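(* Let $U\in\mathcal W(\mathcal M,\mathbf p)$ be the discontinuous Galerkin (DG) solution with starting value $U^0_-\in L_2(\Omega)$, i.e. for every $1\le n\le N$ and every $X\in\mathbb P_{p_n}$, $$\langle U^{n-1}_+-U^{n-1}_-,X^{n-1}_+\rangle+\int_{t_{n-1}}^{t_n}\Big(\langle U',X\rangle+A(\mathcal B_\alpha U,X)\Big)\,dt=\int_{t_{n-1}}^{t_n}\langle f,X\rangle\,dt .$$ Put $d_\alpha=\frac{1}{\cos(\alpha\pi/2)}$ and $g(t)=(I^{-\alpha}f)(t)$. Then for $1\le n\le N$, $$\|U_-^n\|^2+\|U^{n-1}_+\|^2+2\int_0^{t_n}A(\mathcal B_\alpha U,U)\,dt\le 4\|U_-^0\|^2+4\,d_\alpha^2\int_0^{t_n}|\langle g,A^{-1}f\rangle|\,dt .$$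
   Context: Fix $-1<\alpha<0$, $T>0$, a bounded polyhedral domain $\Omega$, and a constant $K>0$ (the diffusivity). $\langle\cdot,\cdot\rangle$ and $\|\cdot\|$ are the inner product and norm of $L_2(\Omega)$. The operator $Au=-\mathrm{div}(K\nabla u)$ with homogeneous Dirichlet boundary conditions is strictly positive definite, with complete orthonormal eigensystem $\{\phi_m\}_{m\ge1}$ in $L_2(\Omega)$, $A\phi_m=\lambda_m\phi_m$, $\phi_m|_{\partial\Omega}=0$, $0<\lambda_1\le\lambda_2\le\cdots$; $A^{-1}$ is its inverse. The associated bilinear form on $H^1_0(\Omega)\times H^1_0(\Omega)$ is $A(v,w)=K\langle\nabla v,\nabla w\rangle=\sum_{m\ge1}\lambda_m\langle v,\phi_m\rangle\langle w,\phi_m\rangle$. With $\omega_{\beta}(t)=t^{\beta-1}/\Gamma(\beta)$ for $\beta>0$, the Riemann–Liouville fractional derivative of order $-\alpha$ is $\mathcal B_\alpha v(t)=\frac{\partial}{\partial t}\int_0^t\omega_{\alpha+1}(t-s)v(s)\,ds$, and the fractional integral is $I^{-\alpha}v(t)=\int_0^t\omega_{-\alpha}(t-s)v(s)\,ds$. The problem being discretized is $u'+\mathcal B_\alpha Au=f$ on $\Omega\times(0,T]$, $u|_{t=0}=u_0$, with homogeneous Dirichlet boundary conditions; $f=f(x,t)$ is a given source term, regular enough that the expressions in the scheme and in the estimate are well defined. $\mathcal M$ is a partition $0=t_0<t_1<\cdots<t_N=T$ with $I_n=(t_{n-1},t_n)$, and $\mathbf p=(p_1,\dots,p_N)$ with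 $p_n\in\mathbb N_0$. $\mathbb P_{p}$ is the space of polynomials in $t$ of degree $\le p$ with coefficients in $H^1_0(\Omega)$, and $\mathcal W(\mathcal M,\mathbf p)=\{v:[0,T]\to H^1_0(\Omega): v|_{I_n}\in\mathbb P_{p_n},\ 1\le n\le N\}$. One writes $v^n_-=v(t_n^-)$, $v^n_+=v(t_n^+)$ for one-sided limits. $U^0_-$ is a prescribed starting value (an approximation of $u_0$), and $U'$ is the time derivative on each $I_n$. *)

theory Defs
  imports "HOL-Analysis.Analysis"
begin

section \<open>Function spaces on a polyhedral domain\<close>

text \<open>
  Elements of \<open>L\<^sub>2(\<Omega>)\<close> are represented by functions on the whole ambient space; only their values on
  \<open>\<Omega>\<close> matter, and functions that agree almost everywhere on \<open>\<Omega>\<close> are not identified. Accordingly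
  all norms below are seminorms.
\<close>

definition polyhedral_domain :: "'a::euclidean_space set \<Rightarrow> bool" where
  "polyhedral_domain \<Omega> \<longleftrightarrow>
     \<Omega> \<noteq> {} \<and> connected \<Omega> \<and>
     (\<exists>F. finite F \<and> (\<forall>P\<in>F. polytope P) \<and> \<Omega> = interior (\<Union>F))"

definition L2_space :: "'a::euclidean_space set \<Rightarrow> ('a \<Rightarrow> 'b::euclidean_space) set" where
  "L2_space \<Omega> = {v \<in> borel_measurable (lebesgue_on \<Omega>). integrable (lebesgue_on \<Omega>) (\<lambda>x. (norm (v x))\<^sup>2)}"

definition L2_inner :: "'a::euclidean_space set \<Rightarrow> ('a \<Rightarrow> 'b::euclidean_space) \<Rightarrow> ('a \<Rightarrow> 'b) \<Rightarrow> real" where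
  "L2_inner \<Omega> v w = (\<integral>x. v x \<bullet> w x \<partial>lebesgue_on \<Omega>)"

definition L2_norm :: "'a::euclidean_space set \<Rightarrow> ('a \<Rightarrow> 'b::euclidean_space) \<Rightarrow> real" where
  "L2_norm \<Omega> v = sqrt (L2_inner \<Omega> v v)"

primrec C_class :: "nat \<Rightarrow> ('a::euclidean_space \<Rightarrow> real) \<Rightarrow> bool" where
  "C_class 0 \<psi> \<longleftrightarrow> continuous_on UNIV \<psi>"
| "C_class (Suc k) \<psi> \<longleftrightarrow>
     (\<forall>x. \<psi> differentiable (at x)) \<and>
     (\<forall>b\<in>Basis. C_class k (\<lambda>x. frechet_derivative \<psi> (at x) b))"

definition test_functions :: "'a::euclidean_space set \<Rightarrow> ('a \<Rightarrow> real) set" where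
  "test_functions \<Omega> =
     {\<psi>. (\<forall>k. C_class k \<psi>) \<and> compact (closure {x. \<psi> x \<noteq> 0}) \<and> closure {x. \<psi> x \<noteq> 0} \<subseteq> \<Omega>}"

definition classical_gradient :: "('a::euclidean_space \<Rightarrow> real) \<Rightarrow> 'a \<Rightarrow> 'a" where
  "classical_gradient \<psi> x = (\<Sum>b\<in>Basis. frechet_derivative \<psi> (at x) b *\<^sub>R b)"

definition is_weak_gradient :: "'a::euclidean_space set \<Rightarrow> ('a \<Rightarrow> real) \<Rightarrow> ('a \<Rightarrow> 'a) \<Rightarrow> bool" where
  "is_weak_gradient \<Omega> v G \<longleftrightarrow>
     (\<forall>\<psi>\<in>test_functions \<Omega>. \<forall>b\<in>Basis.
        (\<integral>x. v x * frechet_derivative \<psi> (at x) b \<partial>lebesgue_on \<Omega>)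
        = - (\<integral>x. (G x \<bullet> b) * \<psi> x \<partial>lebesgue_on \<Omega>))"

definition H1_space :: "'a::euclidean_space set \<Rightarrow> ('a \<Rightarrow> real) set" where
  "H1_space \<Omega> = {v \<in> L2_space \<Omega>. \<exists>G\<in>L2_space \<Omega>. is_weak_gradient \<Omega> v G}"

text \<open>The weak gradient is unique up to a null set, so the choice is immaterial.\<close>

definition weak_gradient :: "'a::euclidean_space set \<Rightarrow> ('a \<Rightarrow> real) \<Rightarrow> 'a \<Rightarrow> 'a" where
  "weak_gradient \<Omega> v = (SOME G. G \<in> L2_space \<Omega> \<and> is_weak_gradient \<Omega> v G)"

definition H10_space :: "'a::euclidean_space set \<Rightarrow> ('a \<Rightarrow> real) set" where
  "H10_space \<Omega> = {v \<in> H1_space \<Omega>.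
     \<exists>\<psi> :: nat \<Rightarrow> 'a \<Rightarrow> real. (\<forall>k. \<psi> k \<in> test_functions \<Omega>) \<and>
       (\<lambda>k. L2_norm \<Omega> (\<lambda>x. \<psi> k x - v x)) \<longlonglongrightarrow> 0 \<and>
       (\<lambda>k. L2_norm \<Omega> (\<lambda>x. classical_gradient (\<psi> k) x - weak_gradient \<Omega> v x)) \<longlonglongrightarrow> 0}"


section \<open>The elliptic operator\<close>

definition energy :: "real \<Rightarrow> 'a::euclidean_space set \<Rightarrow> ('a \<Rightarrow> real) \<Rightarrow> ('a \<Rightarrow> real) \<Rightarrow> real" where
  "energy K \<Omega> v w = K * L2_inner \<Omega> (weak_gradient \<Omega> v) (weak_gradient \<Omega> w)"

text \<open>
  \<open>dirichlet_op K \<Omega> u h\<close>: \<open>u\<close> is in the domain of \<open>A = -div (K \<nabla>\<cdot>)\<close> with homogeneous Dirichlet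
  boundary conditions and \<open>A u = h\<close>, the divergence being taken in the sense of distributions.
\<close>

definition dirichlet_op :: "real \<Rightarrow> 'a::euclidean_space set \<Rightarrow> ('a \<Rightarrow> real) \<Rightarrow> ('a \<Rightarrow> real) \<Rightarrow> bool" where
  "dirichlet_op K \<Omega> u h \<longleftrightarrow>
     u \<in> H10_space \<Omega> \<and> h \<in> L2_space \<Omega> \<and>
     (\<forall>\<psi>\<in>test_functions \<Omega>.
        L2_inner \<Omega> (\<lambda>x. K *\<^sub>R weak_gradient \<Omega> u x) (classical_gradient \<psi>) = L2_inner \<Omega> h \<psi>)"

text \<open>\<open>A\<^sup>-\<^sup>1 h\<close>: the solution of \<open>A u = h\<close>, which is unique up to a null set.\<close>

definition dirichlet_inverse :: "real \<Rightarrow> 'a::euclidean_space set \<Rightarrow> ('a \<Rightarrow> real) \<Rightarrow> 'a \<Rightarrow> real" where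
  "dirichlet_inverse K \<Omega> h = (SOME u. dirichlet_op K \<Omega> u h)"

definition dirichlet_eigensystem ::
  "real \<Rightarrow> 'a::euclidean_space set \<Rightarrow> (nat \<Rightarrow> 'a \<Rightarrow> real) \<Rightarrow> (nat \<Rightarrow> real) \<Rightarrow> bool" where
  "dirichlet_eigensystem K \<Omega> \<phi> lam \<longleftrightarrow>
     0 < lam 1 \<and> (\<forall>m\<ge>1. lam m \<le> lam (Suc m)) \<and>
     (\<forall>m\<ge>1. dirichlet_op K \<Omega> (\<phi> m) (\<lambda>x. lam m * \<phi> m x)) \<and>
     (\<forall>m\<ge>1. \<forall>k\<ge>1. L2_inner \<Omega> (\<phi> m) (\<phi> k) = (if m = k then 1 else 0)) \<and>
     (\<forall>v\<in>L2_space \<Omega>.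
        (\<lambda>M. L2_norm \<Omega> (\<lambda>x. v x - (\<Sum>m=1..M. L2_inner \<Omega> v (\<phi> m) * \<phi> m x))) \<longlonglongrightarrow> 0)"


section \<open>Fractional calculus in time\<close>

definition frac_kernel :: "real \<Rightarrow> real \<Rightarrow> real" where
  "frac_kernel \<beta> t = t powr (\<beta> - 1) / Gamma \<beta>"

definition frac_integral :: "real \<Rightarrow> (real \<Rightarrow> 'a \<Rightarrow> real) \<Rightarrow> real \<Rightarrow> 'a \<Rightarrow> real" where
  "frac_integral \<beta> v t x = (LINT s:{0..t}|lebesgue. frac_kernel \<beta> (t - s) * v s x)"

text \<open>The Riemann--Liouville derivative \<open>B\<^sub>\<alpha>\<close> of order \<open>-\<alpha>\<close>.\<close>

definition RL_derivative :: "real \<Rightarrow> (real \<Rightarrow> 'a \<Rightarrow> real) \<Rightarrow> real \<Rightarrow> 'a \<Rightarrow> real" where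
  "RL_derivative \<alpha> v t x = deriv (\<lambda>r. frac_integral (\<alpha> + 1) v r x) t"


section \<open>The discontinuous Galerkin scheme\<close>

definition time_mesh :: "real \<Rightarrow> nat \<Rightarrow> (nat \<Rightarrow> real) \<Rightarrow> bool" where
  "time_mesh T N t \<longleftrightarrow> t 0 = 0 \<and> t N = T \<and> (\<forall>n<N. t n < t (Suc n))"

definition poly_space :: "'a::euclidean_space set \<Rightarrow> nat \<Rightarrow> (real \<Rightarrow> 'a \<Rightarrow> real) set" where
  "poly_space \<Omega> q =
     {X. \<exists>c. (\<forall>j\<le>q. c j \<in> H10_space \<Omega>) \<and> X = (\<lambda>s x. \<Sum>j\<le>q. s ^ j * c j x)}"

text \<open>
  On each open subinterval one fixed representative of every coefficient is used for all times, so
  that limits and derivatives with respect to time may be taken pointwise in space.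
\<close>

definition dg_space ::
  "'a::euclidean_space set \<Rightarrow> nat \<Rightarrow> (nat \<Rightarrow> real) \<Rightarrow> (nat \<Rightarrow> nat) \<Rightarrow> (real \<Rightarrow> 'a \<Rightarrow> real) set" where
  "dg_space \<Omega> N t p =
     {U. (\<forall>s\<in>{t 0..t N}. U s \<in> H10_space \<Omega>) \<and>
         (\<forall>n\<in>{1..N}. \<exists>X\<in>poly_space \<Omega> (p n). \<forall>s\<in>{t (n - 1)<..<t n}. \<forall>x\<in>\<Omega>. U s x = X s x)}"

definition right_value :: "(real \<Rightarrow> 'a \<Rightarrow> real) \<Rightarrow> real \<Rightarrow> 'a \<Rightarrow> real" where
  "right_value v r x = Lim (at_right r) (\<lambda>s. v s x)"

definition left_value :: "(real \<Rightarrow> 'a \<Rightarrow> real) \<Rightarrow> real \<Rightarrow> 'a \<Rightarrow> real" where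
  "left_value v r x = Lim (at_left r) (\<lambda>s. v s x)"

text \<open>\<open>U\<^sup>n\<^sub>-\<close>; for \<open>n = 0\<close> this is the prescribed starting value, not a limit of \<open>U\<close>.\<close>

definition node_minus ::
  "('a \<Rightarrow> real) \<Rightarrow> (nat \<Rightarrow> real) \<Rightarrow> (real \<Rightarrow> 'a \<Rightarrow> real) \<Rightarrow> nat \<Rightarrow> 'a \<Rightarrow> real" where
  "node_minus U0 t U n = (if n = 0 then U0 else left_value U (t n))"

definition time_derivative :: "(real \<Rightarrow> 'a \<Rightarrow> real) \<Rightarrow> real \<Rightarrow> 'a \<Rightarrow> real" where
  "time_derivative v s x = deriv (\<lambda>r. v r x) s"

text \<open>
  Regularity of the source term: \<open>f\<close> is integrable in time with values in \<open>L\<^sub>2(\<Omega>)\<close>, and the weakly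
  singular double integral belonging to \<open>\<integral> \<langle>I\<^sup>-\<^sup>\<alpha> f, A\<^sup>-\<^sup>1 f\<rangle> dt\<close> converges absolutely in norm.
  Both hold for every \<open>f\<close> that is square integrable in time with values in \<open>L\<^sub>2(\<Omega>)\<close>.
\<close>

definition regular_source ::
  "real \<Rightarrow> real \<Rightarrow> 'a::euclidean_space set \<Rightarrow> (real \<Rightarrow> 'a \<Rightarrow> real) \<Rightarrow> bool" where
  "regular_source \<alpha> T \<Omega> f \<longleftrightarrow>
     (\<lambda>(s, x). f s x) \<in> borel_measurable (lebesgue_on {0..T} \<Otimes>\<^sub>M lebesgue_on \<Omega>) \<and>
     (AE s in lebesgue_on {0..T}. f s \<in> L2_space \<Omega>) \<and>
     set_integrable lebesgue {0..T} (\<lambda>s. L2_norm \<Omega> (f s)) \<and>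
     set_integrable (lebesgue \<Otimes>\<^sub>M lebesgue) {(r, s). 0 < s \<and> s < r \<and> r < T}
       (\<lambda>(r, s). frac_kernel (- \<alpha>) (r - s) * L2_norm \<Omega> (f s) * L2_norm \<Omega> (f r))"

definition dg_solution ::
  "real \<Rightarrow> real \<Rightarrow> 'a::euclidean_space set \<Rightarrow> nat \<Rightarrow> (nat \<Rightarrow> real) \<Rightarrow> (nat \<Rightarrow> nat) \<Rightarrow>
   (real \<Rightarrow> 'a \<Rightarrow> real) \<Rightarrow> ('a \<Rightarrow> real) \<Rightarrow> (real \<Rightarrow> 'a \<Rightarrow> real) \<Rightarrow> bool" where
  "dg_solution \<alpha> K \<Omega> N t p f U0 U \<longleftrightarrow>
     U \<in> dg_space \<Omega> N t p \<and>
     (\<forall>n\<in>{1..N}. \<forall>X\<in>poly_space \<Omega> (p n).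
        L2_inner \<Omega> (\<lambda>x. right_value U (t (n - 1)) x - node_minus U0 t U (n - 1) x)
                    (right_value X (t (n - 1)))
        + (LINT s:{t (n - 1)..t n}|lebesgue.
             L2_inner \<Omega> (time_derivative U s) (X s) + energy K \<Omega> (RL_derivative \<alpha> U s) (X s))
        = (LINT s:{t (n - 1)..t n}|lebesgue. L2_inner \<Omega> (f s) (X s)))"

end

theory Submission
  imports Defs
begin

text \<open>
  Testing the scheme with \<open>X = U\<close> gives, after summation over the subintervals, the energy balance
  \<open>\<parallel>U\<^sup>n\<^sub>-\<parallel>\<^sup>2 + \<Sum>j<n. \<parallel>U\<^sup>j\<^sub>+ - U\<^sup>j\<^sub>-\<parallel>\<^sup>2 + 2 E\<^sub>n = \<parallel>U\<^sup>0\<^sub>-\<parallel>\<^sup>2 + 2 W\<^sub>n\<close>, where \<open>E\<^sub>n = \<integral> A(B\<^sub>\<alpha> U, U)\<close> is the memory energy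
  and \<open>W\<^sub>n = \<integral> \<langle>f, U\<rangle>\<close> the work of the source up to time \<open>t n\<close>. The theorem follows by elementary algebra
  (\<open>stability\<close>) from \<open>E\<^sub>n \<ge> 0\<close> and the work estimate \<open>\<bar>W\<^sub>n\<bar> \<le> d \<surd>G\<^sub>n \<surd>E\<^sub>n\<close> (\<open>source_work_bound\<close>), where
  \<open>G\<^sub>n = \<integral> \<bar>\<langle>g, A\<^sup>-\<^sup>1 f\<rangle>\<bar>\<close>.

  For a single scalar mode the work estimate says that fractional integration is sectorial. Put
  \<open>\<mu> = -\<alpha>\<close> and \<open>Q(F) = \<integral> F I\<^sup>\<mu> F\<close>. A piecewise polynomial \<open>v\<close> with Riemann-Liouville derivative
  \<open>h = B\<^sub>\<alpha> v\<close> satisfies \<open>v = I\<^sup>\<mu> h\<close>, so \<open>\<integral> v B\<^sub>\<alpha> v = Q(h)\<close> and \<open>\<integral> F v = \<integral> F I\<^sup>\<mu> h\<close>. Split \<open>I\<^sup>\<mu>\<close> into two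
  integrals of order \<open>\<mu>/2\<close> and move one of them onto \<open>F\<close>, where it becomes an integral over the future:
  \<open>\<integral> F v\<close> is then an \<open>L\<^sub>2\<close> product over the whole real line. The past and the future
  half-order integral of a function have the same norm, namely \<open>Q / cos (\<pi>\<mu>/2)\<close> after squaring, because
  the correlation of their kernels is the symmetrised kernel of \<open>I\<^sup>\<mu>\<close> divided by \<open>2 cos (\<pi>\<mu>/2)\<close>
  (\<open>causal_kernel_correlation_past\<close>, from the Gamma integral and the reflection formula). The
  Cauchy-Schwarz inequality thus yields the constant \<open>d = 1 / cos (\<alpha>\<pi>/2)\<close> (\<open>frac_form_sector\<close>,
  \<open>spline_duality\<close>).

  The modes are put together by expansion in the eigenfunctions and the Cauchy-Schwarz inequality with
  weights \<open>1 / \<lambda>\<^sub>m\<close> for the source and \<open>\<lambda>\<^sub>m\<close> for the solution. On the source side the sums of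
  \<open>Q(F\<^sub>m) / \<lambda>\<^sub>m\<close> tend to \<open>\<integral> \<langle>g, A\<^sup>-\<^sup>1 f\<rangle>\<close>. On the solution side the modal energies sum to at most \<open>E\<close>
  since the rest is the memory energy of the part of the gradient that the first modes do not see.

  Weak gradients and \<open>A\<^sup>-\<^sup>1\<close> enter the statement through arbitrary choices. These do not matter because the
  eigenfunctions are complete and lie in the closure of the test functions: test functions
  are therefore dense in \<open>L\<^sub>2\<close>, weak gradients are unique, and \<open>A\<^sup>-\<^sup>1\<close> is given by the eigenfunction series.
\<close>

section \<open>The space \<open>L\<^sub>2(\<Omega>)\<close>\<close>

lemma L2_spaceD_measurable: "v \<in> L2_space \<Omega> \<Longrightarrow> v \<in> borel_measurable (lebesgue_on \<Omega>)"
  by (simp add: L2_space_def)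

lemma L2_inner_integrable:
  fixes v w :: "'a::euclidean_space \<Rightarrow> 'b::euclidean_space"
  assumes "v \<in> L2_space \<Omega>" "w \<in> L2_space \<Omega>"
  shows "integrable (lebesgue_on \<Omega>) (\<lambda>x. v x \<bullet> w x)"
proof (rule Bochner_Integration.integrable_bound)
  show "integrable (lebesgue_on \<Omega>) (\<lambda>x. (norm (v x))\<^sup>2 + (norm (w x))\<^sup>2)"
    using assms by (auto simp: L2_space_def)
  show "(\<lambda>x. v x \<bullet> w x) \<in> borel_measurable (lebesgue_on \<Omega>)"
    using assms by (auto simp: L2_space_def)
  have "\<bar>v x \<bullet> w x\<bar> \<le> (norm (v x))\<^sup>2 + (norm (w x))\<^sup>2" for x
  proof -
    have "\<bar>v x \<bullet> w x\<bar> \<le> norm (v x) * norm (w x)"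
      by (rule Cauchy_Schwarz_ineq2)
    also have "\<dots> \<le> (norm (v x))\<^sup>2 + (norm (w x))\<^sup>2"
      using sum_squares_bound[of "norm (v x)" "norm (w x)"]
        mult_nonneg_nonneg[OF norm_ge_zero[of "v x"] norm_ge_zero[of "w x"]] by linarith
    finally show ?thesis .
  qed
  then show "AE x in lebesgue_on \<Omega>. norm (v x \<bullet> w x) \<le> norm ((norm (v x))\<^sup>2 + (norm (w x))\<^sup>2)"
    by simp
qed

lemma L2_space_zero: "(\<lambda>x. 0) \<in> L2_space \<Omega>"
  by (simp add: L2_space_def)

lemma L2_space_scale:
  fixes v :: "'a::euclidean_space \<Rightarrow> 'b::euclidean_space"
  assumes "v \<in> L2_space \<Omega>" shows "(\<lambda>x. c *\<^sub>R v x) \<in> L2_space \<Omega>"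
  using assms by (auto simp: L2_space_def power_mult_distrib)

lemma L2_space_add:
  fixes v w :: "'a::euclidean_space \<Rightarrow> 'b::euclidean_space"
  assumes "v \<in> L2_space \<Omega>" "w \<in> L2_space \<Omega>" shows "(\<lambda>x. v x + w x) \<in> L2_space \<Omega>"
proof -
  have "(norm (v x + w x))\<^sup>2 = (norm (v x))\<^sup>2 + (norm (w x))\<^sup>2 + 2 * (v x \<bullet> w x)" for x
    by (simp add: power2_norm_eq_inner inner_add_left inner_add_right inner_commute)
  then show ?thesis
    using assms L2_inner_integrable[OF assms] by (auto simp: L2_space_def)
qed

lemma L2_space_diff:
  fixes v w :: "'a::euclidean_space \<Rightarrow> 'b::euclidean_space"
  assumes "v \<in> L2_space \<Omega>" "w \<in> L2_space \<Omega>" shows "(\<lambda>x. v x - w x) \<in> L2_space \<Omega>"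
  using L2_space_add[OF assms(1) L2_space_scale[OF assms(2), of "-1"]] by simp

lemma L2_space_sum:
  fixes v :: "'i \<Rightarrow> 'a::euclidean_space \<Rightarrow> 'b::euclidean_space"
  assumes "\<And>i. i \<in> I \<Longrightarrow> v i \<in> L2_space \<Omega>" shows "(\<lambda>x. \<Sum>i\<in>I. v i x) \<in> L2_space \<Omega>"
  using assms by (induction I rule: infinite_finite_induct) (auto intro: L2_space_zero L2_space_add)

lemma L2_space_scale_real:
  assumes "v \<in> L2_space \<Omega>" shows "(\<lambda>x. c * v x :: real) \<in> L2_space \<Omega>"
  using L2_space_scale[OF assms, of c] by simp

lemma L2_inner_cong:
  assumes "\<And>x. x \<in> \<Omega> \<Longrightarrow> v x = v' x" "\<And>x. x \<in> \<Omega> \<Longrightarrow> w x = w' x"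
  shows "L2_inner \<Omega> v w = L2_inner \<Omega> v' w'"
  unfolding L2_inner_def by (rule Bochner_Integration.integral_cong) (auto simp: assms)

lemma L2_space_cong:
  assumes "\<And>x. x \<in> \<Omega> \<Longrightarrow> v x = v' x"
  shows "v \<in> L2_space \<Omega> \<longleftrightarrow> v' \<in> L2_space \<Omega>"
proof -
  have "v \<in> borel_measurable (lebesgue_on \<Omega>) \<longleftrightarrow> v' \<in> borel_measurable (lebesgue_on \<Omega>)"
    by (rule measurable_cong) (auto simp: assms)
  moreover have "integrable (lebesgue_on \<Omega>) (\<lambda>x. (norm (v x))\<^sup>2)
      \<longleftrightarrow> integrable (lebesgue_on \<Omega>) (\<lambda>x. (norm (v' x))\<^sup>2)"
    by (rule Bochner_Integration.integrable_cong) (auto simp: assms)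
  ultimately show ?thesis by (simp add: L2_space_def)
qed

lemma L2_inner_commute: "L2_inner \<Omega> v w = L2_inner \<Omega> w v"
  by (simp add: L2_inner_def inner_commute)

lemma L2_inner_add_left:
  fixes u v w :: "'a::euclidean_space \<Rightarrow> 'b::euclidean_space"
  assumes "u \<in> L2_space \<Omega>" "v \<in> L2_space \<Omega>" "w \<in> L2_space \<Omega>"
  shows "L2_inner \<Omega> (\<lambda>x. u x + v x) w = L2_inner \<Omega> u w + L2_inner \<Omega> v w"
  using assms by (simp add: L2_inner_def inner_add_left L2_inner_integrable)

lemma L2_inner_diff_left:
  fixes u v w :: "'a::euclidean_space \<Rightarrow> 'b::euclidean_space"
  assumes "u \<in> L2_space \<Omega>" "v \<in> L2_space \<Omega>" "w \<in> L2_space \<Omega>"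
  shows "L2_inner \<Omega> (\<lambda>x. u x - v x) w = L2_inner \<Omega> u w - L2_inner \<Omega> v w"
  using assms by (simp add: L2_inner_def inner_diff_left L2_inner_integrable)

lemma L2_inner_diff_right:
  fixes u v w :: "'a::euclidean_space \<Rightarrow> 'b::euclidean_space"
  assumes "u \<in> L2_space \<Omega>" "v \<in> L2_space \<Omega>" "w \<in> L2_space \<Omega>"
  shows "L2_inner \<Omega> w (\<lambda>x. u x - v x) = L2_inner \<Omega> w u - L2_inner \<Omega> w v"
  using L2_inner_diff_left[OF assms] by (simp add: L2_inner_commute)

lemma L2_inner_scale_left:
  "L2_inner \<Omega> (\<lambda>x. c *\<^sub>R v x) w = c * L2_inner \<Omega> v w"
  by (simp add: L2_inner_def)

lemma L2_inner_scale_right: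
  "L2_inner \<Omega> v (\<lambda>x. c *\<^sub>R w x) = c * L2_inner \<Omega> v w"
  by (simp add: L2_inner_def)

lemma L2_inner_scale_left_real:
  "L2_inner \<Omega> (\<lambda>x. c * v x) (w :: _ \<Rightarrow> real) = c * L2_inner \<Omega> v w"
  using L2_inner_scale_left[of \<Omega> c v w] by simp

lemma L2_inner_sum_left:
  fixes v :: "'i \<Rightarrow> 'a::euclidean_space \<Rightarrow> 'b::euclidean_space"
  assumes "\<And>i. i \<in> I \<Longrightarrow> v i \<in> L2_space \<Omega>" "w \<in> L2_space \<Omega>"
  shows "L2_inner \<Omega> (\<lambda>x. \<Sum>i\<in>I. v i x) w = (\<Sum>i\<in>I. L2_inner \<Omega> (v i) w)"
  using assms by (simp add: L2_inner_def inner_sum_left L2_inner_integrable)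

lemma L2_inner_sum_scale_left:
  fixes v :: "'i \<Rightarrow> 'a::euclidean_space \<Rightarrow> 'b::euclidean_space"
  assumes "\<And>i. i \<in> I \<Longrightarrow> v i \<in> L2_space \<Omega>" "w \<in> L2_space \<Omega>"
  shows "L2_inner \<Omega> (\<lambda>x. \<Sum>i\<in>I. a i *\<^sub>R v i x) w = (\<Sum>i\<in>I. a i * L2_inner \<Omega> (v i) w)"
  using assms by (subst L2_inner_sum_left) (auto intro: L2_space_scale simp: L2_inner_scale_left)

lemma L2_inner_sum_scale_right:
  fixes v :: "'i \<Rightarrow> 'a::euclidean_space \<Rightarrow> 'b::euclidean_space"
  assumes "\<And>i. i \<in> I \<Longrightarrow> v i \<in> L2_space \<Omega>" "w \<in> L2_space \<Omega>"
  shows "L2_inner \<Omega> w (\<lambda>x. \<Sum>i\<in>I. a i *\<^sub>R v i x) = (\<Sum>i\<in>I. a i * L2_inner \<Omega> w (v i))"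
  using L2_inner_sum_scale_left[OF assms] by (simp add: L2_inner_commute)

lemma L2_inner_self_nonneg: "0 \<le> L2_inner \<Omega> v v"
  unfolding L2_inner_def by (rule Bochner_Integration.integral_nonneg) simp

lemma L2_norm_nonneg: "0 \<le> L2_norm \<Omega> v"
  by (simp add: L2_norm_def L2_inner_self_nonneg)

lemma L2_norm_power2: "(L2_norm \<Omega> v)\<^sup>2 = L2_inner \<Omega> v v"
  by (simp add: L2_norm_def L2_inner_self_nonneg)

lemma L2_inner_quadratic:
  fixes v w :: "'a::euclidean_space \<Rightarrow> 'b::euclidean_space"
  assumes "v \<in> L2_space \<Omega>" "w \<in> L2_space \<Omega>"
  shows "L2_inner \<Omega> (\<lambda>x. v x - c *\<^sub>R w x) (\<lambda>x. v x - c *\<^sub>R w x)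
    = L2_inner \<Omega> v v - 2 * c * L2_inner \<Omega> v w + c\<^sup>2 * L2_inner \<Omega> w w"
  using assms
  by (simp add: L2_inner_diff_left L2_inner_diff_right L2_space_diff L2_space_scale
      L2_inner_scale_left L2_inner_scale_right L2_inner_commute[of \<Omega> w v] power2_eq_square algebra_simps)

lemma L2_Cauchy_Schwarz:
  fixes v w :: "'a::euclidean_space \<Rightarrow> 'b::euclidean_space"
  assumes "v \<in> L2_space \<Omega>" "w \<in> L2_space \<Omega>"
  shows "\<bar>L2_inner \<Omega> v w\<bar> \<le> L2_norm \<Omega> v * L2_norm \<Omega> w"
proof -
  let ?a = "L2_inner \<Omega> v v" and ?b = "L2_inner \<Omega> v w" and ?c = "L2_inner \<Omega> w w"
  have q: "0 \<le> ?a - 2 * c * ?b + c\<^sup>2 * ?c" for c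
    using L2_inner_self_nonneg[of \<Omega> "\<lambda>x. v x - c *\<^sub>R w x"] L2_inner_quadratic[OF assms] by simp
  have "?b\<^sup>2 \<le> ?a * ?c"
  proof (cases "?c = 0")
    case True
    have "?b = 0"
    proof (rule ccontr)
      assume "?b \<noteq> 0"
      \<comment> \<open>The quadratic is affine with slope \<open>-2b\<close>; at this point it equals \<open>-1\<close>.\<close>
      then show False using q[of "(?a + 1) / (2 * ?b)"] True by simp
    qed
    then show ?thesis using True by simp
  next
    case False
    then have "?c > 0" using L2_inner_self_nonneg[of \<Omega> w] by simp
    \<comment> \<open>The minimiser of the quadratic.\<close>
    then show ?thesis using q[of "?b / ?c"] by (simp add: field_simps power2_eq_square)
  qed
  then have "sqrt (?b\<^sup>2) \<le> sqrt (?a * ?c)" by (rule real_sqrt_le_mono)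
  then show ?thesis by (simp add: L2_norm_def real_sqrt_mult)
qed

lemma L2_norm_triangle:
  fixes v w :: "'a::euclidean_space \<Rightarrow> 'b::euclidean_space"
  assumes "v \<in> L2_space \<Omega>" "w \<in> L2_space \<Omega>"
  shows "L2_norm \<Omega> (\<lambda>x. v x + w x) \<le> L2_norm \<Omega> v + L2_norm \<Omega> w"
proof (rule power2_le_imp_le)
  have "(L2_norm \<Omega> (\<lambda>x. v x + w x))\<^sup>2 = L2_inner \<Omega> v v + 2 * L2_inner \<Omega> v w + L2_inner \<Omega> w w"
    using L2_inner_quadratic[OF assms, of "-1"] by (simp add: L2_norm_power2)
  also have "\<dots> \<le> (L2_norm \<Omega> v + L2_norm \<Omega> w)\<^sup>2"
    using L2_Cauchy_Schwarz[OF assms] by (simp add: power2_sum L2_norm_power2)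
  finally show "(L2_norm \<Omega> (\<lambda>x. v x + w x))\<^sup>2 \<le> (L2_norm \<Omega> v + L2_norm \<Omega> w)\<^sup>2" .
qed (simp add: L2_norm_nonneg)

lemma L2_norm_scale: "L2_norm \<Omega> (\<lambda>x. c *\<^sub>R v x) = \<bar>c\<bar> * L2_norm \<Omega> v"
proof -
  have "L2_inner \<Omega> (\<lambda>x. c *\<^sub>R v x) (\<lambda>x. c *\<^sub>R v x) = c\<^sup>2 * L2_inner \<Omega> v v"
    by (simp add: L2_inner_scale_left L2_inner_scale_right power2_eq_square)
  then show ?thesis by (simp add: L2_norm_def real_sqrt_mult)
qed

lemma L2_norm_triangle_diff:
  fixes u v w :: "'a::euclidean_space \<Rightarrow> 'b::euclidean_space"
  assumes "u \<in> L2_space \<Omega>" "v \<in> L2_space \<Omega>" "w \<in> L2_space \<Omega>"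
  shows "L2_norm \<Omega> (\<lambda>x. u x - w x) \<le> L2_norm \<Omega> (\<lambda>x. u x - v x) + L2_norm \<Omega> (\<lambda>x. v x - w x)"
  using L2_norm_triangle[OF L2_space_diff[OF assms(1,2)] L2_space_diff[OF assms(2,3)]] by simp

lemma L2_norm_minus_commute:
  fixes v w :: "'a::euclidean_space \<Rightarrow> 'b::euclidean_space"
  shows "L2_norm \<Omega> (\<lambda>x. v x - w x) = L2_norm \<Omega> (\<lambda>x. w x - v x)"
  using L2_norm_scale[of \<Omega> "-1" "\<lambda>x. v x - w x"] by simp

lemma L2_inner_tendsto:
  fixes v :: "'a::euclidean_space \<Rightarrow> 'b::euclidean_space"
  assumes "\<And>k. vs k \<in> L2_space \<Omega>" "v \<in> L2_space \<Omega>" "w \<in> L2_space \<Omega>"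
    and "(\<lambda>k::nat. L2_norm \<Omega> (\<lambda>x. vs k x - v x)) \<longlonglongrightarrow> 0"
  shows "(\<lambda>k. L2_inner \<Omega> (vs k) w) \<longlonglongrightarrow> L2_inner \<Omega> v w"
proof -
  have "(\<lambda>k. L2_inner \<Omega> (vs k) w - L2_inner \<Omega> v w) \<longlonglongrightarrow> 0"
  proof (rule Lim_null_comparison)
    show "\<forall>\<^sub>F k in sequentially. norm (L2_inner \<Omega> (vs k) w - L2_inner \<Omega> v w)
        \<le> L2_norm \<Omega> (\<lambda>x. vs k x - v x) * L2_norm \<Omega> w"
      using L2_Cauchy_Schwarz[OF L2_space_diff[OF assms(1,2)] assms(3)]
      by (simp add: L2_inner_diff_left assms)
    show "(\<lambda>k. L2_norm \<Omega> (\<lambda>x. vs k x - v x) * L2_norm \<Omega> w) \<longlonglongrightarrow> 0"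
      using tendsto_mult[OF assms(4) tendsto_const[of "L2_norm \<Omega> w"]] by simp
  qed
  then show ?thesis by (simp add: LIM_zero_iff)
qed

lemma L2_inner_eq_of_norm_diff_zero:
  fixes v :: "'a::euclidean_space \<Rightarrow> 'b::euclidean_space"
  assumes "v \<in> L2_space \<Omega>" "v' \<in> L2_space \<Omega>" "w \<in> L2_space \<Omega>"
    and "L2_norm \<Omega> (\<lambda>x. v x - v' x) = 0"
  shows "L2_inner \<Omega> v w = L2_inner \<Omega> v' w"
  using L2_Cauchy_Schwarz[OF L2_space_diff[OF assms(1,2)] assms(3)] assms
  by (simp add: L2_inner_diff_left)

text \<open>On a set of finite measure an \<open>L\<^sub>2\<close>-Cauchy sequence is \<open>L\<^sub>1\<close>-Cauchy, so a subsequence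
  converges almost everywhere; Fatou's lemma turns the pointwise limit into the \<open>L\<^sub>2\<close>-limit.\<close>

lemma L2_complete:
  fixes v :: "nat \<Rightarrow> 'a::euclidean_space \<Rightarrow> 'b::euclidean_space"
  assumes fin: "\<Omega> \<in> lmeasurable"
    and v: "\<And>k. v k \<in> L2_space \<Omega>"
    and Cauchy: "\<And>e. e > 0 \<Longrightarrow> \<exists>N. \<forall>i\<ge>N. \<forall>j\<ge>N. L2_norm \<Omega> (\<lambda>x. v i x - v j x) < e"
  obtains u where "u \<in> L2_space \<Omega>" "(\<lambda>k. L2_norm \<Omega> (\<lambda>x. v k x - u x)) \<longlonglongrightarrow> 0"
proof -
  let ?M = "lebesgue_on \<Omega>"
  interpret finite_measure ?M
    by (rule finite_measure_lebesgue_on[OF fin])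
  have one: "(\<lambda>x. 1::real) \<in> L2_space \<Omega>"
    by (simp add: L2_space_def)
  have normL2: "(\<lambda>x. norm (w x)) \<in> L2_space \<Omega>" if "w \<in> L2_space \<Omega>" for w :: "'a \<Rightarrow> 'b"
    using that by (auto simp: L2_space_def)
  have normeq: "L2_norm \<Omega> (\<lambda>x. norm (w x)) = L2_norm \<Omega> w" for w :: "'a \<Rightarrow> 'b"
    by (simp add: L2_norm_def L2_inner_def dot_square_norm power2_eq_square)
  have L1: "(LINT x|?M. norm (w x)) \<le> L2_norm \<Omega> w * L2_norm \<Omega> (\<lambda>x. 1::real)"
    if "w \<in> L2_space \<Omega>" for w :: "'a \<Rightarrow> 'b"
    using L2_Cauchy_Schwarz[OF normL2[OF that] one] by (simp add: L2_inner_def normeq)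
  have int: "integrable ?M (v k)" for k
  proof (rule integrable_norm_cancel)
    show "integrable ?M (\<lambda>x. norm (v k x))"
      using L2_inner_integrable[OF normL2[OF v] one, of k] by simp
  qed (rule L2_spaceD_measurable[OF v])
  obtain r where r: "strict_mono r" "AE x in ?M. Cauchy (\<lambda>i. v (r i) x)"
  proof (rule cauchy_L1_AE_cauchy_subseq[of ?M v])
    fix e :: real assume e: "e > 0"
    define C where "C = L2_norm \<Omega> (\<lambda>x::'a. 1::real) + 1"
    have C: "C > 0" using L2_norm_nonneg[of \<Omega> "\<lambda>x::'a. 1::real"] by (simp add: C_def)
    obtain N where N: "\<And>i j. i \<ge> N \<Longrightarrow> j \<ge> N \<Longrightarrow> L2_norm \<Omega> (\<lambda>x. v i x - v j x) < e / C"
      using Cauchy[of "e / C"] e C by auto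
    have "(LINT x|?M. norm (v i x - v j x)) < e" if "i \<ge> N" "j \<ge> N" for i j
    proof -
      have "(LINT x|?M. norm (v i x - v j x)) \<le> L2_norm \<Omega> (\<lambda>x. v i x - v j x) * C"
        using L1[OF L2_space_diff[OF v v], of i j] L2_norm_nonneg[of \<Omega> "\<lambda>x. v i x - v j x"]
        by (simp add: C_def algebra_simps)
      also have "\<dots> < e" using N[OF that] C by (simp add: field_simps)
      finally show ?thesis .
    qed
    then show "\<exists>N. \<forall>i\<ge>N. \<forall>j\<ge>N. (LINT x|?M. norm (v i x - v j x)) < e" by blast
  qed (use int in auto)
  define u where "u = (\<lambda>x. lim (\<lambda>i. v (r i) x))"
  have lim: "AE x in ?M. (\<lambda>i. v (r i) x) \<longlonglongrightarrow> u x"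
    using r(2) by eventually_elim (simp add: u_def Cauchy_convergent_iff convergent_LIMSEQ_iff)
  have vm[measurable]: "v k \<in> borel_measurable ?M" for k
    by (rule L2_spaceD_measurable[OF v])
  have um[measurable]: "u \<in> borel_measurable ?M"
    unfolding u_def by measurable
  have nn: "(\<integral>\<^sup>+x. ennreal ((norm (w x))\<^sup>2) \<partial>?M) = ennreal ((L2_norm \<Omega> w)\<^sup>2)"
    if "w \<in> L2_space \<Omega>" for w :: "'a \<Rightarrow> 'b"
    using that by (subst nn_integral_eq_integral)
      (auto simp: L2_space_def L2_norm_power2 L2_inner_def dot_square_norm)
  have fatou: "(\<integral>\<^sup>+x. ennreal ((norm (v k x - u x))\<^sup>2) \<partial>?M) \<le> ennreal (e\<^sup>2)"
    if e: "e > 0" and k: "\<And>j. j \<ge> N \<Longrightarrow> L2_norm \<Omega> (\<lambda>x. v k x - v j x) < e" for k e N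
  proof -
    have "(\<integral>\<^sup>+x. ennreal ((norm (v k x - u x))\<^sup>2) \<partial>?M)
        = (\<integral>\<^sup>+x. liminf (\<lambda>i. ennreal ((norm (v k x - v (r i) x))\<^sup>2)) \<partial>?M)"
    proof (rule nn_integral_cong_AE)
      show "AE x in ?M. ennreal ((norm (v k x - u x))\<^sup>2)
          = liminf (\<lambda>i. ennreal ((norm (v k x - v (r i) x))\<^sup>2))"
        using lim
      proof eventually_elim
        case (elim x)
        have "(\<lambda>i. ennreal ((norm (v k x - v (r i) x))\<^sup>2)) \<longlonglongrightarrow> ennreal ((norm (v k x - u x))\<^sup>2)"
          by (intro tendsto_intros elim tendsto_ennrealI)
        then show ?case by (rule lim_imp_Liminf[OF sequentially_bot, symmetric])
      qed
    qed
    also have "\<dots> \<le> liminf (\<lambda>i. \<integral>\<^sup>+x. ennreal ((norm (v k x - v (r i) x))\<^sup>2) \<partial>?M)"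
      by (rule nn_integral_liminf) measurable
    also have "\<dots> \<le> ennreal (e\<^sup>2)"
    proof (rule Liminf_le)
      have "\<forall>\<^sub>F i in sequentially. r i \<ge> N"
        using filterlim_subseq[OF r(1)] by (simp add: filterlim_at_top)
      then show "\<forall>\<^sub>F i in sequentially.
          (\<integral>\<^sup>+x. ennreal ((norm (v k x - v (r i) x))\<^sup>2) \<partial>?M) \<le> ennreal (e\<^sup>2)"
      proof eventually_elim
        case (elim i)
        have "(L2_norm \<Omega> (\<lambda>x. v k x - v (r i) x))\<^sup>2 \<le> e\<^sup>2"
          by (rule power_mono[OF less_imp_le[OF k[OF elim]] L2_norm_nonneg])
        then show ?case
          by (subst nn[OF L2_space_diff[OF v v]]) (rule ennreal_leI)
      qed
    qed simp
    finally show ?thesis .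
  qed
  have diffL2: "(\<lambda>x. v k x - u x) \<in> L2_space \<Omega>"
    if e: "e > 0" and k: "\<And>j. j \<ge> N \<Longrightarrow> L2_norm \<Omega> (\<lambda>x. v k x - v j x) < e" for k e N
  proof -
    have "(\<integral>\<^sup>+x. ennreal ((norm (v k x - u x))\<^sup>2) \<partial>?M) \<le> ennreal (e\<^sup>2)"
      by (rule fatou[where N = N, OF e]) (rule k)
    also have "\<dots> < \<infinity>" by (rule ennreal_less_top[folded infinity_ennreal_def])
    finally have "(\<integral>\<^sup>+x. ennreal ((norm (v k x - u x))\<^sup>2) \<partial>?M) < \<infinity>" .
    then have "integrable ?M (\<lambda>x. (norm (v k x - u x))\<^sup>2)"
      by (intro integrableI_nonneg) auto
    then show ?thesis by (simp add: L2_space_def)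
  qed
  obtain N where N: "\<forall>i\<ge>N. \<forall>j\<ge>N. L2_norm \<Omega> (\<lambda>x. v i x - v j x) < 1"
    using Cauchy[OF zero_less_one] by blast
  have "(\<lambda>x. v N x - u x) \<in> L2_space \<Omega>"
    by (rule diffL2[where N = N, OF zero_less_one]) (use N in blast)
  from L2_space_diff[OF v[of N] this] have uL2: "u \<in> L2_space \<Omega>" by simp
  have "(\<lambda>k. L2_norm \<Omega> (\<lambda>x. v k x - u x)) \<longlonglongrightarrow> 0"
  proof (rule LIMSEQ_I)
    fix e :: real assume e: "e > 0"
    obtain N where "\<forall>i\<ge>N. \<forall>j\<ge>N. L2_norm \<Omega> (\<lambda>x. v i x - v j x) < e / 2"
      using Cauchy[OF half_gt_zero[OF e]] by blast
    then have N: "\<And>i j. i \<ge> N \<Longrightarrow> j \<ge> N \<Longrightarrow> L2_norm \<Omega> (\<lambda>x. v i x - v j x) < e / 2" by blast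
    have "norm (L2_norm \<Omega> (\<lambda>x. v k x - u x) - 0) < e" if "k \<ge> N" for k
    proof -
      have "ennreal ((L2_norm \<Omega> (\<lambda>x. v k x - u x))\<^sup>2) \<le> ennreal ((e / 2)\<^sup>2)"
        unfolding nn[OF L2_space_diff[OF v uL2], of k, symmetric]
        by (rule fatou[where N = N]) (use N[OF that] e in auto)
      then have "(L2_norm \<Omega> (\<lambda>x. v k x - u x))\<^sup>2 \<le> (e / 2)\<^sup>2"
        by simp
      then have "L2_norm \<Omega> (\<lambda>x. v k x - u x) \<le> e / 2"
        by (rule power2_le_imp_le) (use e in simp)
      then show ?thesis using e L2_norm_nonneg[of \<Omega> "\<lambda>x. v k x - u x"] by simp
    qed
    then show "\<exists>N. \<forall>k\<ge>N. norm (L2_norm \<Omega> (\<lambda>x. v k x - u x) - 0) < e" by blast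
  qed
  with uL2 show ?thesis by (rule that)
qed

section \<open>Fractional integration kernels\<close>

text \<open>The kernel \<open>\<omega>\<^sub>\<beta>\<close> extended by zero to negative times. The causality \<open>s < r\<close> of a fractional integral is then
  part of the kernel, and all time integrals can be taken over the whole real line.\<close>

definition causal_kernel :: "real \<Rightarrow> real \<Rightarrow> real" where
  "causal_kernel \<beta> r = (if 0 < r then r powr (\<beta> - 1) / Gamma \<beta> else 0)"

lemma causal_kernel_nonneg: "0 < \<beta> \<Longrightarrow> 0 \<le> causal_kernel \<beta> r"
  by (simp add: causal_kernel_def Gamma_real_nonneg)

lemma causal_kernel_measurable[measurable]: "causal_kernel \<beta> \<in> borel_measurable borel"
  unfolding causal_kernel_def by measurable

lemma causal_kernel_nonpos_arg: "r \<le> 0 \<Longrightarrow> causal_kernel \<beta> r = 0"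
  by (simp add: causal_kernel_def)

lemma frac_kernel_eq_causal_kernel: "0 \<le> r \<Longrightarrow> frac_kernel \<beta> r = causal_kernel \<beta> r"
  by (auto simp: frac_kernel_def causal_kernel_def)

lemma Gamma_real_reflection:
  fixes x :: real
  assumes "0 < x" "x < 1"
  shows "Gamma x * Gamma (1 - x) = pi / sin (pi * x)"
proof -
  have "1 - complex_of_real x = of_real (1 - x)" by simp
  from Gamma_reflection_complex[of "complex_of_real x", unfolded this]
  have "complex_of_real (Gamma x * Gamma (1 - x)) = complex_of_real (pi / sin (pi * x))"
    by (simp only: Gamma_complex_of_real sin_of_real flip: of_real_mult of_real_divide)
  then show ?thesis by (rule of_real_eq_iff[THEN iffD1])
qed

lemma nn_integral_Beta_real:
  assumes "a > 0" "b > (0 :: real)"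
  shows "(\<integral>\<^sup>+x. ennreal (indicator {0..1} x * (x powr (a - 1) * (1 - x) powr (b - 1))) \<partial>lborel)
    = ennreal (Beta a b)"
  using nn_integral_has_integral_lebesgue[OF _ has_integral_Beta_real[OF assms]]
  by simp

text \<open>The semigroup law \<open>I\<^sup>a I\<^sup>b = I\<^sup>a\<^sup>+\<^sup>b\<close> at the level of kernels: \<open>u = s + (t - s) x\<close> turns the left-hand side into
  a Beta integral.\<close>

lemma causal_kernel_convolution:
  assumes a: "0 < a" and b: "0 < b"
  shows "(\<integral>\<^sup>+u. ennreal (causal_kernel a (t - u) * causal_kernel b (u - s)) \<partial>lborel)
    = ennreal (causal_kernel (a + b) (t - s))"
proof (cases "s < t")
  case False
  then have "causal_kernel a (t - u) * causal_kernel b (u - s) = 0" for u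
    by (auto simp: causal_kernel_def)
  then have "(\<integral>\<^sup>+u. ennreal (causal_kernel a (t - u) * causal_kernel b (u - s)) \<partial>lborel)
      = (\<integral>\<^sup>+u. 0 \<partial>(lborel :: real measure))"
    by (intro nn_integral_cong) (simp only: ennreal_0)
  then show ?thesis using False by (simp add: causal_kernel_def)
next
  case True
  define r where "r = t - s"
  have r: "r > 0" using True by (simp add: r_def)
  define C where "C = r powr (a + b - 2) / (Gamma a * Gamma b)"
  have C: "C \<ge> 0" using a b by (simp add: C_def Gamma_real_nonneg)
  have "(\<integral>\<^sup>+u. ennreal (causal_kernel a (t - u) * causal_kernel b (u - s)) \<partial>lborel)
      = ennreal \<bar>r\<bar> * (\<integral>\<^sup>+x. ennreal (causal_kernel a (t - (s + r * x)) * causal_kernel b (s + r * x - s)) \<partial>lborel)"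
    using r by (intro nn_integral_real_affine) auto
  also have "(\<integral>\<^sup>+x. ennreal (causal_kernel a (t - (s + r * x)) * causal_kernel b (s + r * x - s)) \<partial>lborel)
      = (\<integral>\<^sup>+x. ennreal C * ennreal (indicator {0..1} x * (x powr (b - 1) * (1 - x) powr (a - 1))) \<partial>lborel)"
  proof (rule nn_integral_cong_AE)
    have "AE x in lborel. x \<noteq> 0 \<and> x \<noteq> (1::real)"
      using AE_lborel_singleton[of "0::real"] AE_lborel_singleton[of "1::real"] by eventually_elim simp
    then show "AE x in lborel. ennreal (causal_kernel a (t - (s + r * x)) * causal_kernel b (s + r * x - s))
       = ennreal C * ennreal (indicator {0..1} x * (x powr (b - 1) * (1 - x) powr (a - 1)))"
    proof eventually_elim
      case (elim x)
      have *: "t - (s + r * x) = r * (1 - x)" by (simp add: r_def algebra_simps)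
      show ?case
      proof (cases "0 < x \<and> x < 1")
        case True
        have "causal_kernel a (r * (1 - x)) * causal_kernel b (r * x)
            = (r powr (a - 1) * r powr (b - 1)) / (Gamma a * Gamma b) * (x powr (b - 1) * (1 - x) powr (a - 1))"
          using True r by (simp add: causal_kernel_def powr_mult)
        also have "r powr (a - 1) * r powr (b - 1) = r powr (a + b - 2)"
          by (simp flip: powr_add add: algebra_simps)
        finally show ?thesis using True C by (simp add: * C_def flip: ennreal_mult')
      next
        case False
        then have "causal_kernel a (r * (1 - x)) * causal_kernel b (r * x) = 0"
          using r by (auto simp: causal_kernel_def zero_less_mult_iff)
        moreover have "indicator {0..1} x = (0::real)" using False elim by (auto simp: indicator_def)
        moreover have "s + r * x - s = r * x" by simp
        ultimately show ?thesis by (simp only: * mult_zero_left mult_zero_right ennreal_0)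
      qed
    qed
  qed
  also have "\<dots> = ennreal C * ennreal (Beta b a)"
    using nn_integral_Beta_real[OF b a] by (simp add: nn_integral_cmult)
  also have "ennreal \<bar>r\<bar> * (ennreal C * ennreal (Beta b a)) = ennreal (r * (C * Beta b a))"
  proof -
    have "0 \<le> Beta b a" using a b by (simp add: Beta_def Gamma_real_nonneg)
    then show ?thesis using C r by (simp flip: ennreal_mult')
  qed
  also have "r * (C * Beta b a) = causal_kernel (a + b) (t - s)"
  proof -
    have "Gamma a \<noteq> 0" "Gamma b \<noteq> 0" using Gamma_real_pos[OF a] Gamma_real_pos[OF b] by auto
    moreover have "r * r powr (a + b - 2) = r powr (a + b - 1)"
      using r powr_add[of r 1 "a + b - 2"] by simp
    ultimately show ?thesis using r
      by (simp add: C_def Beta_def causal_kernel_def r_def[symmetric] field_simps add.commute)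
  qed
  finally show ?thesis .
qed

text \<open>Read from right to left, this writes a negative power of \<open>y\<close> as a superposition of exponentials, the
  form in which it is used below.\<close>

lemma causal_kernel_Laplace:
  assumes b: "0 < b" and y: "0 < y"
  shows "(\<integral>\<^sup>+u. ennreal (causal_kernel b u * exp (- (y * u))) \<partial>lborel) = ennreal (y powr - b)"
proof -
  let ?G = "\<lambda>t. ennreal (indicator {0..} t * t powr (b - 1) / exp t)"
  have "ennreal (Gamma b) = ennreal y * (\<integral>\<^sup>+u. ?G (0 + y * u) \<partial>lborel)"
    using nn_integral_real_affine[of ?G y 0] y Gamma_conv_nn_integral_real[OF b] by simp
  also have "(\<integral>\<^sup>+u. ?G (0 + y * u) \<partial>lborel)
      = (\<integral>\<^sup>+u. ennreal (y powr (b - 1) * Gamma b) * ennreal (causal_kernel b u * exp (- (y * u))) \<partial>lborel)"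
  proof (rule nn_integral_cong_AE)
    show "AE u in lborel. ?G (0 + y * u)
        = ennreal (y powr (b - 1) * Gamma b) * ennreal (causal_kernel b u * exp (- (y * u)))"
      using AE_lborel_singleton[of "0::real"]
    proof eventually_elim
      case (elim u)
      have "Gamma b > 0" by (rule Gamma_real_pos[OF b])
      then show ?case using elim y
        by (cases "0 < u") (auto simp: causal_kernel_def indicator_def powr_mult exp_minus field_simps
            zero_le_mult_iff simp flip: ennreal_mult')
    qed
  qed
  also have "\<dots> = ennreal (y powr (b - 1) * Gamma b)
      * (\<integral>\<^sup>+u. ennreal (causal_kernel b u * exp (- (y * u))) \<partial>lborel)" (is "_ = _ * ?I")
    by (rule nn_integral_cmult) measurable
  finally have *: "ennreal (Gamma b) = ennreal (y powr b * Gamma b) * ?I"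
    using y b powr_add[of y 1 "b - 1"]
    by (simp add: mult.assoc[symmetric] Gamma_real_nonneg flip: ennreal_mult')
  have G: "Gamma b > 0" by (rule Gamma_real_pos[OF b])
  have "ennreal (y powr - b) = ennreal (y powr (-b) / Gamma b) * ennreal (Gamma b)"
    using G by (simp flip: ennreal_mult')
  also have "\<dots> = ennreal (y powr (-b) / Gamma b * (y powr b * Gamma b)) * ?I"
    unfolding * using G by (subst ennreal_mult') (auto simp: mult.assoc)
  also have "y powr (-b) / Gamma b * (y powr b * Gamma b) = 1"
    using G y by (simp add: powr_minus)
  finally show ?thesis by simp
qed

text \<open>The factor \<open>(u + r) powr (b - 1)\<close> is a superposition of the exponentials \<open>exp (- y (u + r))\<close>. After
  exchanging the integrals, the integral over \<open>u\<close> is a Laplace transform in \<open>y\<close>, and what remains is a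
  Laplace transform in \<open>r\<close>. The reflection formula at \<open>b\<close> and at \<open>2 b\<close> reduces the product of
  Gamma values to \<open>1 / (2 cos (\<pi> b))\<close>.\<close>

lemma causal_kernel_correlation_aux:
  assumes b: "0 < b" "b < 1/2" and r: "0 < r"
  shows "(\<integral>\<^sup>+u. ennreal (causal_kernel b u * causal_kernel b (u + r)) \<partial>lborel)
    = ennreal (causal_kernel (2 * b) r / (2 * cos (pi * b)))"
proof -
  have Gb: "Gamma b > 0" "Gamma (1 - b) > 0" "Gamma (1 - 2 * b) > 0" "Gamma (2 * b) > 0"
    using b by (auto intro!: Gamma_real_pos)
  let ?E = "\<lambda>u y. ennreal (causal_kernel b u * (1 / Gamma b) * (causal_kernel (1 - b) y * exp (- (y * (u + r)))))"
  have nn: "0 \<le> causal_kernel b u" "0 \<le> causal_kernel (1 - b) u" "0 \<le> causal_kernel (1 - 2 * b) u" for u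
    using b by (auto intro!: causal_kernel_nonneg)
  have "(\<integral>\<^sup>+u. ennreal (causal_kernel b u * causal_kernel b (u + r)) \<partial>lborel)
      = (\<integral>\<^sup>+u. \<integral>\<^sup>+y. ?E u y \<partial>lborel \<partial>lborel)"
  proof (rule nn_integral_cong)
    fix u :: real
    show "ennreal (causal_kernel b u * causal_kernel b (u + r)) = (\<integral>\<^sup>+y. ?E u y \<partial>lborel)"
    proof (cases "0 < u")
      case False
      then show ?thesis by (simp add: causal_kernel_def)
    next
      case True
      have "(\<integral>\<^sup>+y. ?E u y \<partial>lborel) = ennreal (causal_kernel b u * (1 / Gamma b))
          * (\<integral>\<^sup>+y. ennreal (causal_kernel (1 - b) y * exp (- ((u + r) * y))) \<partial>lborel)"
      proof (subst nn_integral_cmult[symmetric], measurable, rule nn_integral_cong)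
        fix y :: real
        show "?E u y = ennreal (causal_kernel b u * (1 / Gamma b))
            * ennreal (causal_kernel (1 - b) y * exp (- ((u + r) * y)))"
          using Gb nn by (subst ennreal_mult'[symmetric]) (auto simp: mult.commute)
      qed
      also have "\<dots> = ennreal (causal_kernel b u * (1 / Gamma b)) * ennreal ((u + r) powr - (1 - b))"
        using True r b by (subst causal_kernel_Laplace) auto
      also have "\<dots> = ennreal (causal_kernel b u * (1 / Gamma b) * (u + r) powr - (1 - b))"
        using Gb nn by (subst ennreal_mult') auto
      also have "\<dots> = ennreal (causal_kernel b u * causal_kernel b (u + r))"
        using True r by (simp add: causal_kernel_def)
      finally show ?thesis by simp
    qed
  qed
  also have "\<dots> = (\<integral>\<^sup>+y. \<integral>\<^sup>+u. ?E u y \<partial>lborel \<partial>lborel)"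
    by (rule lborel_pair.Fubini') measurable
  also have "\<dots> = (\<integral>\<^sup>+y. ennreal (Gamma (1 - 2 * b) / (Gamma b * Gamma (1 - b)))
      * ennreal (causal_kernel (1 - 2 * b) y * exp (- (r * y))) \<partial>lborel)"
  proof (rule nn_integral_cong)
    fix y :: real
    show "(\<integral>\<^sup>+u. ?E u y \<partial>lborel) = ennreal (Gamma (1 - 2 * b) / (Gamma b * Gamma (1 - b)))
      * ennreal (causal_kernel (1 - 2 * b) y * exp (- (r * y)))"
    proof (cases "0 < y")
      case False
      then show ?thesis by (simp add: causal_kernel_def)
    next
      case True
      have "(\<integral>\<^sup>+u. ?E u y \<partial>lborel)
          = (\<integral>\<^sup>+u. ennreal ((1 / Gamma b) * causal_kernel (1 - b) y * exp (- (r * y)))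
            * ennreal (causal_kernel b u * exp (- (y * u))) \<partial>lborel)"
        using Gb nn by (intro nn_integral_cong)
          (auto simp: algebra_simps exp_add exp_diff exp_minus divide_inverse simp flip: ennreal_mult')
      also have "\<dots> = ennreal ((1 / Gamma b) * causal_kernel (1 - b) y * exp (- (r * y))) * ennreal (y powr - b)"
        using True b by (simp add: nn_integral_cmult causal_kernel_Laplace)
      also have "\<dots> = ennreal ((1 / Gamma b) * causal_kernel (1 - b) y * exp (- (r * y)) * y powr - b)"
        using Gb nn by (simp flip: ennreal_mult')
      also have "(1 / Gamma b) * causal_kernel (1 - b) y * exp (- (r * y)) * y powr - b
          = Gamma (1 - 2 * b) / (Gamma b * Gamma (1 - b)) * (causal_kernel (1 - 2 * b) y * exp (- (r * y)))"
      proof -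
        have "y powr - b * y powr - b = y powr - (2 * b)" by (simp flip: powr_add)
        then show ?thesis using True Gb by (simp add: causal_kernel_def field_simps)
      qed
      finally show ?thesis
        using Gb nn by (subst ennreal_mult'[symmetric]) simp_all
    qed
  qed
  also have "\<dots> = ennreal (Gamma (1 - 2 * b) / (Gamma b * Gamma (1 - b))) * ennreal (r powr - (1 - 2 * b))"
    using b r by (simp add: nn_integral_cmult causal_kernel_Laplace)
  also have "\<dots> = ennreal (Gamma (1 - 2 * b) / (Gamma b * Gamma (1 - b)) * r powr - (1 - 2 * b))"
    using Gb by (subst ennreal_mult'[symmetric]) simp_all
  also have "Gamma (1 - 2 * b) / (Gamma b * Gamma (1 - b)) * r powr - (1 - 2 * b)
      = causal_kernel (2 * b) r / (2 * cos (pi * b))"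
  proof -
    have 1: "Gamma b * Gamma (1 - b) = pi / sin (pi * b)"
      by (rule Gamma_real_reflection) (use b in auto)
    have 2: "Gamma (2 * b) * Gamma (1 - 2 * b) = pi / (2 * sin (pi * b) * cos (pi * b))"
      using Gamma_real_reflection[of "2 * b"] b sin_double[of "pi * b"] by (simp add: mult.left_commute)
    have s: "sin (pi * b) > 0" by (rule sin_gt_zero) (use b in auto)
    have "pi * b < pi * (1/2)" using b by (intro mult_strict_left_mono) auto
    then have c: "cos (pi * b) > 0" using b by (intro cos_gt_zero) auto
    have "Gamma (1 - 2 * b) / (Gamma b * Gamma (1 - b)) = 1 / (Gamma (2 * b) * (2 * cos (pi * b)))"
    proof -
      have "Gamma (1 - 2 * b) = pi / (2 * sin (pi * b) * cos (pi * b)) / Gamma (2 * b)"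
        unfolding 2[symmetric] using Gb by simp
      then show ?thesis unfolding 1 using s c Gb by (simp add: field_simps)
    qed
    then show ?thesis using r by (simp add: causal_kernel_def field_simps)
  qed
  finally show ?thesis .
qed

text \<open>This is where the constant of the stability estimate comes from: with \<open>b = \<mu>/2\<close> the right-hand side is the
  symmetric part of the kernel of \<open>I\<^sup>\<mu>\<close>, divided by \<open>cos (\<pi> \<mu> / 2)\<close>.\<close>

lemma causal_kernel_correlation_past:
  assumes b: "0 < b" "b < 1/2" and ts: "t \<noteq> s"
  shows "(\<integral>\<^sup>+u. ennreal (causal_kernel b (t - u) * causal_kernel b (s - u)) \<partial>lborel)
    = ennreal (causal_kernel (2 * b) \<bar>t - s\<bar> / (2 * cos (pi * b)))"
proof -
  have *: "(\<integral>\<^sup>+u. ennreal (causal_kernel b (t - u) * causal_kernel b (s - u)) \<partial>lborel)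
    = ennreal (causal_kernel (2 * b) (s - t) / (2 * cos (pi * b)))" if "t < s" for t s :: real
  proof -
    have "(\<integral>\<^sup>+u. ennreal (causal_kernel b (t - u) * causal_kernel b (s - u)) \<partial>lborel)
      = ennreal \<bar>-1\<bar> * (\<integral>\<^sup>+w. ennreal (causal_kernel b (t - (t + (-1) * w)) * causal_kernel b (s - (t + (-1) * w))) \<partial>lborel)"
      by (intro nn_integral_real_affine) auto
    also have "\<dots> = (\<integral>\<^sup>+w. ennreal (causal_kernel b w * causal_kernel b (w + (s - t))) \<partial>lborel)"
      by (simp add: algebra_simps)
    finally show ?thesis using causal_kernel_correlation_aux[OF b, of "s - t"] that by simp
  qed
  show ?thesis
    using *[of t s] *[of s t] ts by (cases "t < s") (auto simp: mult.commute abs_if)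
qed

lemma causal_kernel_correlation_future:
  assumes b: "0 < b" "b < 1/2" and ts: "t \<noteq> s"
  shows "(\<integral>\<^sup>+u. ennreal (causal_kernel b (u - t) * causal_kernel b (u - s)) \<partial>lborel)
    = ennreal (causal_kernel (2 * b) \<bar>t - s\<bar> / (2 * cos (pi * b)))"
proof -
  \<comment> \<open>Reversal of time exchanges past and future.\<close>
  have "(\<integral>\<^sup>+u. ennreal (causal_kernel b (u - t) * causal_kernel b (u - s)) \<partial>lborel)
    = ennreal \<bar>-1\<bar> * (\<integral>\<^sup>+w. ennreal (causal_kernel b ((0 + (-1) * w) - t) * causal_kernel b ((0 + (-1) * w) - s)) \<partial>lborel)"
    by (intro nn_integral_real_affine) auto
  also have "\<dots> = (\<integral>\<^sup>+w. ennreal (causal_kernel b ((- t) - w) * causal_kernel b ((- s) - w)) \<partial>lborel)"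
  proof -
    have "(0 + (-1) * w) - c = (- c) - w" for w c :: real by simp
    then show ?thesis by (simp only: abs_minus_cancel abs_one ennreal_1 mult_1_left)
  qed
  also have "\<dots> = ennreal (causal_kernel (2 * b) \<bar>(- t) - (- s)\<bar> / (2 * cos (pi * b)))"
    using ts by (intro causal_kernel_correlation_past b) auto
  finally show ?thesis by (simp add: abs_minus_commute)
qed

section \<open>Fractional integration is sectorial\<close>

text \<open>If a kernel factors as \<open>k(t, s) = \<integral> a(t, u) b(s, u) du\<close>, Fubini's theorem turns its bilinear form into the
  \<open>L\<^sub>2\<close> product of the potentials of \<open>F\<close> and \<open>h\<close>. The triple integral converges absolutely as soon as the
  potentials \<open>A\<close> and \<open>B\<close> of \<open>\<bar>F\<bar>\<close> and \<open>\<bar>h\<bar>\<close> are square integrable, because \<open>A B \<le> A\<^sup>2 + B\<^sup>2\<close>. The kernel only has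
  to factor almost everywhere, which leaves room for its singularity on the diagonal.\<close>

lemma factored_kernel_form:
  fixes a b :: "'t \<Rightarrow> 'u \<Rightarrow> real" and F h :: "'t \<Rightarrow> real" and k :: "'t \<Rightarrow> 't \<Rightarrow> real"
  assumes "sigma_finite_measure M" "sigma_finite_measure L"
    and a[measurable]: "case_prod a \<in> borel_measurable (M \<Otimes>\<^sub>M L)" and b[measurable]: "case_prod b \<in> borel_measurable (M \<Otimes>\<^sub>M L)"
    and [measurable]: "F \<in> borel_measurable M" "h \<in> borel_measurable M" "case_prod k \<in> borel_measurable (M \<Otimes>\<^sub>M M)"
    and nonneg: "\<And>t u. 0 \<le> a t u" "\<And>t u. 0 \<le> b t u" "\<And>t s. 0 \<le> k t s"
    and k: "AE z in M \<Otimes>\<^sub>M M. (\<integral>\<^sup>+u. ennreal (a (fst z) u * b (snd z) u) \<partial>L) = ennreal (k (fst z) (snd z))"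
    and fin_a: "(\<integral>\<^sup>+u. (\<integral>\<^sup>+t. ennreal (a t u * \<bar>F t\<bar>) \<partial>M)\<^sup>2 \<partial>L) < \<infinity>"
    and fin_b: "(\<integral>\<^sup>+u. (\<integral>\<^sup>+t. ennreal (b t u * \<bar>h t\<bar>) \<partial>M)\<^sup>2 \<partial>L) < \<infinity>"
  shows "integrable (M \<Otimes>\<^sub>M M) (\<lambda>(t, s). k t s * F t * h s)"
    and "(\<integral>z. (case z of (t, s) \<Rightarrow> k t s * F t * h s) \<partial>(M \<Otimes>\<^sub>M M))
      = (\<integral>u. (\<integral>t. a t u * F t \<partial>M) * (\<integral>s. b s u * h s \<partial>M) \<partial>L)"
proof -
  interpret M: sigma_finite_measure M by fact
  interpret L: sigma_finite_measure L by fact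
  interpret MM: pair_sigma_finite M M ..
  interpret P: pair_sigma_finite L "M \<Otimes>\<^sub>M M" ..
  have [measurable]: "(\<lambda>z. a (fst z) (snd z)) \<in> borel_measurable (M \<Otimes>\<^sub>M L)"
      "(\<lambda>z. b (fst z) (snd z)) \<in> borel_measurable (M \<Otimes>\<^sub>M L)"
      "(\<lambda>z. k (fst z) (snd z)) \<in> borel_measurable (M \<Otimes>\<^sub>M M)"
    using assms(3,4,7) by (simp_all add: case_prod_unfold)
  have a1[measurable]: "(\<lambda>z. a (f z) (g z)) \<in> borel_measurable N"
    if [measurable]: "f \<in> measurable N M" "g \<in> measurable N L" for f g and N :: "'z measure"
    using measurable_compose[OF measurable_Pair[OF that] a] by simp
  have b1[measurable]: "(\<lambda>z. b (f z) (g z)) \<in> borel_measurable N"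
    if [measurable]: "f \<in> measurable N M" "g \<in> measurable N L" for f g and N :: "'z measure"
    using measurable_compose[OF measurable_Pair[OF that] b] by simp
  define T where "T = (\<lambda>u z. (a (fst z) u * F (fst z)) * (b (snd z) u * h (snd z)))"
  have Tm[measurable]: "case_prod T \<in> borel_measurable (L \<Otimes>\<^sub>M (M \<Otimes>\<^sub>M M))"
    unfolding T_def by measurable
  let ?A = "\<lambda>u. \<integral>\<^sup>+t. ennreal (a t u * \<bar>F t\<bar>) \<partial>M" and ?B = "\<lambda>u. \<integral>\<^sup>+t. ennreal (b t u * \<bar>h t\<bar>) \<partial>M"
  have nnT: "(\<integral>\<^sup>+z. ennreal \<bar>T u z\<bar> \<partial>(M \<Otimes>\<^sub>M M)) = ?A u * ?B u" if "u \<in> space L" for u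
  proof -
    note [measurable] = that
    have "(\<integral>\<^sup>+z. ennreal \<bar>T u z\<bar> \<partial>(M \<Otimes>\<^sub>M M))
        = (\<integral>\<^sup>+t. \<integral>\<^sup>+s. ennreal (a t u * \<bar>F t\<bar>) * ennreal (b s u * \<bar>h s\<bar>) \<partial>M \<partial>M)"
      unfolding T_def using nonneg
      by (subst M.nn_integral_fst[symmetric]) (auto simp: abs_mult simp flip: ennreal_mult')
    also have "\<dots> = ?A u * ?B u"
      by (simp add: nn_integral_cmult nn_integral_multc)
    finally show ?thesis .
  qed
  have AB: "?A u * ?B u \<le> (?A u)\<^sup>2 + (?B u)\<^sup>2" for u
  proof (cases "?A u \<le> ?B u")
    case True
    then have "?A u * ?B u \<le> ?B u * ?B u" by (rule mult_right_mono) simp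
    also have "\<dots> \<le> (?A u)\<^sup>2 + (?B u)\<^sup>2" by (simp add: power2_eq_square)
    finally show ?thesis .
  next
    case False
    then have "?A u * ?B u \<le> ?A u * ?A u" by (intro mult_left_mono) auto
    also have "\<dots> \<le> (?A u)\<^sup>2 + (?B u)\<^sup>2" by (simp add: power2_eq_square)
    finally show ?thesis .
  qed
  have Tint: "integrable (L \<Otimes>\<^sub>M (M \<Otimes>\<^sub>M M)) (case_prod T)"
  proof (rule integrableI_bounded)
    have "(\<integral>\<^sup>+w. ennreal (norm (case_prod T w)) \<partial>(L \<Otimes>\<^sub>M (M \<Otimes>\<^sub>M M)))
        = (\<integral>\<^sup>+u. \<integral>\<^sup>+z. ennreal \<bar>T u z\<bar> \<partial>(M \<Otimes>\<^sub>M M) \<partial>L)"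
      by (subst sigma_finite_measure.nn_integral_fst[OF sigma_finite_pair_measure[OF assms(1,1)], symmetric]) auto
    also have "\<dots> = (\<integral>\<^sup>+u. ?A u * ?B u \<partial>L)"
      by (rule nn_integral_cong) (rule nnT)
    also have "\<dots> \<le> (\<integral>\<^sup>+u. (?A u)\<^sup>2 + (?B u)\<^sup>2 \<partial>L)"
      by (rule nn_integral_mono) (rule AB)
    also have "\<dots> = (\<integral>\<^sup>+u. (?A u)\<^sup>2 \<partial>L) + (\<integral>\<^sup>+u. (?B u)\<^sup>2 \<partial>L)"
      by (rule nn_integral_add) measurable
    also have "\<dots> < \<infinity>" using fin_a fin_b by (simp add: less_top)
    finally show "(\<integral>\<^sup>+w. ennreal (norm (case_prod T w)) \<partial>(L \<Otimes>\<^sub>M (M \<Otimes>\<^sub>M M))) < \<infinity>" .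
  qed measurable
  have inner: "AE z in M \<Otimes>\<^sub>M M. (\<integral>u. T u z \<partial>L) = k (fst z) (snd z) * F (fst z) * h (snd z)"
    using k AE_space
  proof eventually_elim
    case (elim z)
    then have [measurable]: "fst z \<in> space M" "snd z \<in> space M" by (auto simp: space_pair_measure)
    have "(\<integral>u. T u z \<partial>L) = (\<integral>u. (a (fst z) u * b (snd z) u) * (F (fst z) * h (snd z)) \<partial>L)"
      unfolding T_def by (simp add: algebra_simps)
    also have "\<dots> = (\<integral>u. (a (fst z) u * b (snd z) u) \<partial>L) * (F (fst z) * h (snd z))"
      by (rule integral_mult_left_zero)
    also have "(\<integral>u. (a (fst z) u * b (snd z) u) \<partial>L) = k (fst z) (snd z)"
      by (subst integral_eq_nn_integral) (auto simp: nonneg elim)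
    finally show ?case by simp
  qed
  have "integrable (M \<Otimes>\<^sub>M M) (\<lambda>z. \<integral>u. T u z \<partial>L)"
    by (rule P.integrable_snd[OF Tint])
  then show "integrable (M \<Otimes>\<^sub>M M) (\<lambda>(t, s). k t s * F t * h s)"
    by (rule integrable_cong_AE_imp) (use inner in \<open>auto simp: case_prod_unfold eq_commute\<close>)
  have "(\<integral>z. (case z of (t, s) \<Rightarrow> k t s * F t * h s) \<partial>(M \<Otimes>\<^sub>M M)) = (\<integral>z. (\<integral>u. T u z \<partial>L) \<partial>(M \<Otimes>\<^sub>M M))"
    by (rule integral_cong_AE)
      (use inner in \<open>auto simp: case_prod_unfold eq_commute intro!: L.borel_measurable_lebesgue_integral\<close>)
  also have "\<dots> = (\<integral>u. (\<integral>z. T u z \<partial>(M \<Otimes>\<^sub>M M)) \<partial>L)"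
    by (rule P.Fubini_integral[OF Tint])
  also have "\<dots> = (\<integral>u. (\<integral>t. a t u * F t \<partial>M) * (\<integral>s. b s u * h s \<partial>M) \<partial>L)"
  proof (rule integral_cong_AE)
    show "AE u in L. (\<integral>z. T u z \<partial>(M \<Otimes>\<^sub>M M)) = (\<integral>t. a t u * F t \<partial>M) * (\<integral>s. b s u * h s \<partial>M)"
      using P.AE_integrable_fst[OF Tint]
    proof eventually_elim
      case (elim u)
      have "integrable (M \<Otimes>\<^sub>M M) (\<lambda>(t, s). T u (t, s))" using elim by (simp add: case_prod_unfold)
      from MM.integral_fst[OF this]
      have "(\<integral>z. T u z \<partial>(M \<Otimes>\<^sub>M M)) = (\<integral>t. \<integral>s. T u (t, s) \<partial>M \<partial>M)" by (simp add: case_prod_unfold)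
      also have "\<dots> = (\<integral>t. a t u * F t \<partial>M) * (\<integral>s. b s u * h s \<partial>M)"
        by (simp add: T_def)
      finally show ?case .
    qed
  qed measurable
  finally show "(\<integral>z. (case z of (t, s) \<Rightarrow> k t s * F t * h s) \<partial>(M \<Otimes>\<^sub>M M))
      = (\<integral>u. (\<integral>t. a t u * F t \<partial>M) * (\<integral>s. b s u * h s \<partial>M) \<partial>L)" .
qed

text \<open>The bilinear form \<open>\<integral> F I\<^sup>\<mu> h\<close>, written as a double integral so that it makes sense without pointwise
  convergence of the fractional integral.\<close>

definition frac_form :: "real \<Rightarrow> (real \<Rightarrow> real) \<Rightarrow> (real \<Rightarrow> real) \<Rightarrow> real" where
  "frac_form \<mu> F h = (\<integral>(r, s). causal_kernel \<mu> (r - s) * F r * h s \<partial>(lebesgue \<Otimes>\<^sub>M lebesgue))"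

definition frac_admissible :: "real \<Rightarrow> (real \<Rightarrow> real) \<Rightarrow> bool" where
  "frac_admissible \<mu> F \<longleftrightarrow> F \<in> borel_measurable lebesgue \<and>
     integrable (lebesgue \<Otimes>\<^sub>M lebesgue) (\<lambda>(r, s). causal_kernel \<mu> (r - s) * \<bar>F r\<bar> * \<bar>F s\<bar>)"

lemma sigma_finite_lebesgue: "sigma_finite_measure (lebesgue :: 'a::euclidean_space measure)"
proof (unfold_locales, intro exI conjI)
  let ?A = "range (\<lambda>n::nat. cball (0::'a) (real n))"
  show "countable ?A" by simp
  show "?A \<subseteq> sets lebesgue" by auto
  show "\<Union>?A = space lebesgue"
    using real_arch_simple by (fastforce simp: dist_norm)
  show "\<forall>a\<in>?A. emeasure lebesgue a \<noteq> \<infinity>"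
    using emeasure_lborel_cball_finite by (auto simp: less_top)
qed

lemma measurable_fst_lebesgue[measurable]:
  "fst \<in> measurable (lebesgue \<Otimes>\<^sub>M N) (borel :: 'a::euclidean_space measure)"
  by (rule measurable_compose[OF measurable_fst measurable_completion]) simp

lemma measurable_snd_lebesgue[measurable]:
  "snd \<in> measurable (N \<Otimes>\<^sub>M lebesgue) (borel :: 'a::euclidean_space measure)"
  by (rule measurable_compose[OF measurable_snd measurable_completion]) simp

interpretation leb: sigma_finite_measure "lebesgue :: real measure" by (rule sigma_finite_lebesgue)
interpretation leb2: pair_sigma_finite "lebesgue :: real measure" "lebesgue :: real measure" ..

lemma AE_lebesgue_pair_neq:
  "AE z in lebesgue \<Otimes>\<^sub>M (lebesgue :: real measure). fst z \<noteq> (snd z :: real)"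
proof -
  have "AE x in lebesgue. AE y in lebesgue. (x::real) \<noteq> y"
  proof (rule AE_I2)
    fix x :: real
    have "AE y in lebesgue. y \<noteq> x"
      by (rule AE_completion[OF AE_lborel_singleton])
    then show "AE y in lebesgue. x \<noteq> y" by eventually_elim simp
  qed
  then show ?thesis
    by (subst leb2.AE_pair_iff[symmetric]) simp_all
qed


lemma causal_kernel_abs: "causal_kernel \<mu> \<bar>r\<bar> = causal_kernel \<mu> r + causal_kernel \<mu> (- r)"
  by (auto simp: causal_kernel_def)

lemma nn_integral_symmetrized_kernel:
  fixes F :: "real \<Rightarrow> real"
  assumes [measurable]: "F \<in> borel_measurable lebesgue" and "0 < \<mu>"
  shows "(\<integral>\<^sup>+z. ennreal (causal_kernel \<mu> \<bar>fst z - snd z\<bar> * \<bar>F (fst z)\<bar> * \<bar>F (snd z)\<bar>) \<partial>(lebesgue \<Otimes>\<^sub>M lebesgue))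
    = 2 * (\<integral>\<^sup>+z. ennreal (causal_kernel \<mu> (fst z - snd z) * \<bar>F (fst z)\<bar> * \<bar>F (snd z)\<bar>) \<partial>(lebesgue \<Otimes>\<^sub>M lebesgue))"
proof -
  let ?g = "\<lambda>z::real\<times>real. ennreal (causal_kernel \<mu> (fst z - snd z) * \<bar>F (fst z)\<bar> * \<bar>F (snd z)\<bar>)"
  have [measurable]: "(\<lambda>z. F (fst z)) \<in> borel_measurable (lebesgue \<Otimes>\<^sub>M lebesgue)"
      "(\<lambda>z. F (snd z)) \<in> borel_measurable (lebesgue \<Otimes>\<^sub>M lebesgue)"
    by (rule measurable_compose[OF measurable_fst], fact, rule measurable_compose[OF measurable_snd], fact)
  have gm[measurable]: "?g \<in> borel_measurable (lebesgue \<Otimes>\<^sub>M lebesgue)" by measurable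
  have swap: "(\<integral>\<^sup>+z. ?g (snd z, fst z) \<partial>(lebesgue \<Otimes>\<^sub>M lebesgue)) = (\<integral>\<^sup>+z. ?g z \<partial>(lebesgue \<Otimes>\<^sub>M lebesgue))"
  proof -
    have "(\<integral>\<^sup>+z. ?g z \<partial>(lebesgue \<Otimes>\<^sub>M lebesgue))
        = (\<integral>\<^sup>+z. ?g z \<partial>(distr (lebesgue \<Otimes>\<^sub>M lebesgue) (lebesgue \<Otimes>\<^sub>M lebesgue) (\<lambda>(x, y). (y, x))))"
      by (subst leb2.distr_pair_swap[symmetric]) simp
    also have "\<dots> = (\<integral>\<^sup>+z. ?g (snd z, fst z) \<partial>(lebesgue \<Otimes>\<^sub>M lebesgue))"
      by (subst nn_integral_distr) (auto simp: case_prod_unfold)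
    finally show ?thesis by simp
  qed
  have "(\<integral>\<^sup>+z. ennreal (causal_kernel \<mu> \<bar>fst z - snd z\<bar> * \<bar>F (fst z)\<bar> * \<bar>F (snd z)\<bar>) \<partial>(lebesgue \<Otimes>\<^sub>M lebesgue))
     = (\<integral>\<^sup>+z. ?g z + ?g (snd z, fst z) \<partial>(lebesgue \<Otimes>\<^sub>M lebesgue))"
    using causal_kernel_nonneg[OF assms(2)]
    by (intro nn_integral_cong)
      (auto simp: causal_kernel_abs algebra_simps simp flip: ennreal_plus)
  also have "\<dots> = (\<integral>\<^sup>+z. ?g z \<partial>(lebesgue \<Otimes>\<^sub>M lebesgue)) + (\<integral>\<^sup>+z. ?g (snd z, fst z) \<partial>(lebesgue \<Otimes>\<^sub>M lebesgue))"
    by (rule nn_integral_add) measurable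
  finally show ?thesis unfolding swap by (simp add: mult_2)
qed

context
  fixes a :: "real \<Rightarrow> real \<Rightarrow> real" and c \<mu> :: real and F :: "real \<Rightarrow> real"
  assumes am: "case_prod a \<in> borel_measurable (lebesgue \<Otimes>\<^sub>M lebesgue)"
    and a_nonneg: "\<And>t u. 0 \<le> a t u" and c: "0 \<le> c" and mu: "0 < \<mu>"
    and ker: "\<And>t s. t \<noteq> s \<Longrightarrow> (\<integral>\<^sup>+u. ennreal (a t u * a s u) \<partial>lborel) = ennreal (c * causal_kernel \<mu> \<bar>t - s\<bar>)"
    and F: "frac_admissible \<mu> F"
begin

private lemma Fm: "F \<in> borel_measurable lebesgue"
  using F by (simp add: frac_admissible_def)

private lemma ker_AE: "AE z in lebesgue \<Otimes>\<^sub>M lebesgue. (\<integral>\<^sup>+u. ennreal (a (fst z) u * a (snd z) u) \<partial>lebesgue)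
    = ennreal (c * causal_kernel \<mu> \<bar>fst z - snd z\<bar>)"
  using AE_lebesgue_pair_neq by eventually_elim (simp add: ker nn_integral_completion)

text \<open>The two half-order integrals, over the past and over the future, are treated at once: \<open>a\<close> is either kernel,
  and all that matters is its correlation \<open>ker\<close>.\<close>

lemma riesz_potential_finite: "(\<integral>\<^sup>+u. (\<integral>\<^sup>+t. ennreal (a t u * \<bar>F t\<bar>) \<partial>lebesgue)\<^sup>2 \<partial>lebesgue) < \<infinity>"
proof -
  note Fm[measurable]
  interpret P: pair_sigma_finite "lebesgue :: real measure" "lebesgue \<Otimes>\<^sub>M lebesgue :: (real \<times> real) measure"
    by unfold_locales
  have a1[measurable]: "(\<lambda>z. a (f z) (g z)) \<in> borel_measurable N"
    if [measurable]: "f \<in> measurable N lebesgue" "g \<in> measurable N lebesgue" for f g and N :: "'z measure"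
    using measurable_compose[OF measurable_Pair[OF that] am] by simp
  have [measurable]: "(\<lambda>z. F (f z)) \<in> borel_measurable N"
    if "f \<in> measurable N lebesgue" for f and N :: "'z measure"
    by (rule measurable_compose[OF that Fm])
  have "(\<integral>\<^sup>+u. (\<integral>\<^sup>+t. ennreal (a t u * \<bar>F t\<bar>) \<partial>lebesgue)\<^sup>2 \<partial>lebesgue)
      = (\<integral>\<^sup>+u. \<integral>\<^sup>+z. ennreal (a (fst z) u * \<bar>F (fst z)\<bar>) * ennreal (a (snd z) u * \<bar>F (snd z)\<bar>) \<partial>(lebesgue \<Otimes>\<^sub>M lebesgue) \<partial>lebesgue)"
    by (rule nn_integral_cong, subst leb.nn_integral_fst[symmetric])
      (simp_all add: nn_integral_cmult nn_integral_multc power2_eq_square)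
  also have "\<dots> = (\<integral>\<^sup>+z. \<integral>\<^sup>+u. ennreal (a (fst z) u * \<bar>F (fst z)\<bar>) * ennreal (a (snd z) u * \<bar>F (snd z)\<bar>) \<partial>lebesgue \<partial>(lebesgue \<Otimes>\<^sub>M lebesgue))"
    by (rule P.Fubini'[symmetric]) measurable
  also have "\<dots> = (\<integral>\<^sup>+z. ennreal c * ennreal (causal_kernel \<mu> \<bar>fst z - snd z\<bar> * \<bar>F (fst z)\<bar> * \<bar>F (snd z)\<bar>) \<partial>(lebesgue \<Otimes>\<^sub>M lebesgue))"
  proof (rule nn_integral_cong_AE)
    show "AE z in lebesgue \<Otimes>\<^sub>M lebesgue.
        (\<integral>\<^sup>+u. ennreal (a (fst z) u * \<bar>F (fst z)\<bar>) * ennreal (a (snd z) u * \<bar>F (snd z)\<bar>) \<partial>lebesgue)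
        = ennreal c * ennreal (causal_kernel \<mu> \<bar>fst z - snd z\<bar> * \<bar>F (fst z)\<bar> * \<bar>F (snd z)\<bar>)"
      using ker_AE
    proof eventually_elim
      case (elim z)
      have "(\<integral>\<^sup>+u. ennreal (a (fst z) u * \<bar>F (fst z)\<bar>) * ennreal (a (snd z) u * \<bar>F (snd z)\<bar>) \<partial>lebesgue)
          = (\<integral>\<^sup>+u. ennreal (\<bar>F (fst z)\<bar> * \<bar>F (snd z)\<bar>) * ennreal (a (fst z) u * a (snd z) u) \<partial>lebesgue)"
        using a_nonneg by (intro nn_integral_cong) (simp add: algebra_simps flip: ennreal_mult')
      also have "\<dots> = ennreal (\<bar>F (fst z)\<bar> * \<bar>F (snd z)\<bar>) * ennreal (c * causal_kernel \<mu> \<bar>fst z - snd z\<bar>)"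
        unfolding elim[symmetric] by (rule nn_integral_cmult) measurable
      also have "\<dots> = ennreal c * ennreal (causal_kernel \<mu> \<bar>fst z - snd z\<bar> * \<bar>F (fst z)\<bar> * \<bar>F (snd z)\<bar>)"
        using c causal_kernel_nonneg[OF mu] by (simp add: algebra_simps flip: ennreal_mult')
      finally show ?case .
    qed
  qed
  also have "\<dots> = ennreal c * (2 * (\<integral>\<^sup>+z. ennreal (causal_kernel \<mu> (fst z - snd z) * \<bar>F (fst z)\<bar> * \<bar>F (snd z)\<bar>) \<partial>(lebesgue \<Otimes>\<^sub>M lebesgue)))"
    by (subst nn_integral_cmult) (measurable, simp add: nn_integral_symmetrized_kernel mu Fm)
  also have "\<dots> < \<infinity>"
  proof -
    have "(\<integral>\<^sup>+z. ennreal (causal_kernel \<mu> (fst z - snd z) * \<bar>F (fst z)\<bar> * \<bar>F (snd z)\<bar>) \<partial>(lebesgue \<Otimes>\<^sub>M lebesgue)) < \<infinity>"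
      using F causal_kernel_nonneg[OF mu]
      by (auto simp: frac_admissible_def integrable_iff_bounded case_prod_unfold abs_mult)
    then show ?thesis by (auto simp: ennreal_mult_less_top)
  qed
  finally show ?thesis .
qed

text \<open>The correlation kernel is symmetric while \<open>frac_form\<close> only sees the triangle \<open>s < t\<close>, hence the factor \<open>2\<close>.\<close>

lemma riesz_potential_square:
  shows "(\<integral>u. (\<integral>t. a t u * F t \<partial>lebesgue)\<^sup>2 \<partial>lebesgue) = 2 * c * frac_form \<mu> F F"
    and "integrable lebesgue (\<lambda>u. (\<integral>t. a t u * F t \<partial>lebesgue)\<^sup>2)"
    and "(\<lambda>u. \<integral>t. a t u * F t \<partial>lebesgue) \<in> borel_measurable lebesgue"
proof -
  note Fm[measurable]
  have a1[measurable]: "(\<lambda>z. a (f z) (g z)) \<in> borel_measurable N"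
    if [measurable]: "f \<in> measurable N lebesgue" "g \<in> measurable N lebesgue" for f g and N :: "'z measure"
    using measurable_compose[OF measurable_Pair[OF that] am] by simp
  have [measurable]: "(\<lambda>z. F (f z)) \<in> borel_measurable N"
    if "f \<in> measurable N lebesgue" for f and N :: "'z measure"
    by (rule measurable_compose[OF that Fm])
  show m[measurable]: "(\<lambda>u. \<integral>t. a t u * F t \<partial>lebesgue) \<in> borel_measurable lebesgue"
    by (rule leb.borel_measurable_lebesgue_integral) measurable
  have "(\<integral>\<^sup>+u. ennreal (norm ((\<integral>t. a t u * F t \<partial>lebesgue)\<^sup>2)) \<partial>lebesgue)
      \<le> (\<integral>\<^sup>+u. (\<integral>\<^sup>+t. ennreal (a t u * \<bar>F t\<bar>) \<partial>lebesgue)\<^sup>2 \<partial>lebesgue)"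
  proof (rule nn_integral_mono)
    fix u :: real
    have "ennreal \<bar>\<integral>t. a t u * F t \<partial>lebesgue\<bar> \<le> (\<integral>\<^sup>+t. ennreal (a t u * \<bar>F t\<bar>) \<partial>lebesgue)"
    proof (cases "integrable lebesgue (\<lambda>t. a t u * F t)")
      case True
      from integral_norm_bound_ennreal[OF this] show ?thesis
        using a_nonneg by (simp add: abs_mult)
    qed (simp add: not_integrable_integral_eq)
    from power_mono[OF this, of 2]
    show "ennreal (norm ((\<integral>t. a t u * F t \<partial>lebesgue)\<^sup>2)) \<le> (\<integral>\<^sup>+t. ennreal (a t u * \<bar>F t\<bar>) \<partial>lebesgue)\<^sup>2"
      by (simp add: ennreal_power)
  qed
  also have "\<dots> < \<infinity>" by (rule riesz_potential_finite)
  finally show "integrable lebesgue (\<lambda>u. (\<integral>t. a t u * F t \<partial>lebesgue)\<^sup>2)"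
    by (intro integrableI_bounded) measurable
  let ?k = "\<lambda>t s. c * causal_kernel \<mu> \<bar>t - s\<bar>"
  have km: "case_prod ?k \<in> borel_measurable (lebesgue \<Otimes>\<^sub>M lebesgue)" by measurable
  have knn: "0 \<le> ?k t s" for t s using c causal_kernel_nonneg[OF mu] by simp
  note fk = factored_kernel_form[OF sigma_finite_lebesgue sigma_finite_lebesgue am am Fm Fm km a_nonneg a_nonneg knn
      ker_AE riesz_potential_finite riesz_potential_finite]
  have int: "integrable (lebesgue \<Otimes>\<^sub>M lebesgue) (\<lambda>(r, s). causal_kernel \<mu> (r - s) * F r * F s)"
    using F causal_kernel_nonneg[OF mu]
    by (auto simp: frac_admissible_def case_prod_unfold abs_mult intro: Bochner_Integration.integrable_bound)
  have int': "integrable (lebesgue \<Otimes>\<^sub>M lebesgue) (\<lambda>(r, s). causal_kernel \<mu> (s - r) * F s * F r)"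
    using leb2.integrable_product_swap[OF int] by (simp add: case_prod_unfold)
  have "(\<integral>u. (\<integral>t. a t u * F t \<partial>lebesgue)\<^sup>2 \<partial>lebesgue)
      = (\<integral>z. (case z of (t, s) \<Rightarrow> ?k t s * F t * F s) \<partial>(lebesgue \<Otimes>\<^sub>M lebesgue))"
    unfolding fk(2) by (simp add: power2_eq_square)
  also have "\<dots> = (\<integral>z. c * ((case z of (r, s) \<Rightarrow> causal_kernel \<mu> (r - s) * F r * F s)
      + (case z of (r, s) \<Rightarrow> causal_kernel \<mu> (s - r) * F s * F r)) \<partial>(lebesgue \<Otimes>\<^sub>M lebesgue))"
    by (rule Bochner_Integration.integral_cong) (auto simp: causal_kernel_abs algebra_simps)
  also have "\<dots> = c * (frac_form \<mu> F F + (\<integral>(r, s). causal_kernel \<mu> (s - r) * F s * F r \<partial>(lebesgue \<Otimes>\<^sub>M lebesgue)))"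
    using int int' by (simp add: frac_form_def)
  also have "(\<integral>(r, s). causal_kernel \<mu> (s - r) * F s * F r \<partial>(lebesgue \<Otimes>\<^sub>M lebesgue)) = frac_form \<mu> F F"
    using leb2.integral_product_swap[OF borel_measurable_integrable[OF int]]
    by (simp add: frac_form_def case_prod_unfold)
  finally show "(\<integral>u. (\<integral>t. a t u * F t \<partial>lebesgue)\<^sup>2 \<partial>lebesgue) = 2 * c * frac_form \<mu> F F" by simp
qed

end

text \<open>With \<open>b = \<mu>/2\<close>, the semigroup law factors the kernel of \<open>I\<^sup>\<mu>\<close> through an intermediate time \<open>u\<close>. So \<open>frac_form \<mu> F h\<close>
  is the \<open>L\<^sub>2\<close> product of the potential \<open>P\<close> of \<open>F\<close>, integrating over the future of \<open>u\<close>, and the potential \<open>R\<close> of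
  \<open>h\<close>, integrating over its past. Their squared norms are \<open>frac_form \<mu> F F\<close> and \<open>frac_form \<mu> h h\<close> divided by
  \<open>cos (\<pi> b)\<close>, and the bound is the Cauchy-Schwarz inequality for \<open>P\<close> and \<open>R\<close>.\<close>

theorem frac_form_sector:
  assumes mu: "0 < \<mu>" "\<mu> < 1" and F: "frac_admissible \<mu> F" and h: "frac_admissible \<mu> h"
  shows "integrable (lebesgue \<Otimes>\<^sub>M lebesgue) (\<lambda>(r, s). causal_kernel \<mu> (r - s) * F r * h s)"
    and "0 \<le> frac_form \<mu> F F"
    and "\<bar>frac_form \<mu> F h\<bar> \<le> 1 / cos (\<mu> * pi / 2) * sqrt (frac_form \<mu> F F) * sqrt (frac_form \<mu> h h)"
proof -
  define b where "b = \<mu> / 2"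
  have b: "0 < b" "b < 1/2" "2 * b = \<mu>" "b + b = \<mu>" using mu by (auto simp: b_def)
  have cospos: "cos (pi * b) > 0"
  proof -
    have "pi * b < pi * (1/2)" using b by (intro mult_strict_left_mono) auto
    then show ?thesis using b by (intro cos_gt_zero) auto
  qed
  have d: "cos (\<mu> * pi / 2) = cos (pi * b)" by (simp add: b_def mult.commute)
  let ?a = "\<lambda>t u. causal_kernel b (t - u)" and ?b = "\<lambda>t u. causal_kernel b (u - t)"
  define c where "c = 1 / (2 * cos (pi * b))"
  have c: "0 \<le> c" using cospos by (simp add: c_def)
  have ma: "case_prod ?a \<in> borel_measurable (lebesgue \<Otimes>\<^sub>M lebesgue)" by measurable
  have mb: "case_prod ?b \<in> borel_measurable (lebesgue \<Otimes>\<^sub>M lebesgue)" by measurable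
  have nn: "0 \<le> causal_kernel b r" for r by (rule causal_kernel_nonneg[OF b(1)])
  have ka: "t \<noteq> s \<Longrightarrow> (\<integral>\<^sup>+u. ennreal (?a t u * ?a s u) \<partial>lborel) = ennreal (c * causal_kernel \<mu> \<bar>t - s\<bar>)" for t s
    using causal_kernel_correlation_past[OF b(1,2)] b by (simp add: c_def)
  have kb: "t \<noteq> s \<Longrightarrow> (\<integral>\<^sup>+u. ennreal (?b t u * ?b s u) \<partial>lborel) = ennreal (c * causal_kernel \<mu> \<bar>t - s\<bar>)" for t s
    using causal_kernel_correlation_future[OF b(1,2)] b by (simp add: c_def)
  have Fm: "F \<in> borel_measurable lebesgue" and hm: "h \<in> borel_measurable lebesgue"
    using F h by (auto simp: frac_admissible_def)
  let ?P = "\<lambda>u. \<integral>t. ?a t u * F t \<partial>lebesgue" and ?R = "\<lambda>u. \<integral>t. ?b t u * h t \<partial>lebesgue"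
  note Fsq = riesz_potential_square[OF ma nn c mu(1) ka F]
  note hsq = riesz_potential_square[OF mb nn c mu(1) kb h]
  have km: "case_prod (\<lambda>t s. causal_kernel \<mu> (t - s)) \<in> borel_measurable (lebesgue \<Otimes>\<^sub>M lebesgue)" by measurable
  have kconv: "AE z in lebesgue \<Otimes>\<^sub>M lebesgue. (\<integral>\<^sup>+u. ennreal (?a (fst z) u * ?b (snd z) u) \<partial>lebesgue)
      = ennreal (causal_kernel \<mu> (fst z - snd z))"
    by (simp add: nn_integral_completion causal_kernel_convolution b)
  note fk = factored_kernel_form[OF sigma_finite_lebesgue sigma_finite_lebesgue ma mb Fm hm km nn nn
      causal_kernel_nonneg[OF mu(1)] kconv riesz_potential_finite[OF ma nn c mu(1) ka F]
      riesz_potential_finite[OF mb nn c mu(1) kb h]]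
  show "integrable (lebesgue \<Otimes>\<^sub>M lebesgue) (\<lambda>(r, s). causal_kernel \<mu> (r - s) * F r * h s)"
    by (rule fk(1))
  have Q: "frac_form \<mu> F F = cos (pi * b) * (\<integral>u. (?P u)\<^sup>2 \<partial>lebesgue)"
      "frac_form \<mu> h h = cos (pi * b) * (\<integral>u. (?R u)\<^sup>2 \<partial>lebesgue)"
    using Fsq(1) hsq(1) cospos by (simp_all add: c_def)
  show "0 \<le> frac_form \<mu> F F"
    unfolding Q using cospos by (intro mult_nonneg_nonneg Bochner_Integration.integral_nonneg) auto
  have L2: "?P \<in> L2_space UNIV" "?R \<in> L2_space UNIV"
    using Fsq(2,3) hsq(2,3) by (simp_all add: L2_space_def lebesgue_on_UNIV_eq)
  have "\<bar>frac_form \<mu> F h\<bar> = \<bar>L2_inner UNIV ?P ?R\<bar>"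
    using fk(2) by (simp add: frac_form_def L2_inner_def lebesgue_on_UNIV_eq)
  also have "\<dots> \<le> L2_norm UNIV ?P * L2_norm UNIV ?R"
    by (rule L2_Cauchy_Schwarz[OF L2])
  also have "L2_norm UNIV ?P = sqrt (frac_form \<mu> F F / cos (pi * b))"
    using cospos by (simp add: L2_norm_def L2_inner_def lebesgue_on_UNIV_eq Q power2_eq_square)
  also have "L2_norm UNIV ?R = sqrt (frac_form \<mu> h h / cos (pi * b))"
    using cospos by (simp add: L2_norm_def L2_inner_def lebesgue_on_UNIV_eq Q power2_eq_square)
  finally show "\<bar>frac_form \<mu> F h\<bar> \<le> 1 / cos (\<mu> * pi / 2) * sqrt (frac_form \<mu> F F) * sqrt (frac_form \<mu> h h)"
    using cospos by (simp add: d real_sqrt_divide)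
qed

section \<open>Piecewise polynomials in time\<close>

text \<open>Piecewise polynomials in time are combinations of these functions, jumps included (\<open>k = 0\<close>), and up to
  the factor \<open>fact k\<close> they are fractional kernels, so that the semigroup law gives all their fractional
  integrals in closed form.\<close>

definition trunc_power :: "real \<Rightarrow> nat \<Rightarrow> real \<Rightarrow> real" where
  "trunc_power a k r = (if a < r then (r - a) ^ k else 0)"

text \<open>The Riemann-Liouville derivative of order \<open>\<mu>\<close> of a truncated power.\<close>

definition trunc_power_RL :: "real \<Rightarrow> real \<Rightarrow> nat \<Rightarrow> real \<Rightarrow> real" where
  "trunc_power_RL \<mu> a k r = fact k * causal_kernel (real k + 1 - \<mu>) (r - a)"

lemma trunc_power_eq_causal_kernel:
  "trunc_power a k r = fact k * causal_kernel (real k + 1) (r - a)"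
  using Gamma_fact[of k, where 'a = real]
  by (simp add: trunc_power_def causal_kernel_def powr_realpow add.commute)

lemma borel_imp_lebesgue_measurable: "f \<in> borel_measurable borel \<Longrightarrow> f \<in> borel_measurable lebesgue"
  by (rule measurable_completion) simp

lemma set_integrable_sum:
  fixes f :: "'i \<Rightarrow> 'a \<Rightarrow> real"
  assumes "\<And>i. i \<in> I \<Longrightarrow> set_integrable M A (f i)"
  shows "set_integrable M A (\<lambda>x. \<Sum>i\<in>I. f i x)"
  using assms unfolding set_integrable_def scaleR_sum_right by (rule Bochner_Integration.integrable_sum)

lemma set_integral_sum:
  fixes f :: "'i \<Rightarrow> 'a \<Rightarrow> real"
  assumes "\<And>i. i \<in> I \<Longrightarrow> set_integrable M A (f i)"
  shows "(LINT x:A|M. (\<Sum>i\<in>I. f i x)) = (\<Sum>i\<in>I. LINT x:A|M. f i x)"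
  using assms unfolding set_integrable_def set_lebesgue_integral_def scaleR_sum_right
  by (rule Bochner_Integration.integral_sum)

lemma trunc_power_measurable[measurable]: "trunc_power a k \<in> borel_measurable borel"
  unfolding trunc_power_def by measurable

lemma trunc_power_RL_measurable[measurable]: "trunc_power_RL \<mu> a k \<in> borel_measurable borel"
  unfolding trunc_power_RL_def by measurable

lemma trunc_power_nonneg: "0 \<le> trunc_power a k r"
  by (simp add: trunc_power_def)

lemma trunc_power_RL_nonneg: "\<mu> < 1 \<Longrightarrow> 0 \<le> trunc_power_RL \<mu> a k r"
  by (simp add: trunc_power_RL_def causal_kernel_nonneg)

lemma trunc_power_bound:
  assumes "0 \<le> a" "r \<le> \<tau>"
  shows "trunc_power a k r \<le> (1 + \<bar>\<tau>\<bar>) ^ k"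
proof (cases "a < r")
  case True
  then have "(r - a) ^ k \<le> (1 + \<bar>\<tau>\<bar>) ^ k" using assms by (intro power_mono) auto
  then show ?thesis using True by (simp add: trunc_power_def)
qed (simp add: trunc_power_def)

lemma causal_kernel_convolution_integral:
  assumes a: "0 < a" and b: "0 < b"
  shows "integrable lebesgue (\<lambda>u. causal_kernel a (t - u) * causal_kernel b (u - s))"
    and "(\<integral>u. causal_kernel a (t - u) * causal_kernel b (u - s) \<partial>lebesgue) = causal_kernel (a + b) (t - s)"
proof -
  let ?f = "\<lambda>u. causal_kernel a (t - u) * causal_kernel b (u - s)"
  have nn: "0 \<le> ?f u" for u using causal_kernel_nonneg[OF a] causal_kernel_nonneg[OF b] by simp
  have m: "?f \<in> borel_measurable lborel" by measurable
  have conv: "(\<integral>\<^sup>+u. ennreal (?f u) \<partial>lborel) = ennreal (causal_kernel (a + b) (t - s))"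
    by (rule causal_kernel_convolution[OF a b])
  have i: "integrable lborel ?f"
    by (rule integrableI_nonneg[OF m]) (use nn conv in auto)
  then show "integrable lebesgue ?f" by (simp add: integrable_completion m)
  have "0 \<le> causal_kernel (a + b) (t - s)" using a b by (simp add: causal_kernel_nonneg)
  then have "(\<integral>u. ?f u \<partial>lborel) = causal_kernel (a + b) (t - s)"
    by (subst integral_eq_nn_integral[OF m]) (use nn conv in auto)
  then show "(\<integral>u. ?f u \<partial>lebesgue) = causal_kernel (a + b) (t - s)"
    by (simp add: integral_completion m)
qed

lemma frac_integral_trunc_power:
  assumes \<beta>: "0 < \<beta>" and a: "0 \<le> a"
  shows "set_integrable lebesgue {0..r} (\<lambda>s. frac_kernel \<beta> (r - s) * trunc_power a k s)"
    and "(LINT s:{0..r}|lebesgue. frac_kernel \<beta> (r - s) * trunc_power a k s)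
      = fact k * causal_kernel (\<beta> + (real k + 1)) (r - a)"
proof -
  have eq: "indicator {0..r} s *\<^sub>R (frac_kernel \<beta> (r - s) * trunc_power a k s)
      = fact k * (causal_kernel \<beta> (r - s) * causal_kernel (real k + 1) (s - a))" for s
    using a by (cases "s \<in> {0..r}")
      (auto simp: trunc_power_eq_causal_kernel frac_kernel_eq_causal_kernel causal_kernel_nonpos_arg)
  have "0 < real k + 1" by simp
  note conv = causal_kernel_convolution_integral[OF \<beta> this, of r a]
  show "set_integrable lebesgue {0..r} (\<lambda>s. frac_kernel \<beta> (r - s) * trunc_power a k s)"
    unfolding set_integrable_def eq by (rule integrable_mult_right[OF conv(1)])
  show "(LINT s:{0..r}|lebesgue. frac_kernel \<beta> (r - s) * trunc_power a k s)
      = fact k * causal_kernel (\<beta> + (real k + 1)) (r - a)"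
    unfolding set_lebesgue_integral_def eq using conv by simp
qed

lemma has_derivative_frac_integral_trunc_power:
  assumes \<mu>: "\<mu> < 1" and r: "r \<noteq> a"
  shows "((\<lambda>r. fact k * causal_kernel ((1 - \<mu>) + (real k + 1)) (r - a)) has_real_derivative trunc_power_RL \<mu> a k r) (at r)"
proof (cases "r < a")
  case True
  have "((\<lambda>r. 0::real) has_real_derivative 0) (at r)" by simp
  then have "((\<lambda>r. fact k * causal_kernel ((1 - \<mu>) + (real k + 1)) (r - a)) has_real_derivative 0) (at r)"
    by (rule has_field_derivative_transform_within_open[where S = "{..<a}"])
      (use True in \<open>auto simp: causal_kernel_nonpos_arg\<close>)
  then show ?thesis using True by (simp add: trunc_power_RL_def causal_kernel_nonpos_arg)
next
  case False
  then have ra: "a < r" using r by simp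
  define \<gamma> where "\<gamma> = real k + 1 - \<mu>"
  have g: "\<gamma> > 0" using \<mu> by (simp add: \<gamma>_def)
  have nn: "\<gamma> \<notin> \<int>\<^sub>\<le>\<^sub>0" using g by (auto elim!: nonpos_Ints_cases)
  have pos: "Gamma (\<gamma> + 1) > 0" using g by (intro Gamma_real_pos) simp
  note G = Gamma_real_pos[OF g] less_imp_neq[OF pos, symmetric] Gamma_plus1[OF nn]
  have "((\<lambda>r. fact k * ((r - a) powr \<gamma> / Gamma (\<gamma> + 1))) has_real_derivative
      fact k * (\<gamma> * (r - a) powr (\<gamma> - 1) / Gamma (\<gamma> + 1))) (at r)"
    using ra G(2) by (auto intro!: derivative_eq_intros)
  moreover have "fact k * (\<gamma> * (r - a) powr (\<gamma> - 1) / Gamma (\<gamma> + 1)) = trunc_power_RL \<mu> a k r"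
    using ra g G(1) by (simp add: G(3) trunc_power_RL_def causal_kernel_def flip: \<gamma>_def)
  ultimately have "((\<lambda>r. fact k * ((r - a) powr \<gamma> / Gamma (\<gamma> + 1))) has_real_derivative trunc_power_RL \<mu> a k r) (at r)"
    by simp
  then show ?thesis
  proof (rule has_field_derivative_transform_within_open[where S = "{a<..}"])
    have e: "(1 - \<mu>) + (real k + 1) = \<gamma> + 1" by (simp add: \<gamma>_def)
    show "fact k * ((r - a) powr \<gamma> / Gamma (\<gamma> + 1)) = fact k * causal_kernel ((1 - \<mu>) + (real k + 1)) (r - a)"
      if "r \<in> {a<..}" for r
      unfolding e using that by (simp add: causal_kernel_def)
  qed (use ra in auto)
qed

text \<open>Fractional integration of order \<open>\<mu>\<close> undoes the derivative without a boundary term, because the derivative is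
  a multiple of the fractional kernel of order \<open>k + 1 - \<mu>\<close> and the semigroup law applies.\<close>

lemma Abel_inversion_trunc_power:
  assumes \<mu>: "0 < \<mu>" "\<mu> < 1"
  shows "integrable lebesgue (\<lambda>s. causal_kernel \<mu> (r - s) * trunc_power_RL \<mu> a k s)"
    and "(\<integral>s. causal_kernel \<mu> (r - s) * trunc_power_RL \<mu> a k s \<partial>lebesgue) = trunc_power a k r"
proof -
  have "0 < real k + 1 - \<mu>" using \<mu> by simp
  note conv = causal_kernel_convolution_integral[OF \<mu>(1) this, of r a]
  have eq: "causal_kernel \<mu> (r - s) * trunc_power_RL \<mu> a k s
      = fact k * (causal_kernel \<mu> (r - s) * causal_kernel (real k + 1 - \<mu>) (s - a))" for s
    by (simp add: trunc_power_RL_def)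
  show "integrable lebesgue (\<lambda>s. causal_kernel \<mu> (r - s) * trunc_power_RL \<mu> a k s)"
    unfolding eq by (rule integrable_mult_right[OF conv(1)])
  show "(\<integral>s. causal_kernel \<mu> (r - s) * trunc_power_RL \<mu> a k s \<partial>lebesgue) = trunc_power a k r"
    unfolding eq using conv by (simp add: trunc_power_eq_causal_kernel)
qed

lemma trunc_power_RL_set_integrable:
  assumes \<mu>: "\<mu> < 1"
  shows "set_integrable lebesgue {0..\<tau>} (trunc_power_RL \<mu> a k)"
proof -
  have "0 < real k + 1 - \<mu>" using \<mu> by simp
  note conv = causal_kernel_convolution_integral(1)[OF zero_less_one this, of "\<tau> + 1" a]
  have nn: "0 \<le> causal_kernel (real k + 1 - \<mu>) s" for s using \<mu> by (simp add: causal_kernel_nonneg)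
  show ?thesis
    unfolding set_integrable_def
  proof (rule Bochner_Integration.integrable_bound)
    \<comment> \<open>The kernel of order \<open>1\<close> is the indicator of the past. It ends at \<open>\<tau> + 1\<close> rather than \<open>\<tau>\<close> because it
      vanishes at its end point.\<close>
    show "integrable lebesgue (\<lambda>s. fact k * (causal_kernel 1 (\<tau> + 1 - s) * causal_kernel (real k + 1 - \<mu>) (s - a)))"
      by (rule integrable_mult_right[OF conv])
    show "(\<lambda>x. indicat_real {0..\<tau>} x *\<^sub>R trunc_power_RL \<mu> a k x) \<in> borel_measurable lebesgue"
      by (rule borel_imp_lebesgue_measurable) measurable
    show "AE s in lebesgue. norm (indicat_real {0..\<tau>} s *\<^sub>R trunc_power_RL \<mu> a k s)
        \<le> norm (fact k * (causal_kernel 1 (\<tau> + 1 - s) * causal_kernel (real k + 1 - \<mu>) (s - a)))"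
    proof (rule AE_I2)
      fix s
      show "norm (indicat_real {0..\<tau>} s *\<^sub>R trunc_power_RL \<mu> a k s)
        \<le> norm (fact k * (causal_kernel 1 (\<tau> + 1 - s) * causal_kernel (real k + 1 - \<mu>) (s - a)))"
        by (cases "s \<in> {0..\<tau>}") (auto simp: trunc_power_RL_def causal_kernel_def)
    qed
  qed
qed

lemma trunc_power_product_set_integrable:
  assumes \<mu>: "\<mu> < 1" and b: "0 \<le> b"
  shows "set_integrable lebesgue {0..\<tau>} (\<lambda>s. trunc_power_RL \<mu> a k s * trunc_power b l s)"
  unfolding set_integrable_def
proof (rule Bochner_Integration.integrable_bound)
  show "integrable lebesgue (\<lambda>s. (1 + \<bar>\<tau>\<bar>) ^ l * (indicat_real {0..\<tau>} s *\<^sub>R trunc_power_RL \<mu> a k s))"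
    by (rule integrable_mult_right[OF trunc_power_RL_set_integrable[OF \<mu>, unfolded set_integrable_def]])
  show "(\<lambda>x. indicat_real {0..\<tau>} x *\<^sub>R (trunc_power_RL \<mu> a k x * trunc_power b l x)) \<in> borel_measurable lebesgue"
    by (rule borel_imp_lebesgue_measurable) measurable
  show "AE s in lebesgue. norm (indicat_real {0..\<tau>} s *\<^sub>R (trunc_power_RL \<mu> a k s * trunc_power b l s))
        \<le> norm ((1 + \<bar>\<tau>\<bar>) ^ l * (indicat_real {0..\<tau>} s *\<^sub>R trunc_power_RL \<mu> a k s))"
  proof (rule AE_I2)
    fix s
    show "norm (indicat_real {0..\<tau>} s *\<^sub>R (trunc_power_RL \<mu> a k s * trunc_power b l s))
        \<le> norm ((1 + \<bar>\<tau>\<bar>) ^ l * (indicat_real {0..\<tau>} s *\<^sub>R trunc_power_RL \<mu> a k s))"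
      using trunc_power_bound[OF b, of s \<tau> l] trunc_power_nonneg[of b l s] trunc_power_RL_nonneg[OF \<mu>, of a k s]
      by (cases "s \<in> {0..\<tau>}") (auto simp: abs_mult mult.commute[of "trunc_power_RL \<mu> a k s"] intro!: mult_right_mono)
  qed
qed

locale truncated_powers =
  fixes \<mu> :: real and I :: "'i set" and a :: "'i \<Rightarrow> real" and k :: "'i \<Rightarrow> nat"
  assumes mu: "0 < \<mu>" "\<mu> < 1" and fin: "finite I" and a_nonneg: "\<And>i. i \<in> I \<Longrightarrow> 0 \<le> a i"
begin

definition spline :: "('i \<Rightarrow> real) \<Rightarrow> real \<Rightarrow> real" where
  "spline y s = (\<Sum>i\<in>I. y i * trunc_power (a i) (k i) s)"

definition spline_RL :: "('i \<Rightarrow> real) \<Rightarrow> real \<Rightarrow> real" where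
  "spline_RL y s = (\<Sum>i\<in>I. y i * trunc_power_RL \<mu> (a i) (k i) s)"

lemma spline_measurable[measurable]:
  "spline y \<in> borel_measurable borel" "spline_RL y \<in> borel_measurable borel"
  unfolding spline_def[abs_def] spline_RL_def[abs_def] by measurable

lemma spline_product: "spline_RL y s * spline z s
    = (\<Sum>i\<in>I. \<Sum>j\<in>I. y i * z j * (trunc_power_RL \<mu> (a i) (k i) s * trunc_power (a j) (k j) s))"
  unfolding spline_def spline_RL_def sum_product by (intro sum.cong refl) simp

lemma spline_product_set_integrable:
  "set_integrable lebesgue {0..\<tau>} (\<lambda>s. spline_RL y s * spline z s)"
  unfolding spline_product using fin a_nonneg mu
  by (intro set_integrable_sum set_integrable_mult_right trunc_power_product_set_integrable) auto

lemma spline_product_integral: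
  "(LINT s:{0..\<tau>}|lebesgue. spline_RL y s * spline z s) = (\<Sum>i\<in>I. \<Sum>j\<in>I. y i * z j *
    (LINT s:{0..\<tau>}|lebesgue. trunc_power_RL \<mu> (a i) (k i) s * trunc_power (a j) (k j) s))"
proof -
  note int = trunc_power_product_set_integrable[OF mu(2) a_nonneg]
  have "(LINT s:{0..\<tau>}|lebesgue. spline_RL y s * spline z s) = (\<Sum>i\<in>I. LINT s:{0..\<tau>}|lebesgue.
      \<Sum>j\<in>I. y i * z j * (trunc_power_RL \<mu> (a i) (k i) s * trunc_power (a j) (k j) s))"
    unfolding spline_product using int fin
    by (intro set_integral_sum set_integrable_sum set_integrable_mult_right) auto
  also have "\<dots> = (\<Sum>i\<in>I. \<Sum>j\<in>I. LINT s:{0..\<tau>}|lebesgue.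
      y i * z j * (trunc_power_RL \<mu> (a i) (k i) s * trunc_power (a j) (k j) s))"
    using int fin by (intro sum.cong refl set_integral_sum set_integrable_mult_right) auto
  finally show ?thesis by simp
qed

lemma spline_Abel:
  "integrable lebesgue (\<lambda>s. causal_kernel \<mu> (r - s) * spline_RL y s)"
  "(\<integral>s. causal_kernel \<mu> (r - s) * spline_RL y s \<partial>lebesgue) = spline y r"
proof -
  have eq: "causal_kernel \<mu> (r - s) * spline_RL y s
      = (\<Sum>i\<in>I. y i * (causal_kernel \<mu> (r - s) * trunc_power_RL \<mu> (a i) (k i) s))" for s
    by (simp add: spline_RL_def sum_distrib_left algebra_simps)
  note Abel = Abel_inversion_trunc_power[OF mu]
  show "integrable lebesgue (\<lambda>s. causal_kernel \<mu> (r - s) * spline_RL y s)"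
    unfolding eq by (intro Bochner_Integration.integrable_sum integrable_mult_right Abel(1))
  show "(\<integral>s. causal_kernel \<mu> (r - s) * spline_RL y s \<partial>lebesgue) = spline y r"
    unfolding eq
    by (subst Bochner_Integration.integral_sum) (auto simp: Abel spline_def intro!: integrable_mult_right)
qed

lemma spline_RL_causal: "s < 0 \<Longrightarrow> spline_RL y s = 0"
  unfolding spline_RL_def using a_nonneg
  by (intro sum.neutral) (auto simp: trunc_power_RL_def causal_kernel_def dest!: a_nonneg)

abbreviation spline_cut :: "real \<Rightarrow> ('i \<Rightarrow> real) \<Rightarrow> real \<Rightarrow> real" where
  "spline_cut \<tau> y \<equiv> (\<lambda>s. indicator {0..\<tau>} s * spline_RL y s)"

text \<open>By causality the values of \<open>h = spline_RL y\<close> after time \<open>\<tau>\<close> do not influence \<open>I\<^sup>\<mu> h\<close> before \<open>\<tau>\<close>. Cutting \<open>h\<close> off at \<open>\<tau>\<close>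
  therefore turns energies over \<open>[0, \<tau>]\<close> into values of \<open>frac_form\<close> on the whole line.\<close>

lemma spline_cut_Abel:
  assumes "r \<le> \<tau>"
  shows "causal_kernel \<mu> (r - s) * spline_cut \<tau> y s = causal_kernel \<mu> (r - s) * spline_RL y s"
proof (cases "s \<in> {0..\<tau>}")
  case False
  then have "s < 0 \<or> r - s \<le> 0" using assms by auto
  then show ?thesis using spline_RL_causal[of s y] by (auto simp: causal_kernel_nonpos_arg)
qed simp

text \<open>The coefficients \<open>\<bar>y i\<bar>\<close> yield a nonnegative majorant of the same form. Its fractional integral is a
  spline again, so the double integral reduces to the integral of \<open>spline_RL\<close> times \<open>spline\<close>.\<close>

lemma spline_cut_admissible: "frac_admissible \<mu> (spline_cut \<tau> y)"
proof -
  define z where "z i = \<bar>y i\<bar>" for i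
  have RLz: "\<bar>spline_RL y s\<bar> \<le> spline_RL z s" for s
    unfolding spline_RL_def z_def using trunc_power_RL_nonneg[OF mu(2)]
    by (intro order_trans[OF sum_abs] sum_mono) (simp add: abs_mult)
  have RLz_nn: "0 \<le> spline_RL z s" for s using RLz[of s] by linarith
  have z_nn: "0 \<le> spline z s" for s
    unfolding spline_def z_def by (intro sum_nonneg) (simp add: trunc_power_nonneg)
  have ck: "0 \<le> causal_kernel \<mu> s" for s by (rule causal_kernel_nonneg[OF mu(1)])
  have cm: "spline_cut \<tau> y \<in> borel_measurable lebesgue"
    by (rule borel_imp_lebesgue_measurable) measurable
  have [measurable]: "(\<lambda>x. spline_RL w (g x)) \<in> borel_measurable N" if "g \<in> measurable N borel" for g w and N :: "'n measure"
    by (rule measurable_compose[OF that spline_measurable(2)])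
  let ?g = "\<lambda>(r, s). causal_kernel \<mu> (r - s) * \<bar>spline_cut \<tau> y r\<bar> * \<bar>spline_cut \<tau> y s\<bar>"
  have "integrable (lebesgue \<Otimes>\<^sub>M lebesgue) ?g"
  proof (rule integrableI_bounded)
    show gm: "?g \<in> borel_measurable (lebesgue \<Otimes>\<^sub>M lebesgue)" by measurable
    have "(\<integral>\<^sup>+w. ennreal (norm (?g w)) \<partial>(lebesgue \<Otimes>\<^sub>M lebesgue))
        = (\<integral>\<^sup>+r. \<integral>\<^sup>+s. ennreal (norm (?g (r, s))) \<partial>lebesgue \<partial>lebesgue)"
      using gm by (subst leb.nn_integral_fst[symmetric]) auto
    also have "\<dots> \<le> (\<integral>\<^sup>+r. ennreal (indicator {0..\<tau>} r * (spline_RL z r * spline z r)) \<partial>lebesgue)"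
    proof (rule nn_integral_mono)
      fix r :: real
      show "(\<integral>\<^sup>+s. ennreal (norm (?g (r, s))) \<partial>lebesgue) \<le> ennreal (indicator {0..\<tau>} r * (spline_RL z r * spline z r))"
      proof (cases "r \<in> {0..\<tau>}")
        case False
        then show ?thesis by simp
      next
        case True
        have "(\<integral>\<^sup>+s. ennreal (norm (?g (r, s))) \<partial>lebesgue)
            \<le> (\<integral>\<^sup>+s. ennreal (spline_RL z r * (causal_kernel \<mu> (r - s) * spline_RL z s)) \<partial>lebesgue)"
        proof (intro nn_integral_mono ennreal_leI)
          fix s
          have "norm (?g (r, s)) = causal_kernel \<mu> (r - s) * \<bar>spline_RL y r\<bar> * \<bar>spline_cut \<tau> y s\<bar>"
            using True ck[of "r - s"] by (simp add: abs_mult)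
          also have "\<dots> \<le> causal_kernel \<mu> (r - s) * spline_RL z r * spline_RL z s"
            using RLz[of s] RLz_nn[of s]
            by (intro mult_mono RLz ck mult_nonneg_nonneg RLz_nn) (auto simp: indicator_def)
          finally show "norm (?g (r, s)) \<le> spline_RL z r * (causal_kernel \<mu> (r - s) * spline_RL z s)"
            by (simp add: algebra_simps)
        qed
        also have "\<dots> = ennreal (\<integral>s. spline_RL z r * (causal_kernel \<mu> (r - s) * spline_RL z s) \<partial>lebesgue)"
          using RLz_nn ck by (intro nn_integral_eq_integral integrable_mult_right spline_Abel) auto
        also have "(\<integral>s. spline_RL z r * (causal_kernel \<mu> (r - s) * spline_RL z s) \<partial>lebesgue) = spline_RL z r * spline z r"
          by (simp add: spline_Abel)
        finally show ?thesis using True by simp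
      qed
    qed
    also have "\<dots> < \<infinity>"
    proof -
      have "integrable lebesgue (\<lambda>r. indicator {0..\<tau>} r * (spline_RL z r * spline z r))"
        using spline_product_set_integrable[of \<tau> z z] by (simp add: set_integrable_def)
      then show ?thesis
        using RLz_nn z_nn by (subst nn_integral_eq_integral) auto
    qed
    finally show "(\<integral>\<^sup>+w. ennreal (norm (?g w)) \<partial>(lebesgue \<Otimes>\<^sub>M lebesgue)) < \<infinity>" .
  qed
  with cm show ?thesis by (simp add: frac_admissible_def)
qed

lemma frac_form_spline_cut:
  assumes F: "frac_admissible \<mu> F" and supp: "\<And>r. r \<notin> {0..\<tau>} \<Longrightarrow> F r = 0"
  shows "integrable lebesgue (\<lambda>r. F r * spline y r)"
    and "frac_form \<mu> F (spline_cut \<tau> y) = (\<integral>r. F r * spline y r \<partial>lebesgue)"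
proof -
  note int = frac_form_sector(1)[OF mu F spline_cut_admissible[of \<tau> y]]
  have inner: "(\<integral>s. causal_kernel \<mu> (r - s) * F r * spline_cut \<tau> y s \<partial>lebesgue) = F r * spline y r" for r
  proof (cases "r \<in> {0..\<tau>}")
    case True
    have "(\<integral>s. causal_kernel \<mu> (r - s) * F r * spline_cut \<tau> y s \<partial>lebesgue)
        = (\<integral>s. F r * (causal_kernel \<mu> (r - s) * spline_RL y s) \<partial>lebesgue)"
      using True spline_cut_Abel[of r \<tau> _ y] by (intro Bochner_Integration.integral_cong) (auto simp: algebra_simps)
    then show ?thesis by (simp add: spline_Abel)
  qed (simp add: supp)
  show "integrable lebesgue (\<lambda>r. F r * spline y r)"
    using leb2.integrable_fst[OF int] by (simp only: inner)
  show "frac_form \<mu> F (spline_cut \<tau> y) = (\<integral>r. F r * spline y r \<partial>lebesgue)"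
    unfolding frac_form_def using leb2.integral_fst[OF int] by (simp only: inner)
qed

lemma frac_form_spline_cut_self:
  "frac_form \<mu> (spline_cut \<tau> y) (spline_cut \<tau> y) = (LINT s:{0..\<tau>}|lebesgue. spline_RL y s * spline y s)"
  by (subst frac_form_spline_cut(2)[OF spline_cut_admissible]) (auto simp: set_lebesgue_integral_def mult.assoc)

theorem spline_energy_nonneg: "0 \<le> (LINT s:{0..\<tau>}|lebesgue. spline_RL y s * spline y s)"
  using frac_form_sector(2)[OF mu spline_cut_admissible spline_cut_admissible, of \<tau> y]
  by (simp add: frac_form_spline_cut_self)

text \<open>The work estimate for one mode: \<open>spline y\<close> is the fractional integral of the cut-off derivative, so the
  pairing with \<open>F\<close> is \<open>frac_form \<mu> F (spline_cut \<tau> y)\<close> and the sector estimate applies.\<close>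

theorem spline_duality:
  assumes F: "frac_admissible \<mu> F" and supp: "\<And>r. r \<notin> {0..\<tau>} \<Longrightarrow> F r = 0"
  shows "\<bar>\<integral>r. F r * spline y r \<partial>lebesgue\<bar>
    \<le> 1 / cos (\<mu> * pi / 2) * sqrt (frac_form \<mu> F F) * sqrt (LINT s:{0..\<tau>}|lebesgue. spline_RL y s * spline y s)"
proof -
  have "frac_form \<mu> F (spline_cut \<tau> y) = (\<integral>r. F r * spline y r \<partial>lebesgue)"
    by (rule frac_form_spline_cut(2)[OF F]) (rule supp)
  then show ?thesis
    using frac_form_sector(3)[OF mu F spline_cut_admissible[of \<tau> y]]
    by (simp only: frac_form_spline_cut_self)
qed

end

section \<open>Weak gradients and functions vanishing on the boundary\<close>

lemma test_function_differentiable: "\<psi> \<in> test_functions \<Omega> \<Longrightarrow> \<psi> differentiable (at x)"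
  unfolding test_functions_def using C_class.simps(2)[of 0 \<psi>] by blast

lemma test_function_continuous: "\<psi> \<in> test_functions \<Omega> \<Longrightarrow> continuous_on UNIV \<psi>"
  unfolding test_functions_def using C_class.simps(1)[of \<psi>] by blast

lemma frechet_derivative_lincomb:
  fixes \<psi> \<eta> :: "'a::euclidean_space \<Rightarrow> real"
  assumes "\<psi> differentiable (at x)" "\<eta> differentiable (at x)"
  shows "frechet_derivative (\<lambda>x. a * \<psi> x + b * \<eta> x) (at x)
      = (\<lambda>v. a * frechet_derivative \<psi> (at x) v + b * frechet_derivative \<eta> (at x) v)"
  using assms by (intro frechet_derivative_at[symmetric])
    (auto intro!: derivative_eq_intros simp: frechet_derivative_works[symmetric])

lemma C_class_lincomb:
  "C_class k \<psi> \<Longrightarrow> C_class k \<eta> \<Longrightarrow> C_class k (\<lambda>x. a * \<psi> x + b * \<eta> x)"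
proof (induction k arbitrary: \<psi> \<eta>)
  case 0
  then show ?case by (auto intro!: continuous_intros)
next
  case (Suc k)
  then have d: "\<psi> differentiable (at x)" "\<eta> differentiable (at x)" for x by auto
  show ?case using Suc d by (auto intro!: derivative_intros simp: frechet_derivative_lincomb)
qed

lemma test_functions_lincomb:
  assumes "\<psi> \<in> test_functions \<Omega>" "\<eta> \<in> test_functions \<Omega>"
  shows "(\<lambda>x. a * \<psi> x + b * \<eta> x) \<in> test_functions \<Omega>"
proof -
  let ?S = "{x. a * \<psi> x + b * \<eta> x \<noteq> 0}" and ?A = "closure {x. \<psi> x \<noteq> 0}" and ?B = "closure {x. \<eta> x \<noteq> 0}"
  have A: "\<psi> x = 0" if "x \<notin> ?A" for x using that closure_subset[THEN subsetD, of x "{x. \<psi> x \<noteq> 0}"] by auto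
  have B: "\<eta> x = 0" if "x \<notin> ?B" for x using that closure_subset[THEN subsetD, of x "{x. \<eta> x \<noteq> 0}"] by auto
  have "?S \<subseteq> ?A \<union> ?B"
  proof
    fix x assume "x \<in> ?S"
    then show "x \<in> ?A \<union> ?B" using A[of x] B[of x] by (cases "x \<in> ?A") auto
  qed
  then have "closure ?S \<subseteq> ?A \<union> ?B" by (intro closure_minimal) auto
  moreover have "compact (?A \<union> ?B)" using assms by (auto simp: test_functions_def)
  ultimately have "compact (closure ?S)" "closure ?S \<subseteq> \<Omega>"
    using assms compact_Int_closed[of "?A \<union> ?B" "closure ?S"]
    by (auto simp: test_functions_def Int_absorb1)
  then show ?thesis using assms by (auto simp: test_functions_def C_class_lincomb)
qed

lemma classical_gradient_lincomb:
  assumes "\<psi> \<in> test_functions \<Omega>" "\<eta> \<in> test_functions \<Omega>"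
  shows "classical_gradient (\<lambda>x. a * \<psi> x + b * \<eta> x) x
    = a *\<^sub>R classical_gradient \<psi> x + b *\<^sub>R classical_gradient \<eta> x"
  by (simp add: classical_gradient_def frechet_derivative_lincomb assms[THEN test_function_differentiable]
      scaleR_left_distrib sum.distrib scaleR_sum_right)

lemma test_functions_partial:
  assumes \<psi>: "\<psi> \<in> test_functions \<Omega>" and b: "b \<in> Basis"
  shows "(\<lambda>x. frechet_derivative \<psi> (at x) b) \<in> test_functions \<Omega>"
proof -
  let ?S = "{x. frechet_derivative \<psi> (at x) b \<noteq> 0}" and ?A = "closure {x. \<psi> x \<noteq> 0}"
  have "frechet_derivative \<psi> (at x) b = 0" if x: "x \<notin> ?A" for x
  proof -
    have "((\<lambda>x. 0::real) has_derivative (\<lambda>x. 0)) (at x)" by simp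
    then have "(\<psi> has_derivative (\<lambda>x. 0)) (at x)"
    proof (rule has_derivative_transform_within_open)
      show "open (- ?A)" by auto
      show "x \<in> - ?A" using x by simp
      show "0 = \<psi> y" if "y \<in> - ?A" for y
        using that closure_subset[of "{x. \<psi> x \<noteq> 0}"] by auto
    qed
    from frechet_derivative_at[OF this] show ?thesis by metis
  qed
  then have "?S \<subseteq> ?A" by blast
  then have S: "closure ?S \<subseteq> ?A" by (simp add: closure_minimal)
  have "compact (closure ?S)"
    using \<psi> S compact_Int_closed[of ?A "closure ?S"] by (auto simp: test_functions_def Int_absorb1)
  moreover have "closure ?S \<subseteq> \<Omega>" using S \<psi> by (auto simp: test_functions_def)
  moreover have "C_class k (\<lambda>x. frechet_derivative \<psi> (at x) b)" for k
    using \<psi> b C_class.simps(2)[of k \<psi>] by (auto simp: test_functions_def)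
  ultimately show ?thesis by (simp add: test_functions_def)
qed

lemma L2_space_bounded:
  fixes v :: "'a::euclidean_space \<Rightarrow> 'b::euclidean_space"
  assumes "\<Omega> \<in> lmeasurable" "continuous_on UNIV v" "bounded (range v)"
  shows "v \<in> L2_space \<Omega>"
proof -
  interpret finite_measure "lebesgue_on \<Omega>" by (rule finite_measure_lebesgue_on[OF assms(1)])
  have m: "v \<in> borel_measurable (lebesgue_on \<Omega>)"
    using assms(2) by (intro measurable_restrict_space1 measurable_completion)
      (simp add: borel_measurable_continuous_onI)
  obtain B where B: "\<And>x. norm (v x) \<le> B" using assms(3) by (auto simp: bounded_iff)
  have "integrable (lebesgue_on \<Omega>) (\<lambda>x. (norm (v x))\<^sup>2)"
    using m B by (intro integrable_const_bound[where B = "B\<^sup>2"]) (auto intro!: power_mono)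
  with m show ?thesis by (simp add: L2_space_def)
qed

lemma test_functions_L2:
  assumes "\<Omega> \<in> lmeasurable" "\<psi> \<in> test_functions \<Omega>"
  shows "\<psi> \<in> L2_space \<Omega>"
proof (rule L2_space_bounded[OF assms(1)])
  show c: "continuous_on UNIV \<psi>" by (rule test_function_continuous[OF assms(2)])
  let ?A = "closure {x. \<psi> x \<noteq> 0}"
  have "compact (\<psi> ` ?A)"
    using assms(2) by (intro compact_continuous_image continuous_on_subset[OF c]) (auto simp: test_functions_def)
  then have "bounded (insert 0 (\<psi> ` ?A))" by (simp add: compact_imp_bounded)
  moreover have "range \<psi> \<subseteq> insert 0 (\<psi> ` ?A)"
    using closure_subset[of "{x. \<psi> x \<noteq> 0}"] by auto
  ultimately show "bounded (range \<psi>)" by (rule bounded_subset)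
qed

lemma classical_gradient_L2:
  assumes "\<Omega> \<in> lmeasurable" "\<psi> \<in> test_functions \<Omega>"
  shows "classical_gradient \<psi> \<in> L2_space \<Omega>"
proof -
  have sc: "(\<lambda>x. w x *\<^sub>R b) \<in> L2_space \<Omega>" if "w \<in> L2_space \<Omega>" for w and b :: 'a
    using that by (auto simp: L2_space_def power_mult_distrib)
  have "classical_gradient \<psi> = (\<lambda>x. \<Sum>b\<in>Basis. frechet_derivative \<psi> (at x) b *\<^sub>R b)"
    by (auto simp: classical_gradient_def)
  then show ?thesis
    by (simp only:) (intro L2_space_sum sc test_functions_L2[OF assms(1)] test_functions_partial[OF assms(2)])
qed

lemma is_weak_gradient_iff:
  "is_weak_gradient \<Omega> v G \<longleftrightarrow> (\<forall>\<psi>\<in>test_functions \<Omega>. \<forall>b\<in>Basis.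
     L2_inner \<Omega> v (\<lambda>x. frechet_derivative \<psi> (at x) b) = - L2_inner \<Omega> (\<lambda>x. G x \<bullet> b) \<psi>)"
  by (simp add: is_weak_gradient_def L2_inner_def)

lemma is_weak_gradient_cong:
  assumes "\<And>x. x \<in> \<Omega> \<Longrightarrow> v x = w x"
  shows "is_weak_gradient \<Omega> v = is_weak_gradient \<Omega> w"
  by (intro ext) (simp add: is_weak_gradient_iff L2_inner_cong[of \<Omega> v w] assms)

lemma weak_gradient_cong:
  assumes "\<And>x. x \<in> \<Omega> \<Longrightarrow> v x = w x"
  shows "weak_gradient \<Omega> v = weak_gradient \<Omega> w"
  unfolding weak_gradient_def by (simp add: is_weak_gradient_cong[OF assms])

lemma energy_cong:
  assumes "\<And>x. x \<in> \<Omega> \<Longrightarrow> v x = v' x" "\<And>x. x \<in> \<Omega> \<Longrightarrow> w x = w' x"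
  shows "energy K \<Omega> v w = energy K \<Omega> v' w'"
  by (simp add: energy_def weak_gradient_cong[OF assms(1)] weak_gradient_cong[OF assms(2)])

lemma H10_L2: "v \<in> H10_space \<Omega> \<Longrightarrow> v \<in> L2_space \<Omega>"
  by (simp add: H10_space_def H1_space_def)

lemma H10_weak_gradient:
  assumes "v \<in> H10_space \<Omega>"
  shows "weak_gradient \<Omega> v \<in> L2_space \<Omega>" "is_weak_gradient \<Omega> v (weak_gradient \<Omega> v)"
proof -
  from assms obtain G where "G \<in> L2_space \<Omega> \<and> is_weak_gradient \<Omega> v G"
    by (auto simp: H10_space_def H1_space_def)
  from someI[of "\<lambda>G. G \<in> L2_space \<Omega> \<and> is_weak_gradient \<Omega> v G", OF this]
  show "weak_gradient \<Omega> v \<in> L2_space \<Omega>" "is_weak_gradient \<Omega> v (weak_gradient \<Omega> v)"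
    by (simp_all add: weak_gradient_def)
qed

lemma H10_approx:
  assumes "v \<in> H10_space \<Omega>"
  obtains \<psi> :: "nat \<Rightarrow> 'a::euclidean_space \<Rightarrow> real" where "\<And>k. \<psi> k \<in> test_functions \<Omega>"
    "(\<lambda>k. L2_norm \<Omega> (\<lambda>x. \<psi> k x - v x)) \<longlonglongrightarrow> 0"
    "(\<lambda>k. L2_norm \<Omega> (\<lambda>x. classical_gradient (\<psi> k) x - weak_gradient \<Omega> v x)) \<longlonglongrightarrow> 0"
  using assms by (auto simp: H10_space_def)

lemma L2_space_component:
  fixes G :: "'a::euclidean_space \<Rightarrow> 'b::euclidean_space"
  assumes "G \<in> L2_space \<Omega>" "b \<in> Basis" shows "(\<lambda>x. G x \<bullet> b) \<in> L2_space \<Omega>"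
proof -
  have m: "G \<in> borel_measurable (lebesgue_on \<Omega>)" by (rule L2_spaceD_measurable[OF assms(1)])
  have "integrable (lebesgue_on \<Omega>) (\<lambda>x. (norm (G x \<bullet> b))\<^sup>2)"
  proof (rule Bochner_Integration.integrable_bound)
    show "integrable (lebesgue_on \<Omega>) (\<lambda>x. (norm (G x))\<^sup>2)" using assms by (simp add: L2_space_def)
    show "AE x in lebesgue_on \<Omega>. norm ((norm (G x \<bullet> b))\<^sup>2) \<le> norm ((norm (G x))\<^sup>2)"
      using assms(2) by (auto intro!: AE_I2 abs_le_square_iff[THEN iffD1] Basis_le_norm)
  qed (use m in measurable)
  with m show ?thesis by (simp add: L2_space_def)
qed

lemma L2_inner_diff_diff:
  fixes a b c d :: "'a::euclidean_space \<Rightarrow> 'b::euclidean_space"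
  assumes "a \<in> L2_space \<Omega>" "b \<in> L2_space \<Omega>" "c \<in> L2_space \<Omega>" "d \<in> L2_space \<Omega>"
  shows "L2_inner \<Omega> (\<lambda>x. a x - b x) (\<lambda>x. c x - d x)
    = L2_inner \<Omega> a c - L2_inner \<Omega> a d - (L2_inner \<Omega> b c - L2_inner \<Omega> b d)"
  using assms by (simp add: L2_inner_diff_left L2_inner_diff_right L2_space_diff)

locale dirichlet_problem =
  fixes K :: real and \<Omega> :: "'a::euclidean_space set"
    and \<phi> :: "nat \<Rightarrow> 'a \<Rightarrow> real" and lam :: "nat \<Rightarrow> real"
  assumes K_pos: "0 < K" and domain_measurable: "\<Omega> \<in> lmeasurable"
    and eigensystem: "dirichlet_eigensystem K \<Omega> \<phi> lam"
begin

lemma phi_H10: "1 \<le> m \<Longrightarrow> \<phi> m \<in> H10_space \<Omega>"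
  and phi_op: "1 \<le> m \<Longrightarrow> dirichlet_op K \<Omega> (\<phi> m) (\<lambda>x. lam m * \<phi> m x)"
  using eigensystem by (auto simp: dirichlet_eigensystem_def dirichlet_op_def)

lemma phi_L2: "1 \<le> m \<Longrightarrow> \<phi> m \<in> L2_space \<Omega>"
  by (rule H10_L2[OF phi_H10])

lemma phi_orthonormal: "1 \<le> m \<Longrightarrow> 1 \<le> k \<Longrightarrow> L2_inner \<Omega> (\<phi> m) (\<phi> k) = (if m = k then 1 else 0)"
  using eigensystem by (simp add: dirichlet_eigensystem_def)

lemma phi_complete:
  "v \<in> L2_space \<Omega> \<Longrightarrow> (\<lambda>M. L2_norm \<Omega> (\<lambda>x. v x - (\<Sum>m=1..M. L2_inner \<Omega> v (\<phi> m) * \<phi> m x))) \<longlonglongrightarrow> 0"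
  using eigensystem by (simp add: dirichlet_eigensystem_def)

lemma lam_ge: "1 \<le> m \<Longrightarrow> lam 1 \<le> lam m"
proof (induction m rule: dec_induct)
  case (step n)
  have "lam n \<le> lam (Suc n)"
    using eigensystem step by (simp add: dirichlet_eigensystem_def)
  with step show ?case by simp
qed simp

lemma lam_1_pos: "0 < lam 1"
  using eigensystem by (simp add: dirichlet_eigensystem_def)

lemma lam_pos: "1 \<le> m \<Longrightarrow> 0 < lam m"
  using lam_ge lam_1_pos by fastforce

lemma test_L2: "\<psi> \<in> test_functions \<Omega> \<Longrightarrow> \<psi> \<in> L2_space \<Omega>"
  by (rule test_functions_L2[OF domain_measurable])

lemma gradient_L2: "\<psi> \<in> test_functions \<Omega> \<Longrightarrow> classical_gradient \<psi> \<in> L2_space \<Omega>"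
  by (rule classical_gradient_L2[OF domain_measurable])

text \<open>The fundamental lemma of the calculus of variations: the eigenfunctions are limits of test functions, so all
  Fourier coefficients of \<open>Z\<close> vanish, and they are complete.\<close>

lemma orthogonal_to_test_functions:
  assumes Z: "Z \<in> L2_space \<Omega>" and orth: "\<And>\<psi>. \<psi> \<in> test_functions \<Omega> \<Longrightarrow> L2_inner \<Omega> Z \<psi> = 0"
  shows "L2_norm \<Omega> Z = 0"
proof -
  have "L2_inner \<Omega> Z (\<phi> m) = 0" if m: "1 \<le> m" for m
  proof -
    obtain \<psi> where \<psi>: "\<And>k::nat. \<psi> k \<in> test_functions \<Omega>" "(\<lambda>k. L2_norm \<Omega> (\<lambda>x. \<psi> k x - \<phi> m x)) \<longlonglongrightarrow> 0"
      using H10_approx[OF phi_H10[OF m]] by metis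
    have "(\<lambda>k. L2_inner \<Omega> (\<psi> k) Z) \<longlonglongrightarrow> L2_inner \<Omega> (\<phi> m) Z"
      by (rule L2_inner_tendsto[OF test_L2[OF \<psi>(1)] phi_L2[OF m] Z \<psi>(2)])
    then have "(\<lambda>k::nat. 0) \<longlonglongrightarrow> L2_inner \<Omega> Z (\<phi> m)"
      using orth[OF \<psi>(1)] by (simp add: L2_inner_commute)
    then show ?thesis by (simp add: LIMSEQ_const_iff)
  qed
  then have "(\<Sum>m=1..M. L2_inner \<Omega> Z (\<phi> m) * \<phi> m x) = 0" for M x
    by (intro sum.neutral) auto
  with phi_complete[OF Z] show ?thesis by (simp add: LIMSEQ_const_iff)
qed

text \<open>This removes the arbitrariness of \<open>weak_gradient\<close>: only its class modulo null sets matters.\<close>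

lemma weak_gradient_unique:
  assumes G: "G \<in> L2_space \<Omega>" "is_weak_gradient \<Omega> v G"
    and G': "G' \<in> L2_space \<Omega>" "is_weak_gradient \<Omega> v G'"
  shows "L2_norm \<Omega> (\<lambda>x. G x - G' x) = 0"
proof -
  let ?Z = "\<lambda>x. G x - G' x"
  have Z: "?Z \<in> L2_space \<Omega>" by (rule L2_space_diff[OF G(1) G'(1)])
  have comp: "L2_inner \<Omega> (\<lambda>x. ?Z x \<bullet> b) (\<lambda>x. ?Z x \<bullet> b) = 0" if b: "b \<in> Basis" for b
  proof -
    have "L2_norm \<Omega> (\<lambda>x. ?Z x \<bullet> b) = 0"
    proof (rule orthogonal_to_test_functions[OF L2_space_component[OF Z b]])
      fix \<psi> assume \<psi>: "\<psi> \<in> test_functions \<Omega>"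
      have "L2_inner \<Omega> (\<lambda>x. ?Z x \<bullet> b) \<psi> = L2_inner \<Omega> (\<lambda>x. G x \<bullet> b) \<psi> - L2_inner \<Omega> (\<lambda>x. G' x \<bullet> b) \<psi>"
        unfolding inner_diff_left
        by (intro L2_inner_diff_left L2_space_component G(1) G'(1) b test_L2 \<psi>)
      also have "\<dots> = 0" using G(2) G'(2) \<psi> b unfolding is_weak_gradient_iff by force
      finally show "L2_inner \<Omega> (\<lambda>x. ?Z x \<bullet> b) \<psi> = 0" .
    qed
    then show ?thesis by (simp add: L2_norm_def)
  qed
  have "L2_inner \<Omega> ?Z ?Z = (\<integral>x. (\<Sum>b\<in>Basis. (?Z x \<bullet> b) * (?Z x \<bullet> b)) \<partial>lebesgue_on \<Omega>)"
    unfolding L2_inner_def by (rule Bochner_Integration.integral_cong[OF refl]) (rule euclidean_inner)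
  also have "\<dots> = (\<Sum>b\<in>Basis. \<integral>x. (?Z x \<bullet> b) * (?Z x \<bullet> b) \<partial>lebesgue_on \<Omega>)"
  proof (rule Bochner_Integration.integral_sum)
    fix b :: 'a assume "b \<in> Basis"
    from L2_inner_integrable[OF L2_space_component[OF Z this] L2_space_component[OF Z this]]
    show "integrable (lebesgue_on \<Omega>) (\<lambda>x. (?Z x \<bullet> b) * (?Z x \<bullet> b))" by simp
  qed
  also have "\<dots> = 0" using comp by (simp add: L2_inner_def)
  finally show ?thesis by (simp add: L2_norm_def)
qed

text \<open>Membership in \<open>H10_space\<close> is defined through the chosen weak gradient; by uniqueness any weak gradient will do.\<close>

lemma H10I:
  assumes v: "v \<in> L2_space \<Omega>" and G: "G \<in> L2_space \<Omega>" "is_weak_gradient \<Omega> v G"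
    and \<psi>: "\<And>k::nat. \<psi> k \<in> test_functions \<Omega>" "(\<lambda>k. L2_norm \<Omega> (\<lambda>x. \<psi> k x - v x)) \<longlonglongrightarrow> 0"
      "(\<lambda>k. L2_norm \<Omega> (\<lambda>x. classical_gradient (\<psi> k) x - G x)) \<longlonglongrightarrow> 0"
  shows "v \<in> H10_space \<Omega>" and "L2_norm \<Omega> (\<lambda>x. weak_gradient \<Omega> v x - G x) = 0"
proof -
  let ?W = "weak_gradient \<Omega> v"
  have W: "?W \<in> L2_space \<Omega>" "is_weak_gradient \<Omega> v ?W"
    unfolding weak_gradient_def
    using someI[of "\<lambda>G. G \<in> L2_space \<Omega> \<and> is_weak_gradient \<Omega> v G", OF conjI[OF G]] by auto
  show e: "L2_norm \<Omega> (\<lambda>x. ?W x - G x) = 0" by (rule weak_gradient_unique[OF W G])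
  have "(\<lambda>k. L2_norm \<Omega> (\<lambda>x. classical_gradient (\<psi> k) x - ?W x)) \<longlonglongrightarrow> 0"
  proof (rule Lim_null_comparison[OF _ \<psi>(3)])
    show "\<forall>\<^sub>F k in sequentially. norm (L2_norm \<Omega> (\<lambda>x. classical_gradient (\<psi> k) x - ?W x))
        \<le> L2_norm \<Omega> (\<lambda>x. classical_gradient (\<psi> k) x - G x)"
      using L2_norm_triangle_diff[OF gradient_L2[OF \<psi>(1)] G(1) W(1)] e
      by (simp add: L2_norm_nonneg L2_norm_minus_commute[of \<Omega> G])
  qed
  then show "v \<in> H10_space \<Omega>"
    using v G \<psi>(1,2) by (auto simp: H10_space_def H1_space_def)
qed

lemma is_weak_gradient_lincomb:
  assumes "v \<in> L2_space \<Omega>" "w \<in> L2_space \<Omega>" "G \<in> L2_space \<Omega>" "H \<in> L2_space \<Omega>"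
    and "is_weak_gradient \<Omega> v G" "is_weak_gradient \<Omega> w H"
  shows "is_weak_gradient \<Omega> (\<lambda>x. a * v x + b * w x) (\<lambda>x. a *\<^sub>R G x + b *\<^sub>R H x)"
  unfolding is_weak_gradient_iff
proof (intro ballI)
  fix \<psi> e assume \<psi>: "\<psi> \<in> test_functions \<Omega>" and e: "e \<in> (Basis :: 'a set)"
  let ?d = "\<lambda>x. frechet_derivative \<psi> (at x) e"
  have d: "?d \<in> L2_space \<Omega>" by (rule test_L2[OF test_functions_partial[OF \<psi> e]])
  note comp = L2_space_component[OF assms(3) e] L2_space_component[OF assms(4) e]
  have "L2_inner \<Omega> (\<lambda>x. a * v x + b * w x) ?d = a * L2_inner \<Omega> v ?d + b * L2_inner \<Omega> w ?d"
    by (simp add: L2_inner_add_left L2_space_scale_real assms d L2_inner_scale_left_real)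
  also have "\<dots> = - (a * L2_inner \<Omega> (\<lambda>x. G x \<bullet> e) \<psi> + b * L2_inner \<Omega> (\<lambda>x. H x \<bullet> e) \<psi>)"
    using assms(5,6) \<psi> e by (simp add: is_weak_gradient_iff)
  also have "a * L2_inner \<Omega> (\<lambda>x. G x \<bullet> e) \<psi> + b * L2_inner \<Omega> (\<lambda>x. H x \<bullet> e) \<psi>
      = L2_inner \<Omega> (\<lambda>x. (a *\<^sub>R G x + b *\<^sub>R H x) \<bullet> e) \<psi>"
    unfolding inner_add_left inner_scaleR_left
    by (simp add: L2_inner_add_left L2_space_scale_real comp test_L2[OF \<psi>] L2_inner_scale_left_real)
  finally show "L2_inner \<Omega> (\<lambda>x. a * v x + b * w x) ?d = - L2_inner \<Omega> (\<lambda>x. (a *\<^sub>R G x + b *\<^sub>R H x) \<bullet> e) \<psi>" .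
qed

lemma L2_norm_lincomb_tendsto_0:
  fixes v w :: "nat \<Rightarrow> 'a \<Rightarrow> 'b::euclidean_space"
  assumes "\<And>k. v k \<in> L2_space \<Omega>" "\<And>k. w k \<in> L2_space \<Omega>"
    and "(\<lambda>k. L2_norm \<Omega> (v k)) \<longlonglongrightarrow> 0" "(\<lambda>k. L2_norm \<Omega> (w k)) \<longlonglongrightarrow> 0"
  shows "(\<lambda>k. L2_norm \<Omega> (\<lambda>x. a *\<^sub>R v k x + b *\<^sub>R w k x)) \<longlonglongrightarrow> 0"
proof (rule Lim_null_comparison)
  show "\<forall>\<^sub>F k in sequentially. norm (L2_norm \<Omega> (\<lambda>x. a *\<^sub>R v k x + b *\<^sub>R w k x))
      \<le> \<bar>a\<bar> * L2_norm \<Omega> (v k) + \<bar>b\<bar> * L2_norm \<Omega> (w k)"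
    using L2_norm_triangle[OF L2_space_scale[OF assms(1)] L2_space_scale[OF assms(2)]]
    by (simp add: L2_norm_nonneg L2_norm_scale)
  show "(\<lambda>k. \<bar>a\<bar> * L2_norm \<Omega> (v k) + \<bar>b\<bar> * L2_norm \<Omega> (w k)) \<longlonglongrightarrow> 0"
    using tendsto_add[OF tendsto_mult[OF tendsto_const assms(3)] tendsto_mult[OF tendsto_const assms(4)], of "\<bar>a\<bar>" "\<bar>b\<bar>"]
    by simp
qed

lemma H10_lincomb:
  assumes v: "v \<in> H10_space \<Omega>" and w: "w \<in> H10_space \<Omega>"
  shows "(\<lambda>x. a * v x + b * w x) \<in> H10_space \<Omega>"
    and "L2_norm \<Omega> (\<lambda>x. weak_gradient \<Omega> (\<lambda>x. a * v x + b * w x) x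
        - (a *\<^sub>R weak_gradient \<Omega> v x + b *\<^sub>R weak_gradient \<Omega> w x)) = 0"
proof -
  obtain \<psi> where \<psi>: "\<And>k::nat. \<psi> k \<in> test_functions \<Omega>" "(\<lambda>k. L2_norm \<Omega> (\<lambda>x. \<psi> k x - v x)) \<longlonglongrightarrow> 0"
    "(\<lambda>k. L2_norm \<Omega> (\<lambda>x. classical_gradient (\<psi> k) x - weak_gradient \<Omega> v x)) \<longlonglongrightarrow> 0"
    by (rule H10_approx[OF v]) (rule that)
  obtain \<eta> where \<eta>: "\<And>k::nat. \<eta> k \<in> test_functions \<Omega>" "(\<lambda>k. L2_norm \<Omega> (\<lambda>x. \<eta> k x - w x)) \<longlonglongrightarrow> 0"
    "(\<lambda>k. L2_norm \<Omega> (\<lambda>x. classical_gradient (\<eta> k) x - weak_gradient \<Omega> w x)) \<longlonglongrightarrow> 0"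
    by (rule H10_approx[OF w]) (rule that)
  note Gv = H10_weak_gradient[OF v] and Gw = H10_weak_gradient[OF w]
  have 1: "(\<lambda>x. a * v x + b * w x) \<in> L2_space \<Omega>"
    by (intro L2_space_add L2_space_scale_real H10_L2 v w)
  have 2: "(\<lambda>x. a *\<^sub>R weak_gradient \<Omega> v x + b *\<^sub>R weak_gradient \<Omega> w x) \<in> L2_space \<Omega>"
    by (intro L2_space_add L2_space_scale Gv Gw)
  have 3: "is_weak_gradient \<Omega> (\<lambda>x. a * v x + b * w x) (\<lambda>x. a *\<^sub>R weak_gradient \<Omega> v x + b *\<^sub>R weak_gradient \<Omega> w x)"
    by (intro is_weak_gradient_lincomb H10_L2 v w Gv Gw)
  have 4: "(\<lambda>x. a * \<psi> k x + b * \<eta> k x) \<in> test_functions \<Omega>" for k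
    by (rule test_functions_lincomb[OF \<psi>(1) \<eta>(1)])
  have 5: "(\<lambda>k. L2_norm \<Omega> (\<lambda>x. (a * \<psi> k x + b * \<eta> k x) - (a * v x + b * w x))) \<longlonglongrightarrow> 0"
    using L2_norm_lincomb_tendsto_0[OF L2_space_diff[OF test_L2[OF \<psi>(1)] H10_L2[OF v]]
        L2_space_diff[OF test_L2[OF \<eta>(1)] H10_L2[OF w]] \<psi>(2) \<eta>(2), of a b]
    by (simp add: algebra_simps)
  have 6: "(\<lambda>k. L2_norm \<Omega> (\<lambda>x. classical_gradient (\<lambda>x. a * \<psi> k x + b * \<eta> k x) x
      - (a *\<^sub>R weak_gradient \<Omega> v x + b *\<^sub>R weak_gradient \<Omega> w x))) \<longlonglongrightarrow> 0"
    using L2_norm_lincomb_tendsto_0[OF L2_space_diff[OF gradient_L2[OF \<psi>(1)] Gv(1)]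
        L2_space_diff[OF gradient_L2[OF \<eta>(1)] Gw(1)] \<psi>(3) \<eta>(3), of a b]
    by (simp add: classical_gradient_lincomb[OF \<psi>(1) \<eta>(1)] algebra_simps)
  show "(\<lambda>x. a * v x + b * w x) \<in> H10_space \<Omega>"
    and "L2_norm \<Omega> (\<lambda>x. weak_gradient \<Omega> (\<lambda>x. a * v x + b * w x) x
        - (a *\<^sub>R weak_gradient \<Omega> v x + b *\<^sub>R weak_gradient \<Omega> w x)) = 0"
    by (rule H10I[OF 1 2 3 4 5 6])+
qed

lemma H10_zero:
  shows "(\<lambda>x. 0) \<in> H10_space \<Omega>" and "L2_norm \<Omega> (\<lambda>x. weak_gradient \<Omega> (\<lambda>x. 0) x) = 0"
  \<comment> \<open>The zero function as a trivial combination of a function known to be in the space.\<close>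
  using H10_lincomb[OF phi_H10 phi_H10, of 1 1 0 0] by simp_all

lemma H10_sum:
  fixes v :: "'i \<Rightarrow> 'a \<Rightarrow> real"
  assumes "finite I" "\<And>i. i \<in> I \<Longrightarrow> v i \<in> H10_space \<Omega>"
  shows "(\<lambda>x. \<Sum>i\<in>I. a i * v i x) \<in> H10_space \<Omega> \<and>
    L2_norm \<Omega> (\<lambda>x. weak_gradient \<Omega> (\<lambda>x. \<Sum>i\<in>I. a i * v i x) x - (\<Sum>i\<in>I. a i *\<^sub>R weak_gradient \<Omega> (v i) x)) = 0"
  using assms
proof (induction I rule: finite_induct)
  case empty
  show ?case using H10_zero by simp
next
  case (insert i I)
  let ?S = "\<lambda>x. \<Sum>j\<in>I. a j * v j x" and ?G = "\<lambda>x. \<Sum>j\<in>I. a j *\<^sub>R weak_gradient \<Omega> (v j) x"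
  let ?n = "\<lambda>x. a i * v i x + 1 * ?S x"
  have vi: "v i \<in> H10_space \<Omega>" and S: "?S \<in> H10_space \<Omega>"
    and SG: "L2_norm \<Omega> (\<lambda>x. weak_gradient \<Omega> ?S x - ?G x) = 0"
    using insert by auto
  note lc = H10_lincomb[OF vi S, of "a i" 1]
  have G: "?G \<in> L2_space \<Omega>"
    using insert.prems by (intro L2_space_sum L2_space_scale H10_weak_gradient) auto
  note Gi = L2_space_scale[OF H10_weak_gradient(1)[OF vi], of "a i"]
  have "L2_norm \<Omega> (\<lambda>x. weak_gradient \<Omega> ?n x - (a i *\<^sub>R weak_gradient \<Omega> (v i) x + ?G x))
      \<le> L2_norm \<Omega> (\<lambda>x. weak_gradient \<Omega> ?n x - (a i *\<^sub>R weak_gradient \<Omega> (v i) x + 1 *\<^sub>R weak_gradient \<Omega> ?S x))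
      + L2_norm \<Omega> (\<lambda>x. (a i *\<^sub>R weak_gradient \<Omega> (v i) x + 1 *\<^sub>R weak_gradient \<Omega> ?S x)
        - (a i *\<^sub>R weak_gradient \<Omega> (v i) x + ?G x))"
    by (intro L2_norm_triangle_diff H10_weak_gradient lc(1) L2_space_add Gi G L2_space_scale S)
  also have "\<dots> = 0 + 0"
    by (rule arg_cong2[where f = "(+)", OF lc(2)]) (simp only: scaleR_one add_diff_cancel_left SG)
  also have "0 + 0 = (0::real)" by simp
  finally have "L2_norm \<Omega> (\<lambda>x. weak_gradient \<Omega> ?n x - (a i *\<^sub>R weak_gradient \<Omega> (v i) x + ?G x)) = 0"
    by (rule antisym[OF _ L2_norm_nonneg])
  with lc(1) insert.hyps show ?case by simp
qed

lemmas H10_sum_mem = H10_sum[THEN conjunct1] and H10_sum_gradient = H10_sum[THEN conjunct2]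

lemma energy_sum:
  fixes v :: "'i \<Rightarrow> 'a \<Rightarrow> real" and w :: "'j \<Rightarrow> 'a \<Rightarrow> real"
  assumes I: "finite I" "\<And>i. i \<in> I \<Longrightarrow> v i \<in> H10_space \<Omega>"
    and J: "finite J" "\<And>j. j \<in> J \<Longrightarrow> w j \<in> H10_space \<Omega>"
  shows "energy K \<Omega> (\<lambda>x. \<Sum>i\<in>I. a i * v i x) (\<lambda>x. \<Sum>j\<in>J. b j * w j x)
    = (\<Sum>i\<in>I. \<Sum>j\<in>J. a i * b j * energy K \<Omega> (v i) (w j))"
proof -
  let ?V = "\<lambda>x. \<Sum>i\<in>I. a i *\<^sub>R weak_gradient \<Omega> (v i) x" and ?W = "\<lambda>x. \<Sum>j\<in>J. b j *\<^sub>R weak_gradient \<Omega> (w j) x"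
  have V: "?V \<in> L2_space \<Omega>" and W: "?W \<in> L2_space \<Omega>"
    using I J by (auto intro!: L2_space_sum L2_space_scale H10_weak_gradient)
  note Gv = H10_weak_gradient(1)[OF H10_sum_mem[OF I, where a = a]] and Gw = H10_weak_gradient(1)[OF H10_sum_mem[OF J, where a = b]]
  have "L2_inner \<Omega> (weak_gradient \<Omega> (\<lambda>x. \<Sum>i\<in>I. a i * v i x)) (weak_gradient \<Omega> (\<lambda>x. \<Sum>j\<in>J. b j * w j x))
      = L2_inner \<Omega> ?V (weak_gradient \<Omega> (\<lambda>x. \<Sum>j\<in>J. b j * w j x))"
    by (rule L2_inner_eq_of_norm_diff_zero[OF Gv V Gw H10_sum_gradient[OF I]])
  also have "\<dots> = L2_inner \<Omega> ?V ?W"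
    unfolding L2_inner_commute[of \<Omega> ?V]
    by (rule L2_inner_eq_of_norm_diff_zero[OF Gw W V H10_sum_gradient[OF J]])
  also have "\<dots> = (\<Sum>i\<in>I. a i * L2_inner \<Omega> (weak_gradient \<Omega> (v i)) ?W)"
    by (rule L2_inner_sum_scale_left[OF H10_weak_gradient(1)[OF I(2)] W])
  also have "\<dots> = (\<Sum>i\<in>I. a i * (\<Sum>j\<in>J. b j * L2_inner \<Omega> (weak_gradient \<Omega> (v i)) (weak_gradient \<Omega> (w j))))"
  proof (rule sum.cong[OF refl])
    fix i assume i: "i \<in> I"
    show "a i * L2_inner \<Omega> (weak_gradient \<Omega> (v i)) ?W
        = a i * (\<Sum>j\<in>J. b j * L2_inner \<Omega> (weak_gradient \<Omega> (v i)) (weak_gradient \<Omega> (w j)))"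
      by (simp only: L2_inner_sum_scale_right[OF H10_weak_gradient(1)[OF J(2)] H10_weak_gradient(1)[OF I(2)[OF i]]])
  qed
  finally show ?thesis
    by (simp add: energy_def sum_distrib_left algebra_simps)
qed

text \<open>The equation \<open>A u = h\<close> is imposed on test functions only; by density it extends to all of \<open>H10_space\<close>.\<close>

lemma dirichlet_op_weak_form:
  assumes u: "dirichlet_op K \<Omega> u h" and w: "w \<in> H10_space \<Omega>"
  shows "energy K \<Omega> u w = L2_inner \<Omega> h w"
proof -
  have uH: "u \<in> H10_space \<Omega>" and h: "h \<in> L2_space \<Omega>" using u by (auto simp: dirichlet_op_def)
  obtain \<psi> where \<psi>: "\<And>k::nat. \<psi> k \<in> test_functions \<Omega>" "(\<lambda>k. L2_norm \<Omega> (\<lambda>x. \<psi> k x - w x)) \<longlonglongrightarrow> 0"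
    "(\<lambda>k. L2_norm \<Omega> (\<lambda>x. classical_gradient (\<psi> k) x - weak_gradient \<Omega> w x)) \<longlonglongrightarrow> 0"
    by (rule H10_approx[OF w]) (rule that)
  have "(\<lambda>k. L2_inner \<Omega> (\<psi> k) h) \<longlonglongrightarrow> L2_inner \<Omega> w h"
    by (rule L2_inner_tendsto[OF test_L2[OF \<psi>(1)] H10_L2[OF w] h \<psi>(2)])
  moreover have "(\<lambda>k. L2_inner \<Omega> (classical_gradient (\<psi> k)) (\<lambda>x. K *\<^sub>R weak_gradient \<Omega> u x))
      \<longlonglongrightarrow> L2_inner \<Omega> (weak_gradient \<Omega> w) (\<lambda>x. K *\<^sub>R weak_gradient \<Omega> u x)"
    by (rule L2_inner_tendsto[OF gradient_L2[OF \<psi>(1)] H10_weak_gradient(1)[OF w]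
          L2_space_scale[OF H10_weak_gradient(1)[OF uH]] \<psi>(3)])
  moreover have "L2_inner \<Omega> (classical_gradient (\<psi> k)) (\<lambda>x. K *\<^sub>R weak_gradient \<Omega> u x) = L2_inner \<Omega> (\<psi> k) h" for k
    using u \<psi>(1) by (simp add: dirichlet_op_def L2_inner_commute)
  ultimately have "L2_inner \<Omega> w h = L2_inner \<Omega> (weak_gradient \<Omega> w) (\<lambda>x. K *\<^sub>R weak_gradient \<Omega> u x)"
    by (auto dest: LIMSEQ_unique)
  then show ?thesis by (simp add: energy_def L2_inner_scale_right L2_inner_commute)
qed

lemma energy_commute: "energy K \<Omega> v w = energy K \<Omega> w v"
  by (simp add: energy_def L2_inner_commute)

lemma energy_phi: "1 \<le> m \<Longrightarrow> w \<in> H10_space \<Omega> \<Longrightarrow> energy K \<Omega> (\<phi> m) w = lam m * L2_inner \<Omega> w (\<phi> m)"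
  using dirichlet_op_weak_form[OF phi_op] by (simp add: L2_inner_scale_left_real L2_inner_commute)

section \<open>Eigenfunction expansions and the inverse of the elliptic operator\<close>

lemma eigen_sum_inner:
  assumes "finite A" "A \<subseteq> {1..}"
  shows "L2_inner \<Omega> (\<lambda>x. \<Sum>m\<in>A. a m * \<phi> m x) (\<lambda>x. \<Sum>m\<in>A. a m * \<phi> m x) = (\<Sum>m\<in>A. (a m)\<^sup>2)"
proof -
  have L2: "(\<lambda>x. \<Sum>m\<in>A. a m * \<phi> m x) \<in> L2_space \<Omega>"
    using assms by (intro L2_space_sum L2_space_scale_real phi_L2) auto
  have k: "L2_inner \<Omega> (\<phi> k) (\<lambda>x. \<Sum>m\<in>A. a m * \<phi> m x) = a k" if "k \<in> A" for k
  proof -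
    have "L2_inner \<Omega> (\<phi> k) (\<lambda>x. \<Sum>m\<in>A. a m *\<^sub>R \<phi> m x) = (\<Sum>m\<in>A. a m * L2_inner \<Omega> (\<phi> k) (\<phi> m))"
      using assms that by (intro L2_inner_sum_scale_right phi_L2) auto
    also have "\<dots> = (\<Sum>m\<in>A. if m = k then a m else 0)"
      using assms that by (intro sum.cong refl) (auto simp: phi_orthonormal subset_iff)
    finally show ?thesis using assms(1) that by simp
  qed
  have "L2_inner \<Omega> (\<lambda>x. \<Sum>m\<in>A. a m *\<^sub>R \<phi> m x) (\<lambda>x. \<Sum>m\<in>A. a m * \<phi> m x)
      = (\<Sum>k\<in>A. a k * L2_inner \<Omega> (\<phi> k) (\<lambda>x. \<Sum>m\<in>A. a m * \<phi> m x))"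
    using assms by (intro L2_inner_sum_scale_left phi_L2 L2) auto
  then show ?thesis by (simp add: k power2_eq_square)
qed

lemma eigen_sum_energy:
  assumes "finite A" "A \<subseteq> {1..}"
  shows "energy K \<Omega> (\<lambda>x. \<Sum>m\<in>A. a m * \<phi> m x) (\<lambda>x. \<Sum>m\<in>A. a m * \<phi> m x) = (\<Sum>m\<in>A. lam m * (a m)\<^sup>2)"
proof -
  have "energy K \<Omega> (\<lambda>x. \<Sum>m\<in>A. a m * \<phi> m x) (\<lambda>x. \<Sum>m\<in>A. a m * \<phi> m x)
      = (\<Sum>m\<in>A. \<Sum>k\<in>A. a m * a k * energy K \<Omega> (\<phi> m) (\<phi> k))"
    using assms by (intro energy_sum phi_H10) auto
  also have "\<dots> = (\<Sum>m\<in>A. \<Sum>k\<in>A. if k = m then lam m * (a m)\<^sup>2 else 0)"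
    using assms by (intro sum.cong refl) (auto simp: subset_iff energy_phi phi_H10 phi_orthonormal power2_eq_square)
  finally show ?thesis using assms(1) by simp
qed

lemma Bessel:
  assumes v: "v \<in> L2_space \<Omega>"
  shows "(\<Sum>m=1..M. (L2_inner \<Omega> v (\<phi> m))\<^sup>2) \<le> L2_inner \<Omega> v v"
proof -
  let ?S = "\<lambda>x. \<Sum>m=1..M. L2_inner \<Omega> v (\<phi> m) * \<phi> m x"
  have S: "?S \<in> L2_space \<Omega>" by (intro L2_space_sum L2_space_scale_real phi_L2) auto
  have "L2_inner \<Omega> v (\<lambda>x. \<Sum>m=1..M. L2_inner \<Omega> v (\<phi> m) *\<^sub>R \<phi> m x)
      = (\<Sum>m=1..M. L2_inner \<Omega> v (\<phi> m) * L2_inner \<Omega> v (\<phi> m))"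
    by (intro L2_inner_sum_scale_right phi_L2 v) auto
  then have "L2_inner \<Omega> v ?S = (\<Sum>m=1..M. (L2_inner \<Omega> v (\<phi> m))\<^sup>2)" by (simp add: power2_eq_square)
  moreover have "L2_inner \<Omega> ?S ?S = (\<Sum>m=1..M. (L2_inner \<Omega> v (\<phi> m))\<^sup>2)"
    by (rule eigen_sum_inner) auto
  moreover have "0 \<le> L2_inner \<Omega> v v - 2 * 1 * L2_inner \<Omega> v ?S + 1\<^sup>2 * L2_inner \<Omega> ?S ?S"
    unfolding L2_inner_quadratic[OF v S, of 1, symmetric] by (rule L2_inner_self_nonneg)
  ultimately show ?thesis by simp
qed

lemma Parseval:
  assumes v: "v \<in> L2_space \<Omega>" and w: "w \<in> L2_space \<Omega>"
  shows "(\<lambda>M. \<Sum>m=1..M. L2_inner \<Omega> v (\<phi> m) * L2_inner \<Omega> w (\<phi> m)) \<longlonglongrightarrow> L2_inner \<Omega> v w"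
proof -
  let ?S = "\<lambda>M x. \<Sum>m=1..M. L2_inner \<Omega> v (\<phi> m) * \<phi> m x"
  have S: "?S M \<in> L2_space \<Omega>" for M by (intro L2_space_sum L2_space_scale_real phi_L2) auto
  have "(\<lambda>M. L2_norm \<Omega> (\<lambda>x. ?S M x - v x)) \<longlonglongrightarrow> 0"
    using phi_complete[OF v] by (subst L2_norm_minus_commute)
  from L2_inner_tendsto[OF S v w this]
  have "(\<lambda>M. L2_inner \<Omega> (?S M) w) \<longlonglongrightarrow> L2_inner \<Omega> v w" .
  moreover have "L2_inner \<Omega> (?S M) w = (\<Sum>m=1..M. L2_inner \<Omega> v (\<phi> m) * L2_inner \<Omega> w (\<phi> m))" for M
  proof -
    have "L2_inner \<Omega> (\<lambda>x. \<Sum>m=1..M. L2_inner \<Omega> v (\<phi> m) *\<^sub>R \<phi> m x) w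
        = (\<Sum>m=1..M. L2_inner \<Omega> v (\<phi> m) * L2_inner \<Omega> (\<phi> m) w)"
      by (intro L2_inner_sum_scale_left phi_L2 w) auto
    then show ?thesis by (simp add: L2_inner_commute[of \<Omega> w])
  qed
  ultimately show ?thesis by simp
qed

lemma coefficient_sum_bound:
  assumes v: "v \<in> L2_space \<Omega>" and w: "w \<in> L2_space \<Omega>"
  shows "(\<Sum>m=1..M. \<bar>L2_inner \<Omega> v (\<phi> m) * L2_inner \<Omega> w (\<phi> m)\<bar>) \<le> L2_norm \<Omega> v * L2_norm \<Omega> w"
proof -
  have "(\<Sum>m=1..M. \<bar>L2_inner \<Omega> v (\<phi> m)\<bar> * \<bar>L2_inner \<Omega> w (\<phi> m)\<bar>)
      \<le> L2_set (\<lambda>m. L2_inner \<Omega> v (\<phi> m)) {1..M} * L2_set (\<lambda>m. L2_inner \<Omega> w (\<phi> m)) {1..M}"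
    by (rule L2_set_mult_ineq)
  also have "\<dots> \<le> L2_norm \<Omega> v * L2_norm \<Omega> w"
    unfolding L2_set_def L2_norm_def
    by (intro mult_mono real_sqrt_le_mono Bessel v w) (simp_all add: L2_inner_self_nonneg sum_nonneg)
  finally show ?thesis by (simp add: abs_mult)
qed

text \<open>The gradient of \<open>v\<close> minus that of its projection to the first \<open>M\<close> eigenfunctions, formed from the individual
  weak gradients so that it is a finite combination of fixed functions.\<close>

definition gradient_remainder :: "nat \<Rightarrow> ('a \<Rightarrow> real) \<Rightarrow> 'a \<Rightarrow> 'a" where
  "gradient_remainder M v x = weak_gradient \<Omega> v x - (\<Sum>m=1..M. L2_inner \<Omega> v (\<phi> m) *\<^sub>R weak_gradient \<Omega> (\<phi> m) x)"

lemma gradient_remainder_L2: "v \<in> H10_space \<Omega> \<Longrightarrow> gradient_remainder M v \<in> L2_space \<Omega>"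
  unfolding gradient_remainder_def[abs_def]
  by (intro L2_space_diff L2_space_sum L2_space_scale H10_weak_gradient phi_H10) auto

text \<open>Removing the first \<open>M\<close> modes from the energy leaves a Gram matrix. This positivity is what makes the modal
  energies sum to at most the full memory energy.\<close>

lemma gradient_remainder_inner:
  assumes v: "v \<in> H10_space \<Omega>" and w: "w \<in> H10_space \<Omega>"
  shows "K * L2_inner \<Omega> (gradient_remainder M v) (gradient_remainder M w)
    = energy K \<Omega> v w - (\<Sum>m=1..M. lam m * (L2_inner \<Omega> v (\<phi> m) * L2_inner \<Omega> w (\<phi> m)))"
proof -
  let ?G = "weak_gradient \<Omega>" and ?c = "\<lambda>v m. L2_inner \<Omega> v (\<phi> m)"
  let ?S = "\<lambda>v x. \<Sum>m=1..M. ?c v m *\<^sub>R ?G (\<phi> m) x"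
  have S: "?S v \<in> L2_space \<Omega>" for v by (intro L2_space_sum L2_space_scale H10_weak_gradient phi_H10) auto
  have GS: "K * L2_inner \<Omega> (?G v) (?S w) = (\<Sum>m=1..M. lam m * (?c v m * ?c w m))" if v: "v \<in> H10_space \<Omega>" for v w
  proof -
    have "L2_inner \<Omega> (?G v) (?S w) = (\<Sum>m=1..M. ?c w m * L2_inner \<Omega> (?G v) (?G (\<phi> m)))"
      by (intro L2_inner_sum_scale_right H10_weak_gradient phi_H10 v) auto
    then have "K * L2_inner \<Omega> (?G v) (?S w) = (\<Sum>m=1..M. ?c w m * energy K \<Omega> (\<phi> m) v)"
      by (simp add: energy_def sum_distrib_left algebra_simps L2_inner_commute[of \<Omega> "?G v"])
    also have "\<dots> = (\<Sum>m=1..M. lam m * (?c v m * ?c w m))"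
      by (intro sum.cong refl) (simp add: energy_phi v)
    finally show ?thesis .
  qed
  have SS: "K * L2_inner \<Omega> (?S v) (?S w) = (\<Sum>m=1..M. lam m * (?c v m * ?c w m))"
  proof -
    have "L2_inner \<Omega> (?S v) (?S w) = (\<Sum>m=1..M. ?c v m * L2_inner \<Omega> (?G (\<phi> m)) (?S w))"
      by (intro L2_inner_sum_scale_left H10_weak_gradient phi_H10 S) auto
    then have "K * L2_inner \<Omega> (?S v) (?S w) = (\<Sum>m=1..M. ?c v m * (K * L2_inner \<Omega> (?G (\<phi> m)) (?S w)))"
      by (simp add: sum_distrib_left algebra_simps)
    also have "\<dots> = (\<Sum>m=1..M. lam m * (?c v m * ?c w m))"
    proof (intro sum.cong refl)
      fix m assume m: "m \<in> {1..M}"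
      have "K * L2_inner \<Omega> (?G (\<phi> m)) (?S w) = (\<Sum>k=1..M. lam k * (?c (\<phi> m) k * ?c w k))"
        using m by (intro GS phi_H10) auto
      also have "\<dots> = (\<Sum>k=1..M. if k = m then lam m * ?c w m else 0)"
        using m by (intro sum.cong refl) (auto simp: phi_orthonormal)
      also have "\<dots> = lam m * ?c w m" using m by simp
      finally show "?c v m * (K * L2_inner \<Omega> (?G (\<phi> m)) (?S w)) = lam m * (?c v m * ?c w m)" by simp
    qed
    finally show ?thesis .
  qed
  note Gv = H10_weak_gradient(1)[OF v] and Gw = H10_weak_gradient(1)[OF w]
  have "L2_inner \<Omega> (gradient_remainder M v) (gradient_remainder M w)
      = L2_inner \<Omega> (?G v) (?G w) - L2_inner \<Omega> (?G v) (?S w) - (L2_inner \<Omega> (?G w) (?S v) - L2_inner \<Omega> (?S v) (?S w))"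
    unfolding gradient_remainder_def[abs_def] L2_inner_commute[of \<Omega> "?G w"]
    by (rule L2_inner_diff_diff[OF Gv S Gw S])
  then have "K * L2_inner \<Omega> (gradient_remainder M v) (gradient_remainder M w)
      = K * L2_inner \<Omega> (?G v) (?G w) - K * L2_inner \<Omega> (?G v) (?S w)
        - (K * L2_inner \<Omega> (?G w) (?S v) - K * L2_inner \<Omega> (?S v) (?S w))"
    by (simp only: right_diff_distrib)
  then show ?thesis unfolding GS[OF v] GS[OF w] SS by (simp add: energy_def mult.commute[of "?c v _"])
qed

text \<open>Tails of the Parseval series are small; both the eigenfunction series of \<open>A\<^sup>-\<^sup>1 h\<close> and its gradients are controlled
  by these tails.\<close>

lemma squared_coefficients_Cauchy:
  assumes h: "h \<in> L2_space \<Omega>" and e: "0 < (e::real)"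
  obtains N where "\<And>L M. N \<le> L \<Longrightarrow> L \<le> M \<Longrightarrow> (\<Sum>m=Suc L..M. (L2_inner \<Omega> h (\<phi> m))\<^sup>2) < e"
proof -
  let ?s = "\<lambda>M. \<Sum>m=1..M. (L2_inner \<Omega> h (\<phi> m))\<^sup>2"
  have "Cauchy ?s"
    using LIMSEQ_imp_Cauchy[OF Parseval[OF h h]] by (simp add: power2_eq_square)
  then obtain N where N: "\<And>i j. N \<le> i \<Longrightarrow> N \<le> j \<Longrightarrow> dist (?s i) (?s j) < e"
    using e unfolding Cauchy_def by blast
  have "(\<Sum>m=Suc L..M. (L2_inner \<Omega> h (\<phi> m))\<^sup>2) < e" if "N \<le> L" "L \<le> M" for L M
  proof -
    have "?s M = ?s L + (\<Sum>m=Suc L..M. (L2_inner \<Omega> h (\<phi> m))\<^sup>2)"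
      using that sum.ub_add_nat[of 1 L "\<lambda>m. (L2_inner \<Omega> h (\<phi> m))\<^sup>2" "M - L"] by simp
    moreover have "dist (?s M) (?s L) < e" using N[of M L] that by simp
    ultimately show ?thesis by (simp add: dist_real_def)
  qed
  then show ?thesis by (rule that)
qed

lemma eigen_sum_diff:
  assumes "L \<le> M"
  shows "(\<Sum>m=1..M. a m * \<phi> m x) - (\<Sum>m=1..L. a m * \<phi> m x) = (\<Sum>m=Suc L..M. a m * \<phi> m x)"
  using assms sum.ub_add_nat[of 1 L "\<lambda>m. a m * \<phi> m x" "M - L"] by simp

lemma Cauchy_of_ordered:
  fixes v :: "nat \<Rightarrow> 'a \<Rightarrow> 'b::euclidean_space"
  assumes "\<And>L M. N \<le> L \<Longrightarrow> L \<le> M \<Longrightarrow> L2_norm \<Omega> (\<lambda>x. v M x - v L x) < e"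
  shows "\<exists>N. \<forall>i\<ge>N. \<forall>j\<ge>N. L2_norm \<Omega> (\<lambda>x. v i x - v j x) < e"
proof (intro exI allI impI)
  fix i j assume "N \<le> i" "N \<le> j"
  then show "L2_norm \<Omega> (\<lambda>x. v i x - v j x) < e"
    using assms[of i j] assms[of j i] L2_norm_minus_commute[of \<Omega> "v i" "v j"]
    by (cases "i \<le> j") auto
qed

lemma H10_close_test_function:
  assumes v: "v \<in> H10_space \<Omega>" and e: "0 < (e::real)"
  shows "\<exists>\<psi>. \<psi> \<in> test_functions \<Omega> \<and> L2_norm \<Omega> (\<lambda>x. \<psi> x - v x) < e
    \<and> L2_norm \<Omega> (\<lambda>x. classical_gradient \<psi> x - weak_gradient \<Omega> v x) < e"
proof -
  obtain \<psi> where \<psi>: "\<And>k::nat. \<psi> k \<in> test_functions \<Omega>" "(\<lambda>k. L2_norm \<Omega> (\<lambda>x. \<psi> k x - v x)) \<longlonglongrightarrow> 0"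
    "(\<lambda>k. L2_norm \<Omega> (\<lambda>x. classical_gradient (\<psi> k) x - weak_gradient \<Omega> v x)) \<longlonglongrightarrow> 0"
    by (rule H10_approx[OF v]) (rule that)
  have "\<forall>\<^sub>F k in sequentially. L2_norm \<Omega> (\<lambda>x. \<psi> k x - v x) < e
      \<and> L2_norm \<Omega> (\<lambda>x. classical_gradient (\<psi> k) x - weak_gradient \<Omega> v x) < e"
    using order_tendstoD(2)[OF \<psi>(2) e] order_tendstoD(2)[OF \<psi>(3) e] by eventually_elim simp
  then obtain k where "L2_norm \<Omega> (\<lambda>x. \<psi> k x - v x) < e
      \<and> L2_norm \<Omega> (\<lambda>x. classical_gradient (\<psi> k) x - weak_gradient \<Omega> v x) < e"
    using eventually_happens'[OF sequentially_bot] by blast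
  then show ?thesis using \<psi>(1) by blast
qed

text \<open>Each \<open>v k\<close> is replaced by a test function within \<open>1 / (k + 1)\<close> of it, in value and in gradient; these test
  functions then approximate the limit.\<close>

lemma H10_closed:
  assumes v: "\<And>k::nat. v k \<in> H10_space \<Omega>" and u: "u \<in> L2_space \<Omega>" and G: "G \<in> L2_space \<Omega>"
    and lim: "(\<lambda>k. L2_norm \<Omega> (\<lambda>x. v k x - u x)) \<longlonglongrightarrow> 0"
    and lim_grad: "(\<lambda>k. L2_norm \<Omega> (\<lambda>x. weak_gradient \<Omega> (v k) x - G x)) \<longlonglongrightarrow> 0"
  shows "u \<in> H10_space \<Omega>" and "L2_norm \<Omega> (\<lambda>x. weak_gradient \<Omega> u x - G x) = 0"
proof -
  let ?W = "\<lambda>k. weak_gradient \<Omega> (v k)"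
  have W: "?W k \<in> L2_space \<Omega>" for k by (rule H10_weak_gradient(1)[OF v])
  have wg: "is_weak_gradient \<Omega> u G"
    unfolding is_weak_gradient_iff
  proof (intro ballI)
    fix \<psi> b assume \<psi>: "\<psi> \<in> test_functions \<Omega>" and b: "b \<in> (Basis :: 'a set)"
    let ?d = "\<lambda>x. frechet_derivative \<psi> (at x) b"
    have d: "?d \<in> L2_space \<Omega>" by (rule test_L2[OF test_functions_partial[OF \<psi> b]])
    have sb: "(\<lambda>x. \<psi> x *\<^sub>R b) \<in> L2_space \<Omega>"
      using test_L2[OF \<psi>] by (auto simp: L2_space_def power_mult_distrib)
    have eq: "L2_inner \<Omega> (\<lambda>x. H x \<bullet> b) \<psi> = L2_inner \<Omega> H (\<lambda>x. \<psi> x *\<^sub>R b)" for H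
      by (simp add: L2_inner_def mult.commute)
    have "(\<lambda>k. L2_inner \<Omega> (v k) ?d) \<longlonglongrightarrow> L2_inner \<Omega> u ?d"
      by (rule L2_inner_tendsto[OF H10_L2[OF v] u d lim])
    moreover have "(\<lambda>k. - L2_inner \<Omega> (?W k) (\<lambda>x. \<psi> x *\<^sub>R b)) \<longlonglongrightarrow> - L2_inner \<Omega> G (\<lambda>x. \<psi> x *\<^sub>R b)"
      by (rule tendsto_minus[OF L2_inner_tendsto[OF W G sb lim_grad]])
    moreover have "L2_inner \<Omega> (v k) ?d = - L2_inner \<Omega> (?W k) (\<lambda>x. \<psi> x *\<^sub>R b)" for k
      unfolding eq[symmetric]
      using H10_weak_gradient(2)[OF v, of k] \<psi> b unfolding is_weak_gradient_iff by blast
    ultimately show "L2_inner \<Omega> u ?d = - L2_inner \<Omega> (\<lambda>x. G x \<bullet> b) \<psi>"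
      unfolding eq by (auto dest: LIMSEQ_unique)
  qed
  have "\<forall>k. \<exists>\<psi>. \<psi> \<in> test_functions \<Omega> \<and> L2_norm \<Omega> (\<lambda>x. \<psi> x - v k x) < 1 / real (Suc k)
      \<and> L2_norm \<Omega> (\<lambda>x. classical_gradient \<psi> x - ?W k x) < 1 / real (Suc k)"
    by (intro allI H10_close_test_function[OF v]) simp
  then obtain \<psi> where "\<forall>k. \<psi> k \<in> test_functions \<Omega> \<and> L2_norm \<Omega> (\<lambda>x. \<psi> k x - v k x) < 1 / real (Suc k)
      \<and> L2_norm \<Omega> (\<lambda>x. classical_gradient (\<psi> k) x - ?W k x) < 1 / real (Suc k)"
    by (rule choice[THEN exE])
  then have \<psi>: "\<And>k. \<psi> k \<in> test_functions \<Omega>"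
      and close: "\<And>k. L2_norm \<Omega> (\<lambda>x. \<psi> k x - v k x) < 1 / real (Suc k)"
        "\<And>k. L2_norm \<Omega> (\<lambda>x. classical_gradient (\<psi> k) x - ?W k x) < 1 / real (Suc k)"
    by blast+
  have inv: "(\<lambda>k. 1 / real (Suc k)) \<longlonglongrightarrow> 0"
    using LIMSEQ_inverse_real_of_nat by (simp add: inverse_eq_divide)
  have "(\<lambda>k. L2_norm \<Omega> (\<lambda>x. \<psi> k x - u x)) \<longlonglongrightarrow> 0"
  proof (rule Lim_null_comparison)
    show "\<forall>\<^sub>F k in sequentially. norm (L2_norm \<Omega> (\<lambda>x. \<psi> k x - u x)) \<le> 1 / real (Suc k) + L2_norm \<Omega> (\<lambda>x. v k x - u x)"
    proof (rule always_eventually, rule allI)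
      fix k show "norm (L2_norm \<Omega> (\<lambda>x. \<psi> k x - u x)) \<le> 1 / real (Suc k) + L2_norm \<Omega> (\<lambda>x. v k x - u x)"
        using L2_norm_triangle_diff[OF test_L2[OF \<psi>] H10_L2[OF v] u, of k k] close(1)[of k]
          L2_norm_nonneg[of \<Omega> "\<lambda>x. \<psi> k x - u x"] by simp
    qed
    show "(\<lambda>k. 1 / real (Suc k) + L2_norm \<Omega> (\<lambda>x. v k x - u x)) \<longlonglongrightarrow> 0"
      using tendsto_add[OF inv lim] by simp
  qed
  moreover have "(\<lambda>k. L2_norm \<Omega> (\<lambda>x. classical_gradient (\<psi> k) x - G x)) \<longlonglongrightarrow> 0"
  proof (rule Lim_null_comparison)
    show "\<forall>\<^sub>F k in sequentially. norm (L2_norm \<Omega> (\<lambda>x. classical_gradient (\<psi> k) x - G x))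
        \<le> 1 / real (Suc k) + L2_norm \<Omega> (\<lambda>x. ?W k x - G x)"
    proof (rule always_eventually, rule allI)
      fix k show "norm (L2_norm \<Omega> (\<lambda>x. classical_gradient (\<psi> k) x - G x))
          \<le> 1 / real (Suc k) + L2_norm \<Omega> (\<lambda>x. ?W k x - G x)"
        using L2_norm_triangle_diff[OF gradient_L2[OF \<psi>] W G, of k k] close(2)[of k]
          L2_norm_nonneg[of \<Omega> "\<lambda>x. classical_gradient (\<psi> k) x - G x"] by simp
    qed
    show "(\<lambda>k. 1 / real (Suc k) + L2_norm \<Omega> (\<lambda>x. ?W k x - G x)) \<longlonglongrightarrow> 0"
      using tendsto_add[OF inv lim_grad] by simp
  qed
  ultimately show "u \<in> H10_space \<Omega>" and "L2_norm \<Omega> (\<lambda>x. weak_gradient \<Omega> u x - G x) = 0"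
    by (rule H10I[OF u G wg \<psi>])+
qed

text \<open>The solution is the eigenfunction series with coefficients \<open>\<langle>h, \<phi>\<^sub>m\<rangle> / \<lambda>\<^sub>m\<close>. Since \<open>\<lambda>\<^sub>m \<ge> \<lambda>\<^sub>1 > 0\<close>, the tails of
  the series and of its gradients are bounded by those of \<open>\<parallel>h\<parallel>\<^sup>2\<close>, and completeness of \<open>L\<^sub>2\<close> supplies
  the limits.\<close>

lemma dirichlet_solution_exists:
  assumes h: "h \<in> L2_space \<Omega>"
  shows "\<exists>u. dirichlet_op K \<Omega> u h"
proof -
  define a where "a m = L2_inner \<Omega> h (\<phi> m) / lam m" for m
  define v where "v M x = (\<Sum>m=1..M. a m * \<phi> m x)" for M :: nat and x
  have vH: "v M \<in> H10_space \<Omega>" for M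
    unfolding v_def[abs_def] by (intro H10_sum_mem phi_H10) auto
  let ?W = "\<lambda>M. weak_gradient \<Omega> (v M)"
  have W: "?W M \<in> L2_space \<Omega>" for M by (rule H10_weak_gradient(1)[OF vH])
  have L2diff: "(L2_norm \<Omega> (\<lambda>x. v M x - v L x))\<^sup>2 = (\<Sum>m=Suc L..M. (a m)\<^sup>2)" if "L \<le> M" for L M
    unfolding L2_norm_power2 v_def eigen_sum_diff[OF that] by (rule eigen_sum_inner) auto
  have grad_diff: "K * (L2_norm \<Omega> (\<lambda>x. ?W M x - ?W L x))\<^sup>2 = (\<Sum>m=Suc L..M. lam m * (a m)\<^sup>2)" if "L \<le> M" for L M
  proof -
    let ?D = "weak_gradient \<Omega> (\<lambda>x. 1 * v M x + (-1) * v L x)"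
    note lc = H10_lincomb[OF vH vH, of 1 M "-1" L]
    have D: "?D \<in> L2_space \<Omega>" by (rule H10_weak_gradient(1)[OF lc(1)])
    have WD: "(\<lambda>x. ?W M x - ?W L x) \<in> L2_space \<Omega>" by (rule L2_space_diff[OF W W])
    have z: "L2_norm \<Omega> (\<lambda>x. ?D x - (?W M x - ?W L x)) = 0" using lc(2) by simp
    have "L2_inner \<Omega> (\<lambda>x. ?W M x - ?W L x) (\<lambda>x. ?W M x - ?W L x) = L2_inner \<Omega> ?D (\<lambda>x. ?W M x - ?W L x)"
      by (rule L2_inner_eq_of_norm_diff_zero[OF D WD WD z, symmetric])
    also have "\<dots> = L2_inner \<Omega> ?D ?D"
      unfolding L2_inner_commute[of \<Omega> ?D "\<lambda>x. ?W M x - ?W L x"]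
      by (rule L2_inner_eq_of_norm_diff_zero[OF D WD D z, symmetric])
    finally have "K * (L2_norm \<Omega> (\<lambda>x. ?W M x - ?W L x))\<^sup>2
        = energy K \<Omega> (\<lambda>x. 1 * v M x + (-1) * v L x) (\<lambda>x. 1 * v M x + (-1) * v L x)"
      by (simp add: energy_def L2_norm_power2)
    also have "(\<lambda>x. 1 * v M x + (-1) * v L x) = (\<lambda>x. \<Sum>m=Suc L..M. a m * \<phi> m x)"
      using eigen_sum_diff[OF that, of a] by (simp add: v_def)
    also have "energy K \<Omega> (\<lambda>x. \<Sum>m=Suc L..M. a m * \<phi> m x) (\<lambda>x. \<Sum>m=Suc L..M. a m * \<phi> m x)
        = (\<Sum>m=Suc L..M. lam m * (a m)\<^sup>2)"
      by (rule eigen_sum_energy) auto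
    finally show ?thesis .
  qed
  have a2: "(a m)\<^sup>2 \<le> (L2_inner \<Omega> h (\<phi> m))\<^sup>2 / (lam 1)\<^sup>2" and la2: "lam m * (a m)\<^sup>2 \<le> (L2_inner \<Omega> h (\<phi> m))\<^sup>2 / lam 1"
    if "1 \<le> m" for m
  proof -
    have l: "lam 1 \<le> lam m" "0 < lam m" "0 < lam 1" using lam_ge[OF that] lam_pos[OF that] lam_1_pos by auto
    show "(a m)\<^sup>2 \<le> (L2_inner \<Omega> h (\<phi> m))\<^sup>2 / (lam 1)\<^sup>2"
      unfolding a_def power_divide using l by (intro divide_left_mono power_mono) auto
    have "lam m * (a m)\<^sup>2 = (L2_inner \<Omega> h (\<phi> m))\<^sup>2 / lam m"
      using l by (simp add: a_def power2_eq_square field_simps)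
    also have "\<dots> \<le> (L2_inner \<Omega> h (\<phi> m))\<^sup>2 / lam 1"
      using l by (intro divide_left_mono) auto
    finally show "lam m * (a m)\<^sup>2 \<le> (L2_inner \<Omega> h (\<phi> m))\<^sup>2 / lam 1" .
  qed
  obtain u where u: "u \<in> L2_space \<Omega>" "(\<lambda>M. L2_norm \<Omega> (\<lambda>x. v M x - u x)) \<longlonglongrightarrow> 0"
  proof (rule L2_complete[OF domain_measurable H10_L2[OF vH]])
    fix e :: real assume e: "0 < e"
    have "0 < (e * lam 1)\<^sup>2" using e lam_1_pos by simp
    then obtain N where N: "\<And>L M. N \<le> L \<Longrightarrow> L \<le> M \<Longrightarrow> (\<Sum>m=Suc L..M. (L2_inner \<Omega> h (\<phi> m))\<^sup>2) < (e * lam 1)\<^sup>2"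
      by (rule squared_coefficients_Cauchy[OF h]) (rule that)
    show "\<exists>N. \<forall>i\<ge>N. \<forall>j\<ge>N. L2_norm \<Omega> (\<lambda>x. v i x - v j x) < e"
    proof (rule Cauchy_of_ordered[where N = N])
      fix L M assume LM: "N \<le> L" "L \<le> M"
      have "(L2_norm \<Omega> (\<lambda>x. v M x - v L x))\<^sup>2 \<le> (\<Sum>m=Suc L..M. (L2_inner \<Omega> h (\<phi> m))\<^sup>2 / (lam 1)\<^sup>2)"
        unfolding L2diff[OF LM(2)] by (intro sum_mono a2) auto
      also have "\<dots> = (\<Sum>m=Suc L..M. (L2_inner \<Omega> h (\<phi> m))\<^sup>2) / (lam 1)\<^sup>2"
        by (rule sum_divide_distrib[symmetric])
      also have "\<dots> < (e * lam 1)\<^sup>2 / (lam 1)\<^sup>2"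
        using N[OF LM] lam_1_pos by (intro divide_strict_right_mono) auto
      also have "\<dots> = e\<^sup>2" using lam_1_pos by (simp add: power_mult_distrib)
      finally show "L2_norm \<Omega> (\<lambda>x. v M x - v L x) < e"
        by (rule power2_less_imp_less) (use e in simp)
    qed
  qed (rule that)
  obtain G where G: "G \<in> L2_space \<Omega>" "(\<lambda>M. L2_norm \<Omega> (\<lambda>x. ?W M x - G x)) \<longlonglongrightarrow> 0"
  proof (rule L2_complete[OF domain_measurable W])
    fix e :: real assume e: "0 < e"
    have "0 < K * lam 1 * e\<^sup>2" using e lam_1_pos K_pos by simp
    then obtain N where N: "\<And>L M. N \<le> L \<Longrightarrow> L \<le> M \<Longrightarrow> (\<Sum>m=Suc L..M. (L2_inner \<Omega> h (\<phi> m))\<^sup>2) < K * lam 1 * e\<^sup>2"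
      by (rule squared_coefficients_Cauchy[OF h]) (rule that)
    show "\<exists>N. \<forall>i\<ge>N. \<forall>j\<ge>N. L2_norm \<Omega> (\<lambda>x. ?W i x - ?W j x) < e"
    proof (rule Cauchy_of_ordered[where N = N])
      fix L M assume LM: "N \<le> L" "L \<le> M"
      have "K * (L2_norm \<Omega> (\<lambda>x. ?W M x - ?W L x))\<^sup>2 \<le> (\<Sum>m=Suc L..M. (L2_inner \<Omega> h (\<phi> m))\<^sup>2 / lam 1)"
        unfolding grad_diff[OF LM(2)] by (intro sum_mono la2) auto
      also have "\<dots> = (\<Sum>m=Suc L..M. (L2_inner \<Omega> h (\<phi> m))\<^sup>2) / lam 1"
        by (rule sum_divide_distrib[symmetric])
      also have "\<dots> < (K * lam 1 * e\<^sup>2) / lam 1"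
        using N[OF LM] lam_1_pos by (intro divide_strict_right_mono) auto
      also have "\<dots> = K * e\<^sup>2" using lam_1_pos by simp
      finally have "(L2_norm \<Omega> (\<lambda>x. ?W M x - ?W L x))\<^sup>2 < e\<^sup>2" using K_pos by simp
      then show "L2_norm \<Omega> (\<lambda>x. ?W M x - ?W L x) < e"
        by (rule power2_less_imp_less) (use e in simp)
    qed
  qed (rule that)
  note uH = H10_closed[OF vH u(1) G(1) u(2) G(2)]
  have "L2_inner \<Omega> (\<lambda>x. K *\<^sub>R weak_gradient \<Omega> u x) (classical_gradient \<psi>) = L2_inner \<Omega> h \<psi>"
    if \<psi>: "\<psi> \<in> test_functions \<Omega>" for \<psi>
  proof -
    note g = gradient_L2[OF \<psi>]
    have "K * L2_inner \<Omega> (?W M) (classical_gradient \<psi>) = (\<Sum>m=1..M. L2_inner \<Omega> h (\<phi> m) * L2_inner \<Omega> \<psi> (\<phi> m))" for M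
    proof -
      let ?S = "\<lambda>x. \<Sum>m=1..M. a m *\<^sub>R weak_gradient \<Omega> (\<phi> m) x"
      have S: "?S \<in> L2_space \<Omega>" by (intro L2_space_sum L2_space_scale H10_weak_gradient phi_H10) auto
      have z: "L2_norm \<Omega> (\<lambda>x. ?W M x - ?S x) = 0"
        unfolding v_def[abs_def] by (intro H10_sum_gradient phi_H10) auto
      have "L2_inner \<Omega> (?W M) (classical_gradient \<psi>) = L2_inner \<Omega> ?S (classical_gradient \<psi>)"
        by (rule L2_inner_eq_of_norm_diff_zero[OF W S g z])
      also have "\<dots> = (\<Sum>m=1..M. a m * L2_inner \<Omega> (weak_gradient \<Omega> (\<phi> m)) (classical_gradient \<psi>))"
        by (intro L2_inner_sum_scale_left H10_weak_gradient phi_H10 g) auto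
      finally have "K * L2_inner \<Omega> (?W M) (classical_gradient \<psi>)
          = (\<Sum>m=1..M. a m * L2_inner \<Omega> (\<lambda>x. K *\<^sub>R weak_gradient \<Omega> (\<phi> m) x) (classical_gradient \<psi>))"
        by (simp add: sum_distrib_left L2_inner_scale_left algebra_simps)
      also have "\<dots> = (\<Sum>m=1..M. L2_inner \<Omega> h (\<phi> m) * L2_inner \<Omega> \<psi> (\<phi> m))"
      proof (rule sum.cong[OF refl])
        fix m assume "m \<in> {1..M}"
        then have m: "1 \<le> m" by simp
        have "L2_inner \<Omega> (\<lambda>x. K *\<^sub>R weak_gradient \<Omega> (\<phi> m) x) (classical_gradient \<psi>) = lam m * L2_inner \<Omega> \<psi> (\<phi> m)"
          using phi_op[OF m] \<psi> by (simp add: dirichlet_op_def L2_inner_scale_left_real L2_inner_commute)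
        then show "a m * L2_inner \<Omega> (\<lambda>x. K *\<^sub>R weak_gradient \<Omega> (\<phi> m) x) (classical_gradient \<psi>)
            = L2_inner \<Omega> h (\<phi> m) * L2_inner \<Omega> \<psi> (\<phi> m)"
          using lam_pos[OF m] by (simp add: a_def)
      qed
      finally show ?thesis .
    qed
    then have "(\<lambda>M. K * L2_inner \<Omega> (?W M) (classical_gradient \<psi>)) \<longlonglongrightarrow> L2_inner \<Omega> h \<psi>"
      using Parseval[OF h test_L2[OF \<psi>]] by simp
    moreover have "(\<lambda>M. K * L2_inner \<Omega> (?W M) (classical_gradient \<psi>)) \<longlonglongrightarrow> K * L2_inner \<Omega> G (classical_gradient \<psi>)"
      by (rule tendsto_mult_left[OF L2_inner_tendsto[OF W G(1) g G(2)]])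
    ultimately have "K * L2_inner \<Omega> G (classical_gradient \<psi>) = L2_inner \<Omega> h \<psi>" by (auto dest: LIMSEQ_unique)
    moreover have "L2_inner \<Omega> (weak_gradient \<Omega> u) (classical_gradient \<psi>) = L2_inner \<Omega> G (classical_gradient \<psi>)"
      by (rule L2_inner_eq_of_norm_diff_zero[OF H10_weak_gradient(1)[OF uH(1)] G(1) g uH(2)])
    ultimately show ?thesis by (simp add: L2_inner_scale_left)
  qed
  then show ?thesis using uH(1) h by (auto simp: dirichlet_op_def)
qed

lemma dirichlet_inverse_op: "h \<in> L2_space \<Omega> \<Longrightarrow> dirichlet_op K \<Omega> (dirichlet_inverse K \<Omega> h) h"
  unfolding dirichlet_inverse_def by (rule someI_ex[OF dirichlet_solution_exists])

lemma dirichlet_inverse_H10: "h \<in> L2_space \<Omega> \<Longrightarrow> dirichlet_inverse K \<Omega> h \<in> H10_space \<Omega>"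
  using dirichlet_inverse_op by (simp add: dirichlet_op_def)

lemma dirichlet_inverse_coefficient:
  assumes h: "h \<in> L2_space \<Omega>" and m: "1 \<le> m"
  shows "L2_inner \<Omega> (dirichlet_inverse K \<Omega> h) (\<phi> m) = L2_inner \<Omega> h (\<phi> m) / lam m"
proof -
  let ?u = "dirichlet_inverse K \<Omega> h"
  have "lam m * L2_inner \<Omega> ?u (\<phi> m) = energy K \<Omega> ?u (\<phi> m)"
    unfolding energy_commute[of ?u] by (rule energy_phi[OF m dirichlet_inverse_H10[OF h], symmetric])
  also have "\<dots> = L2_inner \<Omega> h (\<phi> m)" by (rule dirichlet_op_weak_form[OF dirichlet_inverse_op[OF h] phi_H10[OF m]])
  finally show ?thesis using lam_pos[OF m] by (simp add: field_simps)
qed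

end

section \<open>Expansion of the source term\<close>

lemma AE_lebesgue_pair_both:
  assumes "AE x in (lebesgue :: real measure). P x"
  shows "AE z in lebesgue \<Otimes>\<^sub>M (lebesgue :: real measure). P (fst z) \<and> P (snd z)"
proof -
  from assms obtain N where N: "{x. \<not> P x} \<subseteq> N" "N \<in> null_sets (lebesgue :: real measure)"
    by (auto simp: eventually_ae_filter)
  have "N \<times> UNIV \<in> null_sets (lebesgue \<Otimes>\<^sub>M (lebesgue :: real measure))"
    by (rule leb.times_in_null_sets1[OF N(2)]) simp
  moreover have "UNIV \<times> N \<in> null_sets (lebesgue \<Otimes>\<^sub>M (lebesgue :: real measure))"
    by (rule leb.times_in_null_sets2[OF _ N(2)]) simp
  ultimately have "N \<times> UNIV \<union> UNIV \<times> N \<in> null_sets (lebesgue \<Otimes>\<^sub>M (lebesgue :: real measure))" by auto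
  then show ?thesis by (rule AE_I') (use N(1) in auto)
qed

lemma L2_norm_abs: "L2_norm \<Omega> (\<lambda>x. \<bar>v x\<bar> :: real) = L2_norm \<Omega> v"
  by (simp add: L2_norm_def L2_inner_def)

lemma L2_space_abs: "v \<in> L2_space \<Omega> \<Longrightarrow> (\<lambda>x. \<bar>v x\<bar> :: real) \<in> L2_space \<Omega>"
  by (auto simp: L2_space_def)

context dirichlet_problem begin

lemma dirichlet_inverse_norm:
  assumes h: "h \<in> L2_space \<Omega>"
  shows "L2_norm \<Omega> (dirichlet_inverse K \<Omega> h) \<le> L2_norm \<Omega> h / lam 1"
proof -
  let ?u = "dirichlet_inverse K \<Omega> h"
  have u: "?u \<in> L2_space \<Omega>" by (rule H10_L2[OF dirichlet_inverse_H10[OF h]])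
  have l: "0 < lam 1" by (rule lam_1_pos)
  have "L2_inner \<Omega> ?u ?u \<le> L2_inner \<Omega> h h / (lam 1)\<^sup>2"
  proof (rule LIMSEQ_le_const2[OF Parseval[OF u u]], intro exI allI impI)
    fix M :: nat
    have "(\<Sum>m=1..M. L2_inner \<Omega> ?u (\<phi> m) * L2_inner \<Omega> ?u (\<phi> m))
        \<le> (\<Sum>m=1..M. (L2_inner \<Omega> h (\<phi> m))\<^sup>2 / (lam 1)\<^sup>2)"
    proof (rule sum_mono)
      fix m assume "m \<in> {1..M}"
      then have m: "1 \<le> m" by simp
      have "(L2_inner \<Omega> h (\<phi> m))\<^sup>2 / (lam m)\<^sup>2 \<le> (L2_inner \<Omega> h (\<phi> m))\<^sup>2 / (lam 1)\<^sup>2"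
        using l lam_ge[OF m] lam_pos[OF m] by (intro divide_left_mono power_mono) auto
      then show "L2_inner \<Omega> ?u (\<phi> m) * L2_inner \<Omega> ?u (\<phi> m) \<le> (L2_inner \<Omega> h (\<phi> m))\<^sup>2 / (lam 1)\<^sup>2"
        by (simp add: dirichlet_inverse_coefficient[OF h m] power2_eq_square)
    qed
    also have "\<dots> = (\<Sum>m=1..M. (L2_inner \<Omega> h (\<phi> m))\<^sup>2) / (lam 1)\<^sup>2"
      by (rule sum_divide_distrib[symmetric])
    also have "\<dots> \<le> L2_inner \<Omega> h h / (lam 1)\<^sup>2"
      by (intro divide_right_mono Bessel h) simp
    finally show "(\<Sum>m=1..M. L2_inner \<Omega> ?u (\<phi> m) * L2_inner \<Omega> ?u (\<phi> m)) \<le> L2_inner \<Omega> h h / (lam 1)\<^sup>2" .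
  qed
  then have "sqrt (L2_inner \<Omega> ?u ?u) \<le> sqrt (L2_inner \<Omega> h h / (lam 1)\<^sup>2)" by (rule real_sqrt_le_mono)
  then show ?thesis using l by (simp add: L2_norm_def real_sqrt_divide)
qed

end

locale source_problem = dirichlet_problem K \<Omega> \<phi> lam
  for K :: real and \<Omega> :: "'a::euclidean_space set" and \<phi> lam +
  fixes \<alpha> T \<tau> :: real and f :: "real \<Rightarrow> 'a \<Rightarrow> real"
  assumes alpha: "- 1 < \<alpha>" "\<alpha> < 0" and tau: "0 \<le> \<tau>" "\<tau> \<le> T"
    and source: "regular_source \<alpha> T \<Omega> f"
begin

abbreviation "\<mu> \<equiv> - \<alpha>"

definition source_coeff :: "('a \<Rightarrow> real) \<Rightarrow> real \<Rightarrow> real" where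
  "source_coeff w s = indicator {0..\<tau>} s * L2_inner \<Omega> (f s) w"

definition source_norm :: "real \<Rightarrow> real" where
  "source_norm s = indicator {0..\<tau>} s * L2_norm \<Omega> (f s)"

sublocale space: finite_measure "lebesgue_on \<Omega>"
  by (rule finite_measure_lebesgue_on[OF domain_measurable])

lemma ck_nonneg: "0 \<le> causal_kernel \<mu> r"
  using alpha by (simp add: causal_kernel_nonneg)

lemma source_measurable: "case_prod f \<in> borel_measurable (lebesgue_on {0..T} \<Otimes>\<^sub>M lebesgue_on \<Omega>)"
  using source by (simp add: regular_source_def)

lemma AE_source_L2: "AE s in lebesgue. s \<in> {0..\<tau>} \<longrightarrow> f s \<in> L2_space \<Omega>"
proof -
  have "AE s in lebesgue_on {0..T}. f s \<in> L2_space \<Omega>" using source by (simp add: regular_source_def)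
  then have "AE s in lebesgue. s \<in> {0..T} \<longrightarrow> f s \<in> L2_space \<Omega>"
    by (subst (asm) AE_restrict_space_iff) auto
  then show ?thesis by eventually_elim (use tau in auto)
qed

lemma cut_measurable:
  fixes h :: "real \<Rightarrow> real"
  assumes "h \<in> borel_measurable (lebesgue_on {0..T})"
  shows "(\<lambda>s. indicator {0..\<tau>} s * h s) \<in> borel_measurable lebesgue"
proof -
  have m: "(\<lambda>s. indicator {0..T} s *\<^sub>R h s) \<in> borel_measurable lebesgue"
    using assms by (subst (asm) borel_measurable_restrict_space_iff) auto
  have "(\<lambda>s. indicator {0..\<tau>} s * (indicator {0..T} s *\<^sub>R h s)) \<in> borel_measurable lebesgue"
    by (rule borel_measurable_times[OF borel_imp_lebesgue_measurable m]) simp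
  also have "(\<lambda>s. indicator {0..\<tau>} s * (indicator {0..T} s *\<^sub>R h s)) = (\<lambda>s. indicator {0..\<tau>} s * h s)"
    using tau by (auto simp: indicator_def)
  finally show ?thesis .
qed

lemma source_coeff_measurable[measurable]:
  assumes "w \<in> L2_space \<Omega>"
  shows "source_coeff w \<in> borel_measurable lebesgue"
proof -
  note [measurable] = source_measurable L2_spaceD_measurable[OF assms]
  have "(\<lambda>s. L2_inner \<Omega> (f s) w) \<in> borel_measurable (lebesgue_on {0..T})"
    unfolding L2_inner_def by (rule space.borel_measurable_lebesgue_integral) measurable
  from cut_measurable[OF this] show ?thesis by (simp add: source_coeff_def[abs_def])
qed

lemma source_norm_integrable: "integrable lebesgue source_norm"
proof -
  have "set_integrable lebesgue {0..T} (\<lambda>s. L2_norm \<Omega> (f s))"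
    using source by (simp add: regular_source_def)
  then have "set_integrable lebesgue {0..\<tau>} (\<lambda>s. L2_norm \<Omega> (f s))"
    by (rule set_integrable_subset) (use tau in auto)
  then show ?thesis by (simp add: set_integrable_def source_norm_def[abs_def])
qed

lemma source_norm_measurable[measurable]: "source_norm \<in> borel_measurable lebesgue"
  by (rule borel_measurable_integrable[OF source_norm_integrable])

lemma source_norm_nonneg: "0 \<le> source_norm s"
  by (simp add: source_norm_def L2_norm_nonneg)

lemma source_coeff_bound:
  assumes "s \<in> {0..\<tau>} \<longrightarrow> f s \<in> L2_space \<Omega>" "w \<in> L2_space \<Omega>"
  shows "\<bar>source_coeff w s\<bar> \<le> source_norm s * L2_norm \<Omega> w"
  using assms L2_Cauchy_Schwarz[of "f s" \<Omega> w]
  by (auto simp: source_coeff_def source_norm_def indicator_def)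

lemma measurable_fst_compose:
  "h \<in> borel_measurable lebesgue \<Longrightarrow> (\<lambda>z. h (fst z)) \<in> borel_measurable (lebesgue \<Otimes>\<^sub>M N)"
  by (rule measurable_compose[OF measurable_fst])

lemma measurable_snd_compose:
  "h \<in> borel_measurable lebesgue \<Longrightarrow> (\<lambda>z. h (snd z)) \<in> borel_measurable (N \<Otimes>\<^sub>M lebesgue)"
  by (rule measurable_compose[OF measurable_snd])

lemma source_kernel_integrable:
  "integrable (lebesgue \<Otimes>\<^sub>M lebesgue) (\<lambda>z. causal_kernel \<mu> (fst z - snd z) * (source_norm (fst z) * source_norm (snd z)))"
proof (rule Bochner_Integration.integrable_bound)
  let ?S = "{(r, s). 0 < s \<and> s < r \<and> r < T}"
  show "integrable (lebesgue \<Otimes>\<^sub>M lebesgue) (\<lambda>z. indicator ?S z *\<^sub>R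
      (case z of (r, s) \<Rightarrow> frac_kernel (- \<alpha>) (r - s) * L2_norm \<Omega> (f s) * L2_norm \<Omega> (f r)))"
    using source by (simp add: regular_source_def set_integrable_def)
  note [measurable] = measurable_fst_compose[OF source_norm_measurable] measurable_snd_compose[OF source_norm_measurable]
  show "(\<lambda>z. causal_kernel \<mu> (fst z - snd z) * (source_norm (fst z) * source_norm (snd z)))
      \<in> borel_measurable (lebesgue \<Otimes>\<^sub>M lebesgue)" by measurable
  have "AE x in (lebesgue :: real measure). x \<noteq> 0 \<and> x \<noteq> T"
    using AE_completion[OF AE_lborel_singleton[of 0]] AE_completion[OF AE_lborel_singleton[of T]]
    by eventually_elim simp
  from AE_lebesgue_pair_both[OF this]
  show "AE z in lebesgue \<Otimes>\<^sub>M lebesgue.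
      norm (causal_kernel \<mu> (fst z - snd z) * (source_norm (fst z) * source_norm (snd z)))
      \<le> norm (indicator ?S z *\<^sub>R (case z of (r, s) \<Rightarrow> frac_kernel (- \<alpha>) (r - s) * L2_norm \<Omega> (f s) * L2_norm \<Omega> (f r)))"
  proof eventually_elim
    case (elim z)
    obtain r s where z: "z = (r, s)" by (cases z)
    show ?case
    proof (cases "0 \<le> s \<and> s < r \<and> r \<le> \<tau>")
      case True
      then show ?thesis using elim tau
        by (auto simp: z source_norm_def frac_kernel_eq_causal_kernel abs_mult indicator_def mult.commute)
    next
      case False
      then have "causal_kernel \<mu> (r - s) * (source_norm r * source_norm s) = 0"
        by (auto simp: source_norm_def indicator_def causal_kernel_nonpos_arg)
      then show ?thesis by (simp only: z fst_conv snd_conv norm_zero norm_ge_zero)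
    qed
  qed
qed

lemma AE_source_pair: "AE z in lebesgue \<Otimes>\<^sub>M lebesgue.
    (fst z \<in> {0..\<tau>} \<longrightarrow> f (fst z) \<in> L2_space \<Omega>) \<and> (snd z \<in> {0..\<tau>} \<longrightarrow> f (snd z) \<in> L2_space \<Omega>)"
  by (rule AE_lebesgue_pair_both[OF AE_source_L2])

lemma source_coeff_admissible:
  assumes w: "w \<in> L2_space \<Omega>"
  shows "frac_admissible \<mu> (source_coeff w)"
proof -
  note m = source_coeff_measurable[OF w]
  note [measurable] = measurable_fst_compose[OF m] measurable_snd_compose[OF m]
  have "integrable (lebesgue \<Otimes>\<^sub>M lebesgue)
      (\<lambda>(r, s). causal_kernel \<mu> (r - s) * \<bar>source_coeff w r\<bar> * \<bar>source_coeff w s\<bar>)"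
  proof (rule Bochner_Integration.integrable_bound)
    show "integrable (lebesgue \<Otimes>\<^sub>M lebesgue) (\<lambda>z. (L2_norm \<Omega> w)\<^sup>2
        * (causal_kernel \<mu> (fst z - snd z) * (source_norm (fst z) * source_norm (snd z))))"
      by (rule integrable_mult_right[OF source_kernel_integrable])
    show "(\<lambda>(r, s). causal_kernel \<mu> (r - s) * \<bar>source_coeff w r\<bar> * \<bar>source_coeff w s\<bar>)
        \<in> borel_measurable (lebesgue \<Otimes>\<^sub>M lebesgue)"
      unfolding case_prod_unfold by measurable
    show "AE z in lebesgue \<Otimes>\<^sub>M lebesgue.
        norm (case z of (r, s) \<Rightarrow> causal_kernel \<mu> (r - s) * \<bar>source_coeff w r\<bar> * \<bar>source_coeff w s\<bar>)
        \<le> norm ((L2_norm \<Omega> w)\<^sup>2 * (causal_kernel \<mu> (fst z - snd z) * (source_norm (fst z) * source_norm (snd z))))"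
      using AE_source_pair
    proof eventually_elim
      case (elim z)
      have "\<bar>source_coeff w (fst z)\<bar> * \<bar>source_coeff w (snd z)\<bar>
          \<le> (source_norm (fst z) * L2_norm \<Omega> w) * (source_norm (snd z) * L2_norm \<Omega> w)"
        using elim source_norm_nonneg L2_norm_nonneg
        by (intro mult_mono source_coeff_bound w mult_nonneg_nonneg) auto
      from mult_left_mono[OF this ck_nonneg[of "fst z - snd z"]]
      show ?case using ck_nonneg source_norm_nonneg L2_norm_nonneg
        by (simp add: case_prod_unfold abs_mult power2_eq_square algebra_simps)
    qed
  qed
  with m show ?thesis by (simp add: frac_admissible_def)
qed

text \<open>Partial sums in \<open>m\<close> of the eigenfunction series of \<open>\<langle>f(s), A\<^sup>-\<^sup>1 f(r)\<rangle>\<close> at \<open>z = (r, s)\<close>.\<close>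

definition resolvent_sum :: "nat \<Rightarrow> real \<times> real \<Rightarrow> real" where
  "resolvent_sum M z = (\<Sum>m=1..M. source_coeff (\<phi> m) (fst z) * source_coeff (\<phi> m) (snd z) / lam m)"

text \<open>The limit is taken by \<open>lim\<close> instead of writing \<open>\<langle>f(s), A\<^sup>-\<^sup>1 f(r)\<rangle>\<close> directly: this makes it jointly measurable, while
  \<open>A\<^sup>-\<^sup>1 f(r)\<close> involves a choice for every \<open>r\<close>.\<close>

definition resolvent_form :: "real \<times> real \<Rightarrow> real" where
  "resolvent_form z = lim (\<lambda>M. resolvent_sum M z)"

lemma resolvent_sum_measurable[measurable]: "resolvent_sum M \<in> borel_measurable (lebesgue \<Otimes>\<^sub>M lebesgue)"
proof -
  have "(\<lambda>z. source_coeff (\<phi> m) (fst z) * source_coeff (\<phi> m) (snd z) / lam m) \<in> borel_measurable (lebesgue \<Otimes>\<^sub>M lebesgue)"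
    if "m \<in> {1..M}" for m
  proof -
    have m: "source_coeff (\<phi> m) \<in> borel_measurable lebesgue"
      using that by (intro source_coeff_measurable phi_L2) auto
    note [measurable] = measurable_fst_compose[OF m] measurable_snd_compose[OF m]
    show ?thesis by measurable
  qed
  then show ?thesis unfolding resolvent_sum_def[abs_def] by (rule borel_measurable_sum)
qed

lemma resolvent_form_measurable[measurable]: "resolvent_form \<in> borel_measurable (lebesgue \<Otimes>\<^sub>M lebesgue)"
  unfolding resolvent_form_def[abs_def] by measurable

lemma resolvent_limit:
  assumes r: "r \<in> {0..\<tau>} \<longrightarrow> f r \<in> L2_space \<Omega>" and s: "s \<in> {0..\<tau>} \<longrightarrow> f s \<in> L2_space \<Omega>"
  shows "(\<lambda>M. resolvent_sum M (r, s)) \<longlonglongrightarrow> indicator {0..\<tau>} r * source_coeff (dirichlet_inverse K \<Omega> (f r)) s"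
    and "\<bar>resolvent_sum M (r, s)\<bar> \<le> source_norm r * source_norm s / lam 1"
proof -
  let ?u = "dirichlet_inverse K \<Omega> (f r)"
  show "(\<lambda>M. resolvent_sum M (r, s)) \<longlonglongrightarrow> indicator {0..\<tau>} r * source_coeff ?u s"
  proof (cases "r \<in> {0..\<tau>} \<and> s \<in> {0..\<tau>}")
    case False
    then show ?thesis by (auto simp: resolvent_sum_def source_coeff_def)
  next
    case True
    then have fr: "f r \<in> L2_space \<Omega>" and fs: "f s \<in> L2_space \<Omega>" using r s by auto
    have eq: "resolvent_sum M (r, s) = (\<Sum>m=1..M. L2_inner \<Omega> (f s) (\<phi> m) * L2_inner \<Omega> ?u (\<phi> m))" for M
      unfolding resolvent_sum_def using True
      by (intro sum.cong refl) (auto simp: source_coeff_def dirichlet_inverse_coefficient[OF fr])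
    show ?thesis
      using Parseval[OF fs H10_L2[OF dirichlet_inverse_H10[OF fr]]] True
      by (simp add: eq source_coeff_def)
  qed
  show "\<bar>resolvent_sum M (r, s)\<bar> \<le> source_norm r * source_norm s / lam 1"
  proof (cases "r \<in> {0..\<tau>} \<and> s \<in> {0..\<tau>}")
    case False
    then have "resolvent_sum M (r, s) = 0" by (auto simp: resolvent_sum_def source_coeff_def)
    then show ?thesis using source_norm_nonneg lam_1_pos by simp
  next
    case True
    then have fr: "f r \<in> L2_space \<Omega>" and fs: "f s \<in> L2_space \<Omega>" using r s by auto
    have "\<bar>resolvent_sum M (r, s)\<bar> \<le> (\<Sum>m=1..M. \<bar>L2_inner \<Omega> (f r) (\<phi> m) * L2_inner \<Omega> (f s) (\<phi> m)\<bar> / lam 1)"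
      unfolding resolvent_sum_def
    proof (rule order_trans[OF sum_abs], rule sum_mono)
      fix m assume m: "m \<in> {1..M}"
      then have "\<bar>L2_inner \<Omega> (f r) (\<phi> m) * L2_inner \<Omega> (f s) (\<phi> m)\<bar> / lam m
          \<le> \<bar>L2_inner \<Omega> (f r) (\<phi> m) * L2_inner \<Omega> (f s) (\<phi> m)\<bar> / lam 1"
        using lam_1_pos lam_ge[of m] lam_pos[of m] by (intro divide_left_mono) auto
      then show "\<bar>source_coeff (\<phi> m) (fst (r, s)) * source_coeff (\<phi> m) (snd (r, s)) / lam m\<bar>
          \<le> \<bar>L2_inner \<Omega> (f r) (\<phi> m) * L2_inner \<Omega> (f s) (\<phi> m)\<bar> / lam 1"
        using True m lam_pos[of m] by (simp add: source_coeff_def abs_mult)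
    qed
    also have "\<dots> = (\<Sum>m=1..M. \<bar>L2_inner \<Omega> (f r) (\<phi> m) * L2_inner \<Omega> (f s) (\<phi> m)\<bar>) / lam 1"
      by (rule sum_divide_distrib[symmetric])
    also have "\<dots> \<le> L2_norm \<Omega> (f r) * L2_norm \<Omega> (f s) / lam 1"
      using lam_1_pos by (intro divide_right_mono coefficient_sum_bound fr fs) auto
    finally show ?thesis using True by (simp add: source_norm_def)
  qed
qed

lemma resolvent_form_eq:
  assumes "r \<in> {0..\<tau>} \<longrightarrow> f r \<in> L2_space \<Omega>" "s \<in> {0..\<tau>} \<longrightarrow> f s \<in> L2_space \<Omega>"
  shows "resolvent_form (r, s) = indicator {0..\<tau>} r * source_coeff (dirichlet_inverse K \<Omega> (f r)) s"
  unfolding resolvent_form_def by (rule limI[OF resolvent_limit(1)[OF assms]])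

text \<open>The majorant is the weakly singular kernel \<open>\<omega>\<^sub>\<mu>(r - s) \<parallel>f(r)\<parallel> \<parallel>f(s)\<parallel> / \<lambda>\<^sub>1\<close>, whose integrability is the
  regularity assumption on the source.\<close>

lemma resolvent_dominated:
  shows "(\<lambda>M. \<integral>z. causal_kernel \<mu> (fst z - snd z) * resolvent_sum M z \<partial>(lebesgue \<Otimes>\<^sub>M lebesgue))
      \<longlonglongrightarrow> (\<integral>z. causal_kernel \<mu> (fst z - snd z) * resolvent_form z \<partial>(lebesgue \<Otimes>\<^sub>M lebesgue))" (is "?lim")
    and "integrable (lebesgue \<Otimes>\<^sub>M lebesgue) (\<lambda>z. causal_kernel \<mu> (fst z - snd z) * resolvent_form z)" (is "?int")
proof -
  let ?w = "\<lambda>z. (causal_kernel \<mu> (fst z - snd z) * (source_norm (fst z) * source_norm (snd z))) / lam 1"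
  have m1: "(\<lambda>z. causal_kernel \<mu> (fst z - snd z) * resolvent_form z) \<in> borel_measurable (lebesgue \<Otimes>\<^sub>M lebesgue)"
    by measurable
  have m2: "(\<lambda>z. causal_kernel \<mu> (fst z - snd z) * resolvent_sum M z) \<in> borel_measurable (lebesgue \<Otimes>\<^sub>M lebesgue)" for M
    by measurable
  have w: "integrable (lebesgue \<Otimes>\<^sub>M lebesgue) ?w"
    using source_kernel_integrable by (rule integrable_divide)
  have l: "AE z in lebesgue \<Otimes>\<^sub>M lebesgue. (\<lambda>M. causal_kernel \<mu> (fst z - snd z) * resolvent_sum M z)
      \<longlonglongrightarrow> causal_kernel \<mu> (fst z - snd z) * resolvent_form z"
    using AE_source_pair
  proof eventually_elim
    case (elim z)
    then have "(\<lambda>M. resolvent_sum M z) \<longlonglongrightarrow> resolvent_form z"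
      using resolvent_limit(1)[of "fst z" "snd z"] resolvent_form_eq[of "fst z" "snd z"] by simp
    then show ?case by (rule tendsto_mult_left)
  qed
  have b: "AE z in lebesgue \<Otimes>\<^sub>M lebesgue. norm (causal_kernel \<mu> (fst z - snd z) * resolvent_sum M z) \<le> ?w z" for M
    using AE_source_pair
  proof eventually_elim
    case (elim z)
    then have "\<bar>resolvent_sum M z\<bar> \<le> source_norm (fst z) * source_norm (snd z) / lam 1"
      using resolvent_limit(2)[of "fst z" "snd z" M] by simp
    from mult_left_mono[OF this ck_nonneg[of "fst z - snd z"]]
    show ?case using ck_nonneg by (simp add: abs_mult)
  qed
  show ?lim by (rule integral_dominated_convergence[OF m1 m2 w l b])
  show ?int by (rule integrable_dominated_convergence[OF m1 m2 w l b])
qed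

lemma resolvent_sum_form:
  "(\<integral>z. causal_kernel \<mu> (fst z - snd z) * resolvent_sum M z \<partial>(lebesgue \<Otimes>\<^sub>M lebesgue))
    = (\<Sum>m=1..M. frac_form \<mu> (source_coeff (\<phi> m)) (source_coeff (\<phi> m)) / lam m)"
proof -
  have int: "integrable (lebesgue \<Otimes>\<^sub>M lebesgue) (\<lambda>z. causal_kernel \<mu> (fst z - snd z)
      * source_coeff (\<phi> m) (fst z) * source_coeff (\<phi> m) (snd z))" if "m \<in> {1..M}" for m
  proof -
    have "frac_admissible \<mu> (source_coeff (\<phi> m))" using that by (intro source_coeff_admissible phi_L2) auto
    from frac_form_sector(1)[OF _ _ this this] show ?thesis
      using alpha by (simp add: case_prod_unfold)
  qed
  have "(\<integral>z. causal_kernel \<mu> (fst z - snd z) * resolvent_sum M z \<partial>(lebesgue \<Otimes>\<^sub>M lebesgue))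
      = (\<integral>z. (\<Sum>m=1..M. (causal_kernel \<mu> (fst z - snd z) * source_coeff (\<phi> m) (fst z) * source_coeff (\<phi> m) (snd z)) / lam m)
          \<partial>(lebesgue \<Otimes>\<^sub>M lebesgue))"
    by (simp add: resolvent_sum_def sum_distrib_left algebra_simps)
  also have "\<dots> = (\<Sum>m=1..M. \<integral>z. (causal_kernel \<mu> (fst z - snd z) * source_coeff (\<phi> m) (fst z) * source_coeff (\<phi> m) (snd z)) / lam m
          \<partial>(lebesgue \<Otimes>\<^sub>M lebesgue))"
    by (rule Bochner_Integration.integral_sum) (intro integrable_divide int)
  finally show ?thesis by (simp add: frac_form_def case_prod_unfold)
qed

text \<open>The fractional integral of \<open>f\<close> is taken pointwise in space, so pulling it out of the spatial inner product is
  a genuine use of Fubini's theorem. The assumption \<open>int\<close> holds for almost every \<open>r\<close> and, together with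
  \<open>\<parallel>A\<^sup>-\<^sup>1 f(r)\<parallel> \<le> \<parallel>f(r)\<parallel> / \<lambda>\<^sub>1\<close>, provides absolute convergence.\<close>

lemma frac_integral_source_inner:
  assumes r: "r \<in> {0..\<tau>}" and fr: "f r \<in> L2_space \<Omega>"
    and int: "integrable lebesgue (\<lambda>s. causal_kernel \<mu> (r - s) * (source_norm r * source_norm s))"
  shows "L2_inner \<Omega> (frac_integral \<mu> f r) (dirichlet_inverse K \<Omega> (f r))
    = (\<integral>s. causal_kernel \<mu> (r - s) * source_coeff (dirichlet_inverse K \<Omega> (f r)) s \<partial>lebesgue)"
proof -
  let ?u = "dirichlet_inverse K \<Omega> (f r)" and ?S = "lebesgue_on {0..T}" and ?X = "lebesgue_on \<Omega>"
  have u: "?u \<in> L2_space \<Omega>" by (rule H10_L2[OF dirichlet_inverse_H10[OF fr]])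
  have rT: "{0..r} \<subseteq> {0..T}" using r tau by auto
  interpret S: sigma_finite_measure ?S
    by (intro sigma_finite_measure_restrict_space sigma_finite_lebesgue) simp
  interpret SX: pair_sigma_finite ?S ?X ..
  define \<kappa> where "\<kappa> s = indicator {0..r} s * frac_kernel \<mu> (r - s)" for s
  have k: "\<kappa> s = indicator {0..\<tau>} s * causal_kernel \<mu> (r - s)" for s
    using r by (auto simp: \<kappa>_def indicator_def frac_kernel_eq_causal_kernel causal_kernel_nonpos_arg)
  have k_nn: "0 \<le> \<kappa> s" for s unfolding k using ck_nonneg by simp
  have km: "\<kappa> \<in> borel_measurable borel" unfolding k[abs_def] by measurable
  have km'[measurable]: "\<kappa> \<in> borel_measurable ?S"
    by (intro measurable_restrict_space1 borel_imp_lebesgue_measurable km)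
  note [measurable] = source_measurable L2_spaceD_measurable[OF u]
  have AE_S: "AE s in ?S. s \<in> {0..\<tau>} \<longrightarrow> f s \<in> L2_space \<Omega>"
    by (subst AE_restrict_space_iff) (use AE_source_L2 in auto)
  let ?h = "\<lambda>(s, x). \<kappa> s * f s x * ?u x"
  have hm: "?h \<in> borel_measurable (?S \<Otimes>\<^sub>M ?X)" by measurable
  have int_h: "integrable (?S \<Otimes>\<^sub>M ?X) ?h"
  proof (rule SX.Fubini_integrable[OF hm])
    have good: "integrable ?X (\<lambda>x. ?h (s, x)) \<and> (\<integral>x. norm (?h (s, x)) \<partial>?X) \<le> \<kappa> s * (source_norm s * L2_norm \<Omega> ?u)"
      if s: "s \<in> {0..\<tau>} \<longrightarrow> f s \<in> L2_space \<Omega>" for s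
    proof (cases "s \<in> {0..\<tau>}")
      case False
      then show ?thesis by (simp add: k)
    next
      case True
      then have fs: "f s \<in> L2_space \<Omega>" using s by simp
      have i: "integrable ?X (\<lambda>x. ?h (s, x))"
        using integrable_mult_right[OF L2_inner_integrable[OF fs u], of "\<kappa> s"] by (simp add: mult.assoc)
      have "(\<integral>x. norm (?h (s, x)) \<partial>?X) = \<kappa> s * L2_inner \<Omega> (\<lambda>x. \<bar>f s x\<bar>) (\<lambda>x. \<bar>?u x\<bar>)"
        using k_nn[of s] by (simp add: L2_inner_def abs_mult mult.assoc)
      also have "\<dots> \<le> \<kappa> s * (L2_norm \<Omega> (f s) * L2_norm \<Omega> ?u)"
        using L2_Cauchy_Schwarz[OF L2_space_abs[OF fs] L2_space_abs[OF u]]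
        by (intro mult_left_mono k_nn) (simp add: L2_norm_abs)
      finally show ?thesis using i True by (simp add: source_norm_def)
    qed
    show "AE s in ?S. integrable ?X (\<lambda>x. ?h (s, x))"
      using AE_S by eventually_elim (use good in blast)
    have "integrable lebesgue (\<lambda>s. (causal_kernel \<mu> (r - s) * (source_norm r * source_norm s)) / lam 1)"
      using int by (rule integrable_divide)
    then have "integrable ?S (\<lambda>s. (causal_kernel \<mu> (r - s) * (source_norm r * source_norm s)) / lam 1)"
      by (subst integrable_restrict_space) (simp, rule integrable_mult_indicator, simp)
    then show "integrable ?S (\<lambda>s. \<integral>x. norm (?h (s, x)) \<partial>?X)"
    proof (rule Bochner_Integration.integrable_bound)
      show "(\<lambda>s. \<integral>x. norm (?h (s, x)) \<partial>?X) \<in> borel_measurable ?S"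
        by (rule space.borel_measurable_lebesgue_integral) measurable
      show "AE s in ?S. norm (\<integral>x. norm (?h (s, x)) \<partial>?X)
          \<le> norm ((causal_kernel \<mu> (r - s) * (source_norm r * source_norm s)) / lam 1)"
        using AE_S
      proof eventually_elim
        case (elim s)
        have "(\<integral>x. norm (?h (s, x)) \<partial>?X) \<le> \<kappa> s * (source_norm s * L2_norm \<Omega> ?u)"
          using good[OF elim] by blast
        also have "\<dots> \<le> causal_kernel \<mu> (r - s) * (source_norm s * (source_norm r / lam 1))"
        proof (intro mult_mono mult_left_mono)
          show "\<kappa> s \<le> causal_kernel \<mu> (r - s)" unfolding k using ck_nonneg by (auto simp: indicator_def)
          show "L2_norm \<Omega> ?u \<le> source_norm r / lam 1"
            using dirichlet_inverse_norm[OF fr] r by (simp add: source_norm_def)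
        qed (auto intro!: ck_nonneg source_norm_nonneg mult_nonneg_nonneg L2_norm_nonneg)
        finally have "(\<integral>x. norm (?h (s, x)) \<partial>?X) \<le> (causal_kernel \<mu> (r - s) * (source_norm r * source_norm s)) / lam 1"
          by (simp add: algebra_simps)
        moreover have "0 \<le> (\<integral>x. norm (?h (s, x)) \<partial>?X)" by (rule Bochner_Integration.integral_nonneg) simp
        ultimately show ?case unfolding real_norm_def by linarith
      qed
    qed
  qed
  have "L2_inner \<Omega> (frac_integral \<mu> f r) ?u = (\<integral>x. (\<integral>s. \<kappa> s * f s x * ?u x \<partial>?S) \<partial>?X)"
    unfolding L2_inner_def
  proof (rule Bochner_Integration.integral_cong[OF refl])
    fix x
    have "frac_integral \<mu> f r x = (\<integral>s. indicator {0..T} s *\<^sub>R (\<kappa> s * f s x) \<partial>lebesgue)"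
      unfolding frac_integral_def set_lebesgue_integral_def \<kappa>_def
      by (rule Bochner_Integration.integral_cong) (use rT in \<open>auto simp: indicator_def\<close>)
    also have "\<dots> = (\<integral>s. \<kappa> s * f s x \<partial>?S)"
      by (rule integral_restrict_space[symmetric]) simp
    finally show "frac_integral \<mu> f r x \<bullet> ?u x = (\<integral>s. \<kappa> s * f s x * ?u x \<partial>?S)" by simp
  qed
  also have "\<dots> = (\<integral>s. (\<integral>x. \<kappa> s * f s x * ?u x \<partial>?X) \<partial>?S)"
    by (rule SX.Fubini_integral) (use int_h in simp)
  also have "\<dots> = (\<integral>s. \<kappa> s * L2_inner \<Omega> (f s) ?u \<partial>?S)"
    by (simp add: L2_inner_def mult.assoc)
  also have "\<dots> = (\<integral>s. indicator {0..T} s *\<^sub>R (\<kappa> s * L2_inner \<Omega> (f s) ?u) \<partial>lebesgue)"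
    by (rule integral_restrict_space) simp
  also have "\<dots> = (\<integral>s. causal_kernel \<mu> (r - s) * source_coeff ?u s \<partial>lebesgue)"
    using tau by (intro Bochner_Integration.integral_cong) (auto simp: k source_coeff_def indicator_def)
  finally show ?thesis .
qed

text \<open>Integrating first over \<open>s\<close> identifies the limit of the modal source energies with \<open>\<integral> \<langle>g, A\<^sup>-\<^sup>1 f\<rangle>\<close>.\<close>

lemma resolvent_form_bound:
  shows "set_integrable lebesgue {0..\<tau>} (\<lambda>r. \<bar>L2_inner \<Omega> (frac_integral \<mu> f r) (dirichlet_inverse K \<Omega> (f r))\<bar>)"
    and "\<bar>\<integral>z. causal_kernel \<mu> (fst z - snd z) * resolvent_form z \<partial>(lebesgue \<Otimes>\<^sub>M lebesgue)\<bar>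
    \<le> (LINT r:{0..\<tau>}|lebesgue. \<bar>L2_inner \<Omega> (frac_integral \<mu> f r) (dirichlet_inverse K \<Omega> (f r))\<bar>)"
proof -
  let ?J = "\<lambda>r. \<integral>s. causal_kernel \<mu> (r - s) * resolvent_form (r, s) \<partial>lebesgue"
  have int: "integrable (lebesgue \<Otimes>\<^sub>M lebesgue) (\<lambda>(r, s). causal_kernel \<mu> (r - s) * resolvent_form (r, s))"
    using resolvent_dominated(2) by (simp add: case_prod_unfold)
  have J: "integrable lebesgue ?J" by (rule leb2.integrable_fst[OF int])
  have "integrable (lebesgue \<Otimes>\<^sub>M lebesgue) (\<lambda>(r, s). causal_kernel \<mu> (r - s) * (source_norm r * source_norm s))"
    using source_kernel_integrable by (simp add: case_prod_unfold)
  from leb2.AE_integrable_fst[OF this] AE_source_L2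
  have eq: "AE r in lebesgue. \<bar>?J r\<bar> = indicator {0..\<tau>} r *\<^sub>R \<bar>L2_inner \<Omega> (frac_integral \<mu> f r) (dirichlet_inverse K \<Omega> (f r))\<bar>"
  proof eventually_elim
    case (elim r)
    have m1: "source_coeff (dirichlet_inverse K \<Omega> (f r)) \<in> borel_measurable lebesgue" if "r \<in> {0..\<tau>}"
      using elim(2) that by (intro source_coeff_measurable H10_L2[OF dirichlet_inverse_H10]) simp
    have ckm: "(\<lambda>s. causal_kernel \<mu> (r - s)) \<in> borel_measurable lebesgue"
      by (rule borel_imp_lebesgue_measurable) measurable
    have "?J r = (\<integral>s. causal_kernel \<mu> (r - s) * (indicator {0..\<tau>} r * source_coeff (dirichlet_inverse K \<Omega> (f r)) s) \<partial>lebesgue)"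
    proof (rule integral_cong_AE)
      have "(\<lambda>s. resolvent_form (r, s)) \<in> borel_measurable lebesgue"
        by (rule measurable_compose[OF _ resolvent_form_measurable]) simp
      then show "(\<lambda>s. causal_kernel \<mu> (r - s) * resolvent_form (r, s)) \<in> borel_measurable lebesgue"
        using ckm by simp
      show "(\<lambda>s. causal_kernel \<mu> (r - s) * (indicator {0..\<tau>} r * source_coeff (dirichlet_inverse K \<Omega> (f r)) s)) \<in> borel_measurable lebesgue"
        using m1 ckm by (cases "r \<in> {0..\<tau>}") auto
      show "AE s in lebesgue. causal_kernel \<mu> (r - s) * resolvent_form (r, s)
          = causal_kernel \<mu> (r - s) * (indicator {0..\<tau>} r * source_coeff (dirichlet_inverse K \<Omega> (f r)) s)"
        using AE_source_L2 by eventually_elim (simp add: resolvent_form_eq elim(2))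
    qed
    also have "\<dots> = indicator {0..\<tau>} r * L2_inner \<Omega> (frac_integral \<mu> f r) (dirichlet_inverse K \<Omega> (f r))"
      using elim frac_integral_source_inner[of r] by (cases "r \<in> {0..\<tau>}") auto
    finally show ?case by (simp add: abs_mult)
  qed
  have mJ: "(\<lambda>r. \<bar>?J r\<bar>) \<in> borel_measurable lebesgue" using J by auto
  note mg = borel_measurable_AE[OF mJ eq]
  show "set_integrable lebesgue {0..\<tau>} (\<lambda>r. \<bar>L2_inner \<Omega> (frac_integral \<mu> f r) (dirichlet_inverse K \<Omega> (f r))\<bar>)"
    unfolding set_integrable_def by (rule integrable_cong_AE_imp[OF integrable_abs[OF J] mg]) (use eq in eventually_elim, simp)
  have "\<bar>\<integral>z. causal_kernel \<mu> (fst z - snd z) * resolvent_form z \<partial>(lebesgue \<Otimes>\<^sub>M lebesgue)\<bar> = \<bar>\<integral>r. ?J r \<partial>lebesgue\<bar>"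
    using leb2.integral_fst[OF int] by (simp add: case_prod_unfold)
  also have "\<dots> \<le> (\<integral>r. \<bar>?J r\<bar> \<partial>lebesgue)" by (rule integral_abs_bound)
  also have "\<dots> = (\<integral>r. indicator {0..\<tau>} r *\<^sub>R \<bar>L2_inner \<Omega> (frac_integral \<mu> f r) (dirichlet_inverse K \<Omega> (f r))\<bar> \<partial>lebesgue)"
    by (rule integral_cong_AE[OF mJ mg eq])
  finally show "\<bar>\<integral>z. causal_kernel \<mu> (fst z - snd z) * resolvent_form z \<partial>(lebesgue \<Otimes>\<^sub>M lebesgue)\<bar>
    \<le> (LINT r:{0..\<tau>}|lebesgue. \<bar>L2_inner \<Omega> (frac_integral \<mu> f r) (dirichlet_inverse K \<Omega> (f r))\<bar>)"
    by (simp add: set_lebesgue_integral_def)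
qed

end

section \<open>Work of the source and memory energy\<close>

locale dg_data = source_problem K \<Omega> \<phi> lam \<alpha> T \<tau> f + truncated_powers "- \<alpha>" I a k
  for K :: real and \<Omega> :: "'a::euclidean_space set" and \<phi> lam \<alpha> T \<tau> f
    and I :: "'i set" and a :: "'i \<Rightarrow> real" and k :: "'i \<Rightarrow> nat" +
  fixes c :: "'i \<Rightarrow> 'a \<Rightarrow> real"
  assumes c_H10: "\<And>i. i \<in> I \<Longrightarrow> c i \<in> H10_space \<Omega>"
begin

text \<open>Separated form of a time-dependent function: truncated powers in time, fixed functions in space. The
  discontinuous Galerkin solution has this form up to its values at the nodes.\<close>

definition state :: "real \<Rightarrow> 'a \<Rightarrow> real" where
  "state s x = (\<Sum>i\<in>I. trunc_power (a i) (k i) s * c i x)"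

definition state_RL :: "real \<Rightarrow> 'a \<Rightarrow> real" where
  "state_RL s x = (\<Sum>i\<in>I. trunc_power_RL (- \<alpha>) (a i) (k i) s * c i x)"

definition time_gram :: "'i \<Rightarrow> 'i \<Rightarrow> real" where
  "time_gram i j = (LINT s:{0..\<tau>}|lebesgue. trunc_power_RL (- \<alpha>) (a i) (k i) s * trunc_power (a j) (k j) s)"

lemma c_L2: "i \<in> I \<Longrightarrow> c i \<in> L2_space \<Omega>"
  by (rule H10_L2[OF c_H10])

lemma state_energy:
  "energy K \<Omega> (state_RL s) (state s) = (\<Sum>i\<in>I. \<Sum>j\<in>I. energy K \<Omega> (c i) (c j)
    * (trunc_power_RL (- \<alpha>) (a i) (k i) s * trunc_power (a j) (k j) s))"
  unfolding state_def[abs_def] state_RL_def[abs_def]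
  by (subst energy_sum[OF fin c_H10 fin c_H10]) (auto simp: algebra_simps)

lemma state_energy_set_integrable: "set_integrable lebesgue {0..\<tau>'} (\<lambda>s. energy K \<Omega> (state_RL s) (state s))"
  unfolding state_energy using fin a_nonneg mu
  by (intro set_integrable_sum set_integrable_mult_right trunc_power_product_set_integrable) auto

lemma state_energy_integral:
  "(LINT s:{0..\<tau>}|lebesgue. energy K \<Omega> (state_RL s) (state s))
    = (\<Sum>i\<in>I. \<Sum>j\<in>I. energy K \<Omega> (c i) (c j) * time_gram i j)"
proof -
  note int = trunc_power_product_set_integrable[OF mu(2) a_nonneg]
  have "(LINT s:{0..\<tau>}|lebesgue. energy K \<Omega> (state_RL s) (state s)) = (\<Sum>i\<in>I. LINT s:{0..\<tau>}|lebesgue.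
      \<Sum>j\<in>I. energy K \<Omega> (c i) (c j) * (trunc_power_RL (- \<alpha>) (a i) (k i) s * trunc_power (a j) (k j) s))"
    unfolding state_energy using int fin
    by (intro set_integral_sum set_integrable_sum set_integrable_mult_right) auto
  also have "\<dots> = (\<Sum>i\<in>I. \<Sum>j\<in>I. LINT s:{0..\<tau>}|lebesgue.
      energy K \<Omega> (c i) (c j) * (trunc_power_RL (- \<alpha>) (a i) (k i) s * trunc_power (a j) (k j) s))"
    using int fin by (intro sum.cong refl set_integral_sum set_integrable_mult_right) auto
  finally show ?thesis by (simp add: time_gram_def)
qed

lemma time_gram_nonneg: "0 \<le> (\<Sum>i\<in>I. \<Sum>j\<in>I. y i * y j * time_gram i j)"
  using spline_energy_nonneg[of \<tau> y] unfolding spline_product_integral time_gram_def .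

text \<open>Positivity of the memory energy passes from scalars to \<open>L\<^sub>2\<close> coefficients by applying it to every component at
  every point of the domain and integrating.\<close>

lemma time_gram_inner_nonneg:
  fixes G :: "'i \<Rightarrow> 'a \<Rightarrow> 'b::euclidean_space"
  assumes G: "\<And>i. i \<in> I \<Longrightarrow> G i \<in> L2_space \<Omega>"
  shows "0 \<le> (\<Sum>i\<in>I. \<Sum>j\<in>I. L2_inner \<Omega> (G i) (G j) * time_gram i j)"
proof -
  have "(\<Sum>i\<in>I. \<Sum>j\<in>I. L2_inner \<Omega> (G i) (G j) * time_gram i j)
      = (\<integral>x. (\<Sum>i\<in>I. \<Sum>j\<in>I. (G i x \<bullet> G j x) * time_gram i j) \<partial>lebesgue_on \<Omega>)"
  proof -
    have int: "integrable (lebesgue_on \<Omega>) (\<lambda>x. (G i x \<bullet> G j x) * time_gram i j)" if "i \<in> I" "j \<in> I" for i j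
      by (rule integrable_mult_left[OF L2_inner_integrable[OF G[OF that(1)] G[OF that(2)]]])
    have "(\<integral>x. (\<Sum>i\<in>I. \<Sum>j\<in>I. (G i x \<bullet> G j x) * time_gram i j) \<partial>lebesgue_on \<Omega>)
        = (\<Sum>i\<in>I. \<integral>x. (\<Sum>j\<in>I. (G i x \<bullet> G j x) * time_gram i j) \<partial>lebesgue_on \<Omega>)"
      by (rule Bochner_Integration.integral_sum) (intro Bochner_Integration.integrable_sum int)
    also have "\<dots> = (\<Sum>i\<in>I. \<Sum>j\<in>I. \<integral>x. (G i x \<bullet> G j x) * time_gram i j \<partial>lebesgue_on \<Omega>)"
      by (intro sum.cong refl Bochner_Integration.integral_sum int)
    finally show ?thesis by (simp add: L2_inner_def)
  qed
  also have "\<dots> \<ge> 0"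
  proof (rule Bochner_Integration.integral_nonneg)
    fix x
    have "(\<Sum>i\<in>I. \<Sum>j\<in>I. (G i x \<bullet> G j x) * time_gram i j)
        = (\<Sum>i\<in>I. \<Sum>j\<in>I. \<Sum>b\<in>Basis. (G i x \<bullet> b) * (G j x \<bullet> b) * time_gram i j)"
    proof (intro sum.cong refl)
      fix i j
      show "(G i x \<bullet> G j x) * time_gram i j = (\<Sum>b\<in>Basis. (G i x \<bullet> b) * (G j x \<bullet> b) * time_gram i j)"
        by (subst euclidean_inner) (rule sum_distrib_right)
    qed
    also have "\<dots> = (\<Sum>i\<in>I. \<Sum>b\<in>Basis. \<Sum>j\<in>I. (G i x \<bullet> b) * (G j x \<bullet> b) * time_gram i j)"
      by (intro sum.cong refl sum.swap)
    also have "\<dots> = (\<Sum>b\<in>Basis. \<Sum>i\<in>I. \<Sum>j\<in>I. (G i x \<bullet> b) * (G j x \<bullet> b) * time_gram i j)"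
      by (rule sum.swap)
    also have "\<dots> \<ge> 0" by (intro sum_nonneg time_gram_nonneg)
    finally show "0 \<le> (\<Sum>i\<in>I. \<Sum>j\<in>I. (G i x \<bullet> G j x) * time_gram i j)" .
  qed
  finally show ?thesis .
qed

abbreviation mode :: "nat \<Rightarrow> 'i \<Rightarrow> real" where
  "mode m i \<equiv> L2_inner \<Omega> (c i) (\<phi> m)"

abbreviation mode_energy :: "nat \<Rightarrow> real" where
  "mode_energy m \<equiv> (LINT s:{0..\<tau>}|lebesgue. spline_RL (mode m) s * spline (mode m) s)"

abbreviation state_energy_total :: real where
  "state_energy_total \<equiv> (LINT s:{0..\<tau>}|lebesgue. energy K \<Omega> (state_RL s) (state s))"

text \<open>The difference of the two sides is the memory energy of the gradient remainders, which is nonnegative.\<close>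

lemma mode_energy_sum_le: "(\<Sum>m=1..M. lam m * mode_energy m) \<le> state_energy_total"
proof -
  have "0 \<le> K * (\<Sum>i\<in>I. \<Sum>j\<in>I. L2_inner \<Omega> (gradient_remainder M (c i)) (gradient_remainder M (c j)) * time_gram i j)"
    by (intro mult_nonneg_nonneg time_gram_inner_nonneg gradient_remainder_L2 c_H10) (use K_pos in auto)
  also have "\<dots> = (\<Sum>i\<in>I. \<Sum>j\<in>I. (K * L2_inner \<Omega> (gradient_remainder M (c i)) (gradient_remainder M (c j))) * time_gram i j)"
    by (simp add: sum_distrib_left mult.assoc)
  also have "\<dots> = (\<Sum>i\<in>I. \<Sum>j\<in>I. (energy K \<Omega> (c i) (c j) - (\<Sum>m=1..M. lam m * (mode m i * mode m j))) * time_gram i j)"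
    by (intro sum.cong refl arg_cong2[where f = "\<lambda>x y. x * y"] gradient_remainder_inner c_H10)
  also have "\<dots> = (\<Sum>i\<in>I. \<Sum>j\<in>I. energy K \<Omega> (c i) (c j) * time_gram i j)
      - (\<Sum>i\<in>I. \<Sum>j\<in>I. \<Sum>m=1..M. lam m * (mode m i * mode m j * time_gram i j))"
    by (simp add: left_diff_distrib sum_subtractf sum_distrib_right mult.assoc)
  also have "(\<Sum>i\<in>I. \<Sum>j\<in>I. \<Sum>m=1..M. lam m * (mode m i * mode m j * time_gram i j))
      = (\<Sum>i\<in>I. \<Sum>m=1..M. \<Sum>j\<in>I. lam m * (mode m i * mode m j * time_gram i j))"
    by (intro sum.cong refl sum.swap)
  also have "\<dots> = (\<Sum>m=1..M. \<Sum>i\<in>I. \<Sum>j\<in>I. lam m * (mode m i * mode m j * time_gram i j))"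
    by (rule sum.swap)
  also have "\<dots> = (\<Sum>m=1..M. lam m * mode_energy m)"
    by (simp add: spline_product_integral time_gram_def sum_distrib_left)
  finally show ?thesis unfolding state_energy_integral by simp
qed

lemma state_energy_nonneg: "0 \<le> state_energy_total"
  using mode_energy_sum_le[of 0] by simp

lemma source_coeff_support: "r \<notin> {0..\<tau>} \<Longrightarrow> source_coeff w r = 0"
  by (simp add: source_coeff_def)

definition source_pairing :: "real \<Rightarrow> real" where
  "source_pairing s = (\<Sum>i\<in>I. trunc_power (a i) (k i) s * source_coeff (c i) s)"

lemma source_pairing_eq:
  "AE s in lebesgue. source_pairing s = indicator {0..\<tau>} s *\<^sub>R L2_inner \<Omega> (f s) (state s)"
  using AE_source_L2
proof eventually_elim
  case (elim s)
  show ?case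
  proof (cases "s \<in> {0..\<tau>}")
    case True
    then have fs: "f s \<in> L2_space \<Omega>" using elim by simp
    show ?thesis
      using True L2_inner_sum_scale_right[OF c_L2 fs, of I "\<lambda>i. i" "\<lambda>i. trunc_power (a i) (k i) s"]
      by (simp add: source_coeff_def source_pairing_def state_def[abs_def])
  qed (simp add: source_coeff_def source_pairing_def)
qed

lemma source_pairing_integrable: "integrable lebesgue source_pairing"
  unfolding source_pairing_def[abs_def]
proof (rule Bochner_Integration.integrable_sum)
  fix i assume i: "i \<in> I"
  have m: "(\<lambda>s. trunc_power (a i) (k i) s * source_coeff (c i) s) \<in> borel_measurable lebesgue"
    using borel_imp_lebesgue_measurable[OF trunc_power_measurable] source_coeff_measurable[OF c_L2[OF i]]
    by (rule borel_measurable_times)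
  show "integrable lebesgue (\<lambda>s. trunc_power (a i) (k i) s * source_coeff (c i) s)"
  proof (rule Bochner_Integration.integrable_bound[OF integrable_mult_left[OF source_norm_integrable] m])
    show "AE s in lebesgue. norm (trunc_power (a i) (k i) s * source_coeff (c i) s)
        \<le> norm (source_norm s * ((1 + \<bar>\<tau>\<bar>) ^ k i * L2_norm \<Omega> (c i)))"
      using AE_source_L2
    proof eventually_elim
      case (elim s)
      show ?case
      proof (cases "s \<in> {0..\<tau>}")
        case False
        then show ?thesis by (simp add: source_coeff_def)
      next
        case True
        then have "\<bar>trunc_power (a i) (k i) s\<bar> * \<bar>source_coeff (c i) s\<bar>
            \<le> (1 + \<bar>\<tau>\<bar>) ^ k i * (source_norm s * L2_norm \<Omega> (c i))"
          using source_coeff_bound[OF elim c_L2[OF i]] trunc_power_bound[OF a_nonneg[OF i], of s \<tau> "k i"]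
            trunc_power_nonneg[of "a i" "k i" s]
          by (intro mult_mono) auto
        then show ?thesis
          using source_norm_nonneg[of s] L2_norm_nonneg[of \<Omega> "c i"] by (simp add: abs_mult algebra_simps)
      qed
    qed
  qed
qed

lemma work_measurable:
  "(\<lambda>s. indicator {0..\<tau>} s *\<^sub>R L2_inner \<Omega> (f s) (state s)) \<in> borel_measurable lebesgue"
  by (rule borel_measurable_AE[OF borel_measurable_integrable[OF source_pairing_integrable] source_pairing_eq])

lemma work_set_integrable: "set_integrable lebesgue {0..\<tau>} (\<lambda>s. L2_inner \<Omega> (f s) (state s))"
  unfolding set_integrable_def
  by (rule integrable_cong_AE_imp[OF source_pairing_integrable work_measurable])
    (use source_pairing_eq in eventually_elim, simp)

text \<open>The Parseval series converges for almost every time, dominated by a multiple of \<open>\<parallel>f(s)\<parallel>\<close>, which is integrable.\<close>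

lemma work_limit:
  "(\<lambda>M. \<Sum>m=1..M. \<integral>s. source_coeff (\<phi> m) s * spline (mode m) s \<partial>lebesgue)
    \<longlonglongrightarrow> (LINT s:{0..\<tau>}|lebesgue. L2_inner \<Omega> (f s) (state s))"
proof -
  have tp: "\<bar>trunc_power (a i) (k i) s\<bar> \<le> (1 + \<bar>\<tau>\<bar>) ^ k i" if "i \<in> I" "s \<le> \<tau>" for i s
    using trunc_power_bound[OF a_nonneg[OF that(1)] that(2)] trunc_power_nonneg[of "a i" "k i" s] by simp
  have int: "integrable lebesgue (\<lambda>s. source_coeff (\<phi> m) s * spline (mode m) s)" if "m \<in> {1..M}" for m M
    using that by (intro frac_form_spline_cut(1)[where \<tau> = \<tau>] source_coeff_admissible phi_L2 source_coeff_support) auto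
  let ?S = "\<lambda>M s. \<Sum>m=1..M. source_coeff (\<phi> m) s * spline (mode m) s"
  let ?w = "\<lambda>s. source_norm s * (\<Sum>i\<in>I. (1 + \<bar>\<tau>\<bar>) ^ k i * L2_norm \<Omega> (c i))"
  have split: "?S M s = (\<Sum>i\<in>I. trunc_power (a i) (k i) s
      * (indicator {0..\<tau>} s * (\<Sum>m=1..M. L2_inner \<Omega> (f s) (\<phi> m) * mode m i)))" for M s
  proof -
    have "?S M s = (\<Sum>m=1..M. \<Sum>i\<in>I. source_coeff (\<phi> m) s * (mode m i * trunc_power (a i) (k i) s))"
      by (simp add: spline_def sum_distrib_left)
    also have "\<dots> = (\<Sum>i\<in>I. \<Sum>m=1..M. source_coeff (\<phi> m) s * (mode m i * trunc_power (a i) (k i) s))"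
      by (rule sum.swap)
    finally show ?thesis by (simp add: source_coeff_def sum_distrib_left algebra_simps)
  qed
  have "(\<lambda>M. \<integral>s. ?S M s \<partial>lebesgue) \<longlonglongrightarrow> (\<integral>s. source_pairing s \<partial>lebesgue)"
  proof (rule integral_dominated_convergence)
    show "source_pairing \<in> borel_measurable lebesgue"
      by (rule borel_measurable_integrable[OF source_pairing_integrable])
    show "?S M \<in> borel_measurable lebesgue" for M
      using int by (intro borel_measurable_sum borel_measurable_integrable) auto
    show "integrable lebesgue ?w" by (rule integrable_mult_left[OF source_norm_integrable])
    show "AE s in lebesgue. (\<lambda>M. ?S M s) \<longlonglongrightarrow> source_pairing s"
      using AE_source_L2
    proof eventually_elim
      case (elim s)
      show ?case
        unfolding split source_pairing_def
      proof (intro tendsto_sum tendsto_mult_left)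
        fix i assume i: "i \<in> I"
        show "(\<lambda>M. indicator {0..\<tau>} s * (\<Sum>m=1..M. L2_inner \<Omega> (f s) (\<phi> m) * mode m i)) \<longlonglongrightarrow> source_coeff (c i) s"
        proof (cases "s \<in> {0..\<tau>}")
          case True
          then show ?thesis using Parseval[OF _ c_L2[OF i], of "f s"] elim by (simp add: source_coeff_def)
        qed (simp add: source_coeff_def)
      qed
    qed
    show "AE s in lebesgue. norm (?S M s) \<le> ?w s" for M
      using AE_source_L2
    proof eventually_elim
      case (elim s)
      show ?case
      proof (cases "s \<in> {0..\<tau>}")
        case False
        then show ?thesis by (simp add: source_coeff_def source_norm_def)
      next
        case True
        then have fs: "f s \<in> L2_space \<Omega>" using elim by simp
        have "norm (?S M s) \<le> (\<Sum>i\<in>I. (1 + \<bar>\<tau>\<bar>) ^ k i * (L2_norm \<Omega> (f s) * L2_norm \<Omega> (c i)))"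
          unfolding split real_norm_def
        proof (rule order_trans[OF sum_abs], rule sum_mono)
          fix i assume i: "i \<in> I"
          have "\<bar>\<Sum>m=1..M. L2_inner \<Omega> (f s) (\<phi> m) * mode m i\<bar> \<le> L2_norm \<Omega> (f s) * L2_norm \<Omega> (c i)"
            by (rule order_trans[OF sum_abs coefficient_sum_bound[OF fs c_L2[OF i]]])
          then show "\<bar>trunc_power (a i) (k i) s * (indicator {0..\<tau>} s * (\<Sum>m=1..M. L2_inner \<Omega> (f s) (\<phi> m) * mode m i))\<bar>
              \<le> (1 + \<bar>\<tau>\<bar>) ^ k i * (L2_norm \<Omega> (f s) * L2_norm \<Omega> (c i))"
            using True tp[OF i, of s] by (simp add: abs_mult mult_mono)
        qed
        also have "\<dots> = ?w s" using True by (simp add: source_norm_def sum_distrib_left algebra_simps)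
        finally show ?thesis .
      qed
    qed
  qed
  moreover have "(\<integral>s. ?S M s \<partial>lebesgue) = (\<Sum>m=1..M. \<integral>s. source_coeff (\<phi> m) s * spline (mode m) s \<partial>lebesgue)" for M
    by (rule Bochner_Integration.integral_sum) (rule int)
  moreover have "(\<integral>s. source_pairing s \<partial>lebesgue) = (LINT s:{0..\<tau>}|lebesgue. L2_inner \<Omega> (f s) (state s))"
    unfolding set_lebesgue_integral_def
    by (rule integral_cong_AE[OF borel_measurable_integrable[OF source_pairing_integrable] work_measurable source_pairing_eq])
  ultimately show ?thesis by simp
qed

text \<open>For each mode \<open>spline_duality\<close> bounds the work by \<open>d \<surd>(Q\<^sub>m / \<lambda>\<^sub>m) \<surd>(\<lambda>\<^sub>m E\<^sub>m)\<close>. The Cauchy-Schwarz inequality over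
  \<open>m\<close> separates the two factors, whose sums of squares are controlled by \<open>resolvent_form_bound\<close> and by
  \<open>mode_energy_sum_le\<close>.\<close>

theorem source_work_bound:
  "\<bar>LINT s:{0..\<tau>}|lebesgue. L2_inner \<Omega> (f s) (state s)\<bar> \<le> 1 / cos (\<alpha> * pi / 2)
    * sqrt (LINT s:{0..\<tau>}|lebesgue. \<bar>L2_inner \<Omega> (frac_integral (- \<alpha>) f s) (dirichlet_inverse K \<Omega> (f s))\<bar>)
    * sqrt state_energy_total"
proof -
  define d where "d = 1 / cos (\<alpha> * pi / 2)"
  have d_eq: "1 / cos (- \<alpha> * pi / 2) = d" by (simp add: d_def)
  have "0 < cos (\<alpha> * pi / 2)"
  proof (rule cos_gt_zero_pi)
    show "- (pi / 2) < \<alpha> * pi / 2" using alpha mult_strict_right_mono[of "-1" \<alpha> pi] by simp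
    show "\<alpha> * pi / 2 < pi / 2" using alpha mult_strict_right_mono[of \<alpha> 1 pi] by simp
  qed
  then have d: "0 < d" by (simp add: d_def)
  let ?Q = "\<lambda>m. frac_form (- \<alpha>) (source_coeff (\<phi> m)) (source_coeff (\<phi> m))"
  let ?R = "\<integral>z. causal_kernel (- \<alpha>) (fst z - snd z) * resolvent_form z \<partial>(lebesgue \<Otimes>\<^sub>M lebesgue)"
  have Qlim: "(\<lambda>M. \<Sum>m=1..M. ?Q m / lam m) \<longlonglongrightarrow> ?R"
    using resolvent_dominated(1) by (simp only: resolvent_sum_form)
  have adm: "frac_admissible (- \<alpha>) (source_coeff (\<phi> m))" if "1 \<le> m" for m
    by (rule source_coeff_admissible[OF phi_L2[OF that]])
  have Q: "0 \<le> ?Q m" if "1 \<le> m" for m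
    by (rule frac_form_sector(2)[OF mu adm[OF that] adm[OF that]])
  have bound: "\<bar>\<Sum>m=1..M. \<integral>s. source_coeff (\<phi> m) s * spline (mode m) s \<partial>lebesgue\<bar>
      \<le> d * sqrt (\<Sum>m=1..M. ?Q m / lam m) * sqrt state_energy_total" for M
  proof -
    have "\<bar>\<Sum>m=1..M. \<integral>s. source_coeff (\<phi> m) s * spline (mode m) s \<partial>lebesgue\<bar>
        \<le> (\<Sum>m=1..M. d * (\<bar>sqrt (?Q m / lam m)\<bar> * \<bar>sqrt (lam m * mode_energy m)\<bar>))"
    proof (rule order_trans[OF sum_abs], rule sum_mono)
      fix m assume "m \<in> {1..M}"
      then have m: "1 \<le> m" by simp
      have "\<bar>\<integral>s. source_coeff (\<phi> m) s * spline (mode m) s \<partial>lebesgue\<bar> \<le> d * sqrt (?Q m) * sqrt (mode_energy m)"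
        using spline_duality[OF adm[OF m] source_coeff_support, of \<tau> "mode m"] unfolding d_eq by simp
      also have "\<dots> = d * (\<bar>sqrt (?Q m / lam m)\<bar> * \<bar>sqrt (lam m * mode_energy m)\<bar>)"
        using lam_pos[OF m] Q[OF m] spline_energy_nonneg[of \<tau> "mode m"]
        by (simp add: real_sqrt_divide real_sqrt_mult)
      finally show "\<bar>\<integral>s. source_coeff (\<phi> m) s * spline (mode m) s \<partial>lebesgue\<bar>
          \<le> d * (\<bar>sqrt (?Q m / lam m)\<bar> * \<bar>sqrt (lam m * mode_energy m)\<bar>)" .
    qed
    also have "\<dots> = d * (\<Sum>m=1..M. \<bar>sqrt (?Q m / lam m)\<bar> * \<bar>sqrt (lam m * mode_energy m)\<bar>)"
      by (simp only: sum_distrib_left)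
    also have "\<dots> \<le> d * (L2_set (\<lambda>m. sqrt (?Q m / lam m)) {1..M} * L2_set (\<lambda>m. sqrt (lam m * mode_energy m)) {1..M})"
      using d by (intro mult_left_mono L2_set_mult_ineq) simp
    also have "L2_set (\<lambda>m. sqrt (?Q m / lam m)) {1..M} = sqrt (\<Sum>m=1..M. ?Q m / lam m)"
      unfolding L2_set_def
      by (intro arg_cong[where f = sqrt] sum.cong refl real_sqrt_pow2 divide_nonneg_pos Q lam_pos) auto
    also have "L2_set (\<lambda>m. sqrt (lam m * mode_energy m)) {1..M} = sqrt (\<Sum>m=1..M. lam m * mode_energy m)"
      unfolding L2_set_def
      by (intro arg_cong[where f = sqrt] sum.cong refl real_sqrt_pow2 mult_nonneg_nonneg spline_energy_nonneg
          less_imp_le[OF lam_pos]) auto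
    also have "d * (sqrt (\<Sum>m=1..M. ?Q m / lam m) * sqrt (\<Sum>m=1..M. lam m * mode_energy m))
        \<le> d * (sqrt (\<Sum>m=1..M. ?Q m / lam m) * sqrt state_energy_total)"
    proof (intro mult_left_mono real_sqrt_le_mono mode_energy_sum_le)
      show "0 \<le> sqrt (\<Sum>m=1..M. ?Q m / lam m)"
        by (intro real_sqrt_ge_zero sum_nonneg divide_nonneg_pos Q lam_pos) auto
    qed (use d in simp)
    finally show ?thesis by (simp add: mult.assoc)
  qed
  have "\<bar>LINT s:{0..\<tau>}|lebesgue. L2_inner \<Omega> (f s) (state s)\<bar> \<le> d * sqrt ?R * sqrt state_energy_total"
  proof (rule LIMSEQ_le)
    show "(\<lambda>M. \<bar>\<Sum>m=1..M. \<integral>s. source_coeff (\<phi> m) s * spline (mode m) s \<partial>lebesgue\<bar>)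
        \<longlonglongrightarrow> \<bar>LINT s:{0..\<tau>}|lebesgue. L2_inner \<Omega> (f s) (state s)\<bar>"
      by (rule tendsto_rabs[OF work_limit])
    show "(\<lambda>M. d * sqrt (\<Sum>m=1..M. ?Q m / lam m) * sqrt state_energy_total) \<longlonglongrightarrow> d * sqrt ?R * sqrt state_energy_total"
      by (intro tendsto_mult tendsto_const tendsto_real_sqrt Qlim)
  qed (use bound in blast)
  also have "\<dots> \<le> d * sqrt (LINT s:{0..\<tau>}|lebesgue. \<bar>L2_inner \<Omega> (frac_integral (- \<alpha>) f s) (dirichlet_inverse K \<Omega> (f s))\<bar>)
      * sqrt state_energy_total"
    using resolvent_form_bound(2) d state_energy_nonneg
    by (intro mult_right_mono mult_left_mono real_sqrt_le_mono) auto
  finally show ?thesis by (simp only: d_def)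
qed

end

section \<open>The discontinuous Galerkin solution\<close>

lemma set_integral_split:
  fixes h :: "real \<Rightarrow> real"
  assumes h: "set_integrable lebesgue {0..b} h" and ab: "0 \<le> a" "a \<le> b"
  shows "(LINT s:{0..b}|lebesgue. h s) = (LINT s:{0..a}|lebesgue. h s) + (LINT s:{a..b}|lebesgue. h s)"
proof -
  have h1: "set_integrable lebesgue {0..a} h" by (rule set_integrable_subset[OF h]) (use ab in auto)
  have h2: "set_integrable lebesgue {a..b} h" by (rule set_integrable_subset[OF h]) (use ab in auto)
  have "(LINT s:{0..b}|lebesgue. h s) = (\<integral>s. indicator {0..a} s *\<^sub>R h s + indicator {a..b} s *\<^sub>R h s \<partial>lebesgue)"
    unfolding set_lebesgue_integral_def
  proof (rule integral_cong_AE)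
    show "AE s in lebesgue. indicator {0..b} s *\<^sub>R h s = indicator {0..a} s *\<^sub>R h s + indicator {a..b} s *\<^sub>R h s"
      using AE_completion[OF AE_lborel_singleton[of a]] by eventually_elim (use ab in \<open>auto simp: indicator_def\<close>)
  qed (use h h1 h2 in \<open>auto simp: set_integrable_def\<close>)
  also have "\<dots> = (LINT s:{0..a}|lebesgue. h s) + (LINT s:{a..b}|lebesgue. h s)"
    using h1 h2 unfolding set_integrable_def set_lebesgue_integral_def by (rule Bochner_Integration.integral_add)
  finally show ?thesis .
qed

lemma set_integral_cong_AE_lebesgue:
  fixes g h :: "real \<Rightarrow> real"
  assumes h: "set_integrable lebesgue A h" and eq: "AE s in lebesgue. s \<in> A \<longrightarrow> g s = h s"
  shows "(LINT s:A|lebesgue. g s) = (LINT s:A|lebesgue. h s)"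
proof -
  have m: "(\<lambda>s. indicator A s *\<^sub>R h s) \<in> borel_measurable lebesgue"
    using h by (auto simp: set_integrable_def)
  have eq': "AE s in lebesgue. indicator A s *\<^sub>R h s = indicator A s *\<^sub>R g s"
    using eq by eventually_elim (auto simp: indicator_def)
  show ?thesis
    unfolding set_lebesgue_integral_def
    by (rule integral_cong_AE[OF m borel_measurable_AE[OF m eq'] eq', symmetric])
qed

lemma set_integral_mono_interval:
  fixes h :: "real \<Rightarrow> real"
  assumes h: "set_integrable lebesgue {0..b} h" and ab: "0 \<le> a" "a \<le> b" and nn: "\<And>s. 0 \<le> h s"
  shows "(LINT s:{0..a}|lebesgue. h s) \<le> (LINT s:{0..b}|lebesgue. h s)"
proof -
  have "0 \<le> (LINT s:{a..b}|lebesgue. h s)"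
    unfolding set_lebesgue_integral_def by (rule Bochner_Integration.integral_nonneg) (simp add: nn)
  then show ?thesis using set_integral_split[OF h ab] by simp
qed

lemma L2_inner_double_sum:
  fixes c :: "'i \<Rightarrow> 'a::euclidean_space \<Rightarrow> real"
  assumes c: "\<And>i. i \<in> I \<Longrightarrow> c i \<in> L2_space \<Omega>"
  shows "L2_inner \<Omega> (\<lambda>x. \<Sum>i\<in>I. a i * c i x) (\<lambda>x. \<Sum>i\<in>I. b i * c i x)
    = (\<Sum>i\<in>I. \<Sum>j\<in>I. a i * b j * L2_inner \<Omega> (c i) (c j))"
proof -
  let ?B = "\<lambda>x. \<Sum>i\<in>I. b i *\<^sub>R c i x"
  have B: "?B \<in> L2_space \<Omega>" by (intro L2_space_sum L2_space_scale c)
  have "L2_inner \<Omega> (\<lambda>x. \<Sum>i\<in>I. a i *\<^sub>R c i x) ?B = (\<Sum>i\<in>I. a i * L2_inner \<Omega> (c i) ?B)"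
    by (rule L2_inner_sum_scale_left[OF c B])
  also have "\<dots> = (\<Sum>i\<in>I. \<Sum>j\<in>I. a i * b j * L2_inner \<Omega> (c i) (c j))"
  proof (rule sum.cong[OF refl])
    fix i assume i: "i \<in> I"
    have "L2_inner \<Omega> (c i) ?B = (\<Sum>j\<in>I. b j * L2_inner \<Omega> (c i) (c j))"
      by (rule L2_inner_sum_scale_right[OF c c[OF i]])
    then show "a i * L2_inner \<Omega> (c i) ?B = (\<Sum>j\<in>I. a i * b j * L2_inner \<Omega> (c i) (c j))"
      by (simp only: sum_distrib_left mult.assoc)
  qed
  finally show ?thesis by simp
qed

definition time_poly :: "nat \<Rightarrow> (nat \<Rightarrow> 'a \<Rightarrow> real) \<Rightarrow> real \<Rightarrow> 'a \<Rightarrow> real" where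
  "time_poly q c s x = (\<Sum>j\<le>q. s ^ j * c j x)"

definition time_poly_deriv :: "nat \<Rightarrow> (nat \<Rightarrow> 'a \<Rightarrow> real) \<Rightarrow> real \<Rightarrow> 'a \<Rightarrow> real" where
  "time_poly_deriv q c s x = (\<Sum>j\<le>q. (real j * s ^ (j - 1)) * c j x)"

lemma poly_space_iff:
  "X \<in> poly_space \<Omega> q \<longleftrightarrow> (\<exists>c. (\<forall>j\<le>q. c j \<in> H10_space \<Omega>) \<and> X = time_poly q c)"
  by (simp add: poly_space_def time_poly_def[abs_def])

lemma time_poly_has_derivative:
  "((\<lambda>s. time_poly q c s x) has_real_derivative time_poly_deriv q c s x) (at s)"
  unfolding time_poly_def time_poly_deriv_def
  by (intro DERIV_sum) (auto intro!: derivative_eq_intros)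

lemma time_poly_tendsto: "((\<lambda>s. time_poly q c s x) \<longlongrightarrow> time_poly q c r x) (at r within S)"
  unfolding time_poly_def by (intro tendsto_intros)

lemma right_value_time_poly: "right_value (time_poly q c) r = time_poly q c r"
  unfolding right_value_def by (rule ext, rule tendsto_Lim[OF trivial_limit_at_right_real time_poly_tendsto])

lemma time_poly_norm_FTC:
  fixes c :: "nat \<Rightarrow> 'a::euclidean_space \<Rightarrow> real"
  assumes c: "\<And>j. j \<le> q \<Longrightarrow> c j \<in> L2_space \<Omega>" and ab: "a \<le> b"
  shows "set_integrable lebesgue {a..b} (\<lambda>s. L2_inner \<Omega> (time_poly_deriv q c s) (time_poly q c s))"
    and "(LINT s:{a..b}|lebesgue. L2_inner \<Omega> (time_poly_deriv q c s) (time_poly q c s))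
      = (L2_inner \<Omega> (time_poly q c b) (time_poly q c b) - L2_inner \<Omega> (time_poly q c a) (time_poly q c a)) / 2"
proof -
  let ?g = "\<lambda>i j. L2_inner \<Omega> (c i) (c j)"
  let ?f = "\<lambda>s. \<Sum>i\<le>q. \<Sum>j\<le>q. (real i * s ^ (i - 1)) * s ^ j * ?g i j"
  let ?F = "\<lambda>s. (\<Sum>i\<le>q. \<Sum>j\<le>q. s ^ i * s ^ j * ?g i j) / 2"
  have f: "L2_inner \<Omega> (time_poly_deriv q c s) (time_poly q c s) = ?f s" for s
    unfolding time_poly_def[abs_def] time_poly_deriv_def[abs_def] by (rule L2_inner_double_sum) (simp add: c)
  have F: "L2_inner \<Omega> (time_poly q c s) (time_poly q c s) / 2 = ?F s" for s
    unfolding time_poly_def[abs_def] by (subst L2_inner_double_sum) (simp_all add: c)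
  have cont: "continuous_on {a..b} ?f" by (intro continuous_intros)
  have deriv: "(?F has_real_derivative ?f s) (at s within {a..b})" for s
  proof -
    have "(?F has_real_derivative (\<Sum>i\<le>q. \<Sum>j\<le>q. (real i * s ^ (i - 1) * s ^ j + s ^ i * (real j * s ^ (j - 1))) * ?g i j) / 2)
        (at s within {a..b})"
      by (intro DERIV_cdivide DERIV_sum) (auto intro!: derivative_eq_intros simp: algebra_simps)
    also have "(\<Sum>i\<le>q. \<Sum>j\<le>q. (real i * s ^ (i - 1) * s ^ j + s ^ i * (real j * s ^ (j - 1))) * ?g i j)
        = ?f s + (\<Sum>i\<le>q. \<Sum>j\<le>q. s ^ i * (real j * s ^ (j - 1)) * ?g i j)"
      by (simp only: distrib_right sum.distrib)
    also have "(\<Sum>i\<le>q. \<Sum>j\<le>q. s ^ i * (real j * s ^ (j - 1)) * ?g i j) = (\<Sum>j\<le>q. \<Sum>i\<le>q. s ^ i * (real j * s ^ (j - 1)) * ?g i j)"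
      by (rule sum.swap)
    also have "\<dots> = ?f s"
    proof (intro sum.cong refl)
      fix j i
      show "s ^ i * (real j * s ^ (j - 1)) * ?g i j = (real j * s ^ (j - 1)) * s ^ i * ?g j i"
        unfolding L2_inner_commute[of \<Omega> "c i" "c j"] by (simp only: ac_simps)
    qed
    finally show ?thesis by simp
  qed
  have int: "set_integrable lborel {a..b} ?f" by (rule borel_integrable_atLeastAtMost'[OF cont])
  have m: "(\<lambda>s. indicator {a..b} s *\<^sub>R ?f s) \<in> borel_measurable lborel"
    using int by (auto simp: set_integrable_def)
  show "set_integrable lebesgue {a..b} (\<lambda>s. L2_inner \<Omega> (time_poly_deriv q c s) (time_poly q c s))"
    unfolding f using int m by (simp only: set_integrable_def integrable_completion)
  have "(LINT s:{a..b}|lebesgue. ?f s) = (\<integral>s. indicator {a..b} s *\<^sub>R ?f s \<partial>lborel)"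
    unfolding set_lebesgue_integral_def by (rule integral_completion[OF m])
  also have "\<dots> = ?F b - ?F a"
    by (rule integral_FTC_atLeastAtMost[OF ab _ cont]) (use deriv in \<open>simp add: has_real_derivative_iff_has_vector_derivative\<close>)
  finally show "(LINT s:{a..b}|lebesgue. L2_inner \<Omega> (time_poly_deriv q c s) (time_poly q c s))
      = (L2_inner \<Omega> (time_poly q c b) (time_poly q c b) - L2_inner \<Omega> (time_poly q c a) (time_poly q c a)) / 2"
    unfolding f by (simp add: F diff_divide_distrib)
qed

lemma time_mesh_mono:
  assumes "time_mesh T N t" "i \<le> j" "j \<le> N" shows "t i \<le> t j"
  using assms(2,3)
proof (induction j rule: dec_induct)
  case (step n)
  then have "t n < t (Suc n)" using assms(1) by (simp add: time_mesh_def)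
  with step show ?case by simp
qed simp

lemma time_mesh_cover:
  assumes mesh: "time_mesh T N t" and s: "0 \<le> s" "s \<le> t n" "n \<le> N" "s \<notin> t ` {..N}"
  shows "\<exists>m\<in>{1..n}. t (m - 1) < s \<and> s < t m"
  using s
proof (induction n)
  case 0
  then show ?case using mesh by (auto simp: time_mesh_def)
next
  case (Suc n)
  show ?case
  proof (cases "s \<le> t n")
    case True
    then show ?thesis using Suc by fastforce
  next
    case False
    moreover have "s \<noteq> t (Suc n)" using Suc.prems by blast
    ultimately show ?thesis using Suc.prems by (intro bexI[of _ "Suc n"]) auto
  qed
qed

lemma AE_not_mesh: "AE s in lebesgue. s \<notin> (t :: nat \<Rightarrow> real) ` {..N}"
  by (rule AE_completion, rule AE_not_in, rule finite_imp_null_set_lborel) simp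

text \<open>A polynomial piece starting at \<open>a\<close>, expanded at its starting point.\<close>

lemma power_eq_trunc_power:
  assumes "j \<le> P"
  shows "(if a < s then s ^ j else 0) = (\<Sum>l\<le>P. trunc_power a l s * (real (j choose l) * a ^ (j - l)))"
proof (cases "a < s")
  case True
  have "s ^ j = ((s - a) + a) ^ j" by simp
  also have "\<dots> = (\<Sum>l\<le>j. real (j choose l) * (s - a) ^ l * a ^ (j - l))" by (rule binomial_ring)
  also have "\<dots> = (\<Sum>l\<le>P. real (j choose l) * (s - a) ^ l * a ^ (j - l))"
    using assms by (intro sum.mono_neutral_left) (auto simp: binomial_eq_0)
  finally show ?thesis using True by (simp add: trunc_power_def algebra_simps)
qed (simp add: trunc_power_def)

text \<open>At every node the difference of the two adjacent polynomials is switched on; the differences telescope to the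
  current polynomial.\<close>

lemma (in dirichlet_problem) dg_space_truncated_powers:
  assumes mesh: "time_mesh T N t" and U: "U \<in> dg_space \<Omega> N t p"
  obtains P c where "\<And>i. i \<in> {..<N} \<times> {..P::nat} \<Longrightarrow> c i \<in> H10_space \<Omega>"
    and "\<And>n s x. n \<in> {1..N} \<Longrightarrow> t (n - 1) < s \<Longrightarrow> s < t n \<Longrightarrow> x \<in> \<Omega> \<Longrightarrow>
      U s x = (\<Sum>i\<in>{..<N} \<times> {..P}. trunc_power (t (fst i)) (snd i) s * c i x)"
proof -
  have "\<forall>n\<in>{1..N}. \<exists>c. (\<forall>j\<le>p n. c j \<in> H10_space \<Omega>) \<and> (\<forall>s\<in>{t (n - 1)<..<t n}. \<forall>x\<in>\<Omega>. U s x = time_poly (p n) c s x)"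
  proof
    fix n assume "n \<in> {1..N}"
    then have "\<exists>X\<in>poly_space \<Omega> (p n). \<forall>s\<in>{t (n - 1)<..<t n}. \<forall>x\<in>\<Omega>. U s x = X s x"
      using U unfolding dg_space_def by blast
    then obtain X where X: "X \<in> poly_space \<Omega> (p n)" "\<forall>s\<in>{t (n - 1)<..<t n}. \<forall>x\<in>\<Omega>. U s x = X s x"
      by (rule bexE)
    from X(1) obtain c where c: "\<forall>j\<le>p n. c j \<in> H10_space \<Omega>" "X = time_poly (p n) c"
      unfolding poly_space_iff by (elim exE conjE)
    show "\<exists>c. (\<forall>j\<le>p n. c j \<in> H10_space \<Omega>) \<and> (\<forall>s\<in>{t (n - 1)<..<t n}. \<forall>x\<in>\<Omega>. U s x = time_poly (p n) c s x)"
      using c(1) X(2) unfolding c(2) by (intro exI[of _ c] conjI)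
  qed
  from bchoice[OF this] obtain C where C0: "\<forall>n\<in>{1..N}. (\<forall>j\<le>p n. C n j \<in> H10_space \<Omega>)
      \<and> (\<forall>s\<in>{t (n - 1)<..<t n}. \<forall>x\<in>\<Omega>. U s x = time_poly (p n) (C n) s x)"
    by (rule exE)
  have C: "\<And>n j. n \<in> {1..N} \<Longrightarrow> j \<le> p n \<Longrightarrow> C n j \<in> H10_space \<Omega>"
      "\<And>n s x. n \<in> {1..N} \<Longrightarrow> t (n - 1) < s \<Longrightarrow> s < t n \<Longrightarrow> x \<in> \<Omega> \<Longrightarrow> U s x = time_poly (p n) (C n) s x"
    using C0 by auto
  define P where "P = (\<Sum>n\<in>{1..N}. p n)"
  have P: "p n \<le> P" if "n \<in> {1..N}" for n unfolding P_def using that by (intro member_le_sum) auto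
  \<comment> \<open>All pieces are given the common degree \<open>P\<close>. Index \<open>0\<close> stands for the zero function before the
    first node, so that the telescoping sum starts from zero.\<close>
  define C' where "C' n j = (if n \<in> {1..N} \<and> j \<le> p n then C n j else (\<lambda>x. 0))" for n j
  have C'H: "C' n j \<in> H10_space \<Omega>" for n j unfolding C'_def using C(1) H10_zero(1) by auto
  define D where "D m j x = 1 * C' (Suc m) j x + (-1) * C' m j x" for m j x
  have DH: "D m j \<in> H10_space \<Omega>" for m j unfolding D_def[abs_def] by (rule H10_lincomb(1)[OF C'H C'H])
  define c where "c i x = (\<Sum>j\<le>P. (real (j choose snd i) * t (fst i) ^ (j - snd i)) * D (fst i) j x)" for i :: "nat \<times> nat" and x
  have cH: "c i \<in> H10_space \<Omega>" for i
    unfolding c_def[abs_def] by (rule H10_sum_mem) (auto simp: DH)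
  have "U s x = (\<Sum>i\<in>{..<N} \<times> {..P}. trunc_power (t (fst i)) (snd i) s * c i x)"
    if n: "n \<in> {1..N}" and s: "t (n - 1) < s" "s < t n" and x: "x \<in> \<Omega>" for n s x
  proof -
    have knot: "(t m < s) = (m < n)" if m: "m < N" for m
    proof
      assume "t m < s"
      show "m < n"
      proof (rule ccontr)
        assume "\<not> m < n"
        then have "t n \<le> t m" using m by (intro time_mesh_mono[OF mesh]) auto
        then show False using s \<open>t m < s\<close> by simp
      qed
    next
      assume "m < n"
      then have "t m \<le> t (n - 1)" using n by (intro time_mesh_mono[OF mesh]) auto
      then show "t m < s" using s by simp
    qed
    have tele: "(\<Sum>m<N. if t m < s then D m j x else 0) = C' n j x" for j
    proof -
      have "(\<Sum>m<N. if t m < s then D m j x else 0) = (\<Sum>m<n. C' (Suc m) j x - C' m j x)"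
        using n knot by (intro sum.mono_neutral_cong_right) (auto simp: D_def)
      also have "\<dots> = C' n j x - C' 0 j x" by (rule sum_lessThan_telescope)
      finally show ?thesis by (simp add: C'_def)
    qed
    have "U s x = (\<Sum>j\<le>p n. s ^ j * C n j x)" using C(2)[OF n s x] by (simp add: time_poly_def)
    also have "\<dots> = (\<Sum>j\<le>P. s ^ j * C' n j x)"
      using P[OF n] n by (intro sum.mono_neutral_cong_left) (auto simp: C'_def)
    also have "\<dots> = (\<Sum>j\<le>P. \<Sum>m<N. (if t m < s then s ^ j else 0) * D m j x)"
      unfolding tele[symmetric] by (intro sum.cong refl) (auto simp: sum_distrib_left intro!: sum.cong)
    also have "\<dots> = (\<Sum>j\<le>P. \<Sum>m<N. \<Sum>l\<le>P. trunc_power (t m) l s * ((real (j choose l) * t m ^ (j - l)) * D m j x))"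
      by (intro sum.cong refl, subst power_eq_trunc_power[where P = P]) (auto simp: sum_distrib_right mult.assoc)
    also have "\<dots> = (\<Sum>m<N. \<Sum>j\<le>P. \<Sum>l\<le>P. trunc_power (t m) l s * ((real (j choose l) * t m ^ (j - l)) * D m j x))"
      by (rule sum.swap)
    also have "\<dots> = (\<Sum>m<N. \<Sum>l\<le>P. \<Sum>j\<le>P. trunc_power (t m) l s * ((real (j choose l) * t m ^ (j - l)) * D m j x))"
      by (intro sum.cong refl sum.swap)
    also have "\<dots> = (\<Sum>m<N. \<Sum>l\<le>P. trunc_power (t m) l s * c (m, l) x)"
      by (simp add: c_def sum_distrib_left)
    also have "\<dots> = (\<Sum>i\<in>{..<N} \<times> {..P}. trunc_power (t (fst i)) (snd i) s * c i x)"
      by (subst sum.cartesian_product) (simp add: case_prod_unfold)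
    finally show ?thesis .
  qed
  with cH show ?thesis by (rule that)
qed

text \<open>A solution of the scheme together with one fixed representation by truncated powers, indexed by pairs of a
  node and a degree.\<close>

locale dg_representation = dirichlet_problem K \<Omega> \<phi> lam
  for K :: real and \<Omega> :: "'a::euclidean_space set" and \<phi> lam +
  fixes \<alpha> T :: real and N :: nat and t :: "nat \<Rightarrow> real" and p :: "nat \<Rightarrow> nat"
    and f U :: "real \<Rightarrow> 'a \<Rightarrow> real" and U0 :: "'a \<Rightarrow> real"
    and P :: nat and c :: "nat \<times> nat \<Rightarrow> 'a \<Rightarrow> real"
  assumes order: "- 1 < \<alpha>" "\<alpha> < 0" and mesh: "time_mesh T N t"
    and regular: "regular_source \<alpha> T \<Omega> f" and U0: "U0 \<in> L2_space \<Omega>"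
    and solution: "dg_solution \<alpha> K \<Omega> N t p f U0 U"
    and coeff_H10: "\<And>i. i \<in> {..<N} \<times> {..P} \<Longrightarrow> c i \<in> H10_space \<Omega>"
    and representation: "\<And>n s x. n \<in> {1..N} \<Longrightarrow> t (n - 1) < s \<Longrightarrow> s < t n \<Longrightarrow> x \<in> \<Omega> \<Longrightarrow>
      U s x = (\<Sum>i\<in>{..<N} \<times> {..P}. trunc_power (t (fst i)) (snd i) s * c i x)"
begin

abbreviation "knots \<equiv> {..<N} \<times> {..P}"
abbreviation "knot_time \<equiv> (\<lambda>i::nat \<times> nat. t (fst i))"
abbreviation "knot_degree \<equiv> (snd :: nat \<times> nat \<Rightarrow> nat)"

lemma t_0: "t 0 = 0" and t_N: "t N = T"
  using mesh by (auto simp: time_mesh_def)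

lemma t_nonneg: "n \<le> N \<Longrightarrow> 0 \<le> t n"
  using time_mesh_mono[OF mesh, of 0 n] t_0 by simp

lemma t_le_T: "n \<le> N \<Longrightarrow> t n \<le> T"
  using time_mesh_mono[OF mesh, of n N] t_N by simp

lemma t_step: "n \<in> {1..N} \<Longrightarrow> t (n - 1) < t n"
  using mesh unfolding time_mesh_def by (cases n) auto

lemma dg_data_knots: "0 \<le> \<tau> \<Longrightarrow> \<tau> \<le> T \<Longrightarrow> dg_data K \<Omega> \<phi> lam \<alpha> T \<tau> f knots knot_time c"
  using order regular t_nonneg coeff_H10 by unfold_locales auto

abbreviation "V \<equiv> dg_data.state knots knot_time knot_degree c"
abbreviation "V_RL \<equiv> dg_data.state_RL \<alpha> knots knot_time knot_degree c"

lemma T_nonneg: "0 \<le> T"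
  using t_nonneg[of N] t_N by simp

lemma V_eq: "V s x = (\<Sum>i\<in>knots. trunc_power (knot_time i) (knot_degree i) s * c i x)"
  and V_RL_eq: "V_RL s x = (\<Sum>i\<in>knots. trunc_power_RL (- \<alpha>) (knot_time i) (knot_degree i) s * c i x)"
proof -
  interpret D: dg_data K \<Omega> \<phi> lam \<alpha> T T f knots knot_time knot_degree c
    by (rule dg_data_knots[OF T_nonneg order_refl])
  show "V s x = (\<Sum>i\<in>knots. trunc_power (knot_time i) (knot_degree i) s * c i x)" by (rule D.state_def)
  show "V_RL s x = (\<Sum>i\<in>knots. trunc_power_RL (- \<alpha>) (knot_time i) (knot_degree i) s * c i x)" by (rule D.state_RL_def)
qed

text \<open>The values of \<open>U\<close> at the nodes are unrelated to its polynomial pieces, but they form a null set.\<close>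

lemma frac_integral_U:
  assumes r: "0 \<le> r" "r \<le> T" and x: "x \<in> \<Omega>"
  shows "frac_integral (\<alpha> + 1) U r x = (\<Sum>i\<in>knots. c i x * (fact (knot_degree i)
    * causal_kernel ((1 - (- \<alpha>)) + (real (knot_degree i) + 1)) (r - knot_time i)))"
proof -
  have b: "0 < \<alpha> + 1" "\<alpha> + 1 = 1 - (- \<alpha>)" using order by auto
  have a: "0 \<le> knot_time i" if "i \<in> knots" for i using that t_nonneg by auto
  note int = frac_integral_trunc_power[OF b(1)]
  let ?h = "\<lambda>s. \<Sum>i\<in>knots. c i x * (frac_kernel (\<alpha> + 1) (r - s) * trunc_power (knot_time i) (knot_degree i) s)"
  have h: "set_integrable lebesgue {0..r} ?h"
    by (intro set_integrable_sum set_integrable_mult_right int a)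
  have "frac_integral (\<alpha> + 1) U r x = (LINT s:{0..r}|lebesgue. ?h s)"
    unfolding frac_integral_def
  proof (rule set_integral_cong_AE_lebesgue[OF h])
    show "AE s in lebesgue. s \<in> {0..r} \<longrightarrow> frac_kernel (\<alpha> + 1) (r - s) * U s x = ?h s"
      using AE_not_mesh[of t N]
    proof eventually_elim
      case (elim s)
      show ?case
      proof
        assume "s \<in> {0..r}"
        then obtain m where "m \<in> {1..N}" "t (m - 1) < s" "s < t m"
          using time_mesh_cover[OF mesh _ _ order_refl elim] r t_N by auto
        from representation[OF this x] show "frac_kernel (\<alpha> + 1) (r - s) * U s x = ?h s"
          by (simp add: sum_distrib_left algebra_simps)
      qed
    qed
  qed
  also have "\<dots> = (\<Sum>i\<in>knots. LINT s:{0..r}|lebesgue. c i x * (frac_kernel (\<alpha> + 1) (r - s) * trunc_power (knot_time i) (knot_degree i) s))"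
    by (intro set_integral_sum set_integrable_mult_right int a)
  also have "\<dots> = (\<Sum>i\<in>knots. c i x * (fact (knot_degree i)
    * causal_kernel ((\<alpha> + 1) + (real (knot_degree i) + 1)) (r - knot_time i)))"
    by (intro sum.cong refl) (simp add: int(2)[OF a])
  finally show ?thesis by (simp only: b(2))
qed

lemma RL_derivative_U:
  assumes n: "n \<in> {1..N}" and s: "t (n - 1) < s" "s < t n" and x: "x \<in> \<Omega>"
  shows "RL_derivative \<alpha> U s x = V_RL s x"
proof -
  have nT: "0 \<le> t (n - 1)" "t n \<le> T" using n t_nonneg[of "n - 1"] t_le_T[of n] by auto
  have mu: "- \<alpha> < 1" using order by simp
  have ne: "s \<noteq> knot_time i" if i: "i \<in> knots" for i
  proof (cases "fst i < n")
    case True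
    then have "t (fst i) \<le> t (n - 1)" using n by (intro time_mesh_mono[OF mesh]) auto
    then show ?thesis using s by simp
  next
    case False
    then have "t n \<le> t (fst i)" using i by (intro time_mesh_mono[OF mesh]) auto
    then show ?thesis using s by simp
  qed
  let ?g = "\<lambda>r. \<Sum>i\<in>knots. c i x * (fact (knot_degree i)
    * causal_kernel ((1 - (- \<alpha>)) + (real (knot_degree i) + 1)) (r - knot_time i))"
  have "(?g has_real_derivative (\<Sum>i\<in>knots. c i x * trunc_power_RL (- \<alpha>) (knot_time i) (knot_degree i) s)) (at s)"
    by (intro DERIV_sum DERIV_cmult has_derivative_frac_integral_trunc_power[OF mu] ne)
  then have "((\<lambda>r. frac_integral (\<alpha> + 1) U r x) has_real_derivative
      (\<Sum>i\<in>knots. c i x * trunc_power_RL (- \<alpha>) (knot_time i) (knot_degree i) s)) (at s)"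
  proof (rule has_field_derivative_transform_within_open[where S = "{t (n - 1)<..<t n}"])
    show "?g r = frac_integral (\<alpha> + 1) U r x" if "r \<in> {t (n - 1)<..<t n}" for r
      using that nT by (intro frac_integral_U[symmetric] x) auto
  qed (use s in auto)
  then show ?thesis unfolding RL_derivative_def V_RL_eq by (simp add: DERIV_imp_deriv mult.commute)
qed

lemma U_eq_V: "n \<in> {1..N} \<Longrightarrow> t (n - 1) < s \<Longrightarrow> s < t n \<Longrightarrow> x \<in> \<Omega> \<Longrightarrow> U s x = V s x"
  unfolding V_eq by (rule representation)

lemma AE_open_interval: "AE s in lebesgue. s \<in> {t (n - 1)..t n} \<longrightarrow> t (n - 1) < s \<and> s < t n"
  using AE_completion[OF AE_lborel_singleton[of "t (n - 1)"]] AE_completion[OF AE_lborel_singleton[of "t n"]]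
  by eventually_elim auto

definition state_energy_upto :: "nat \<Rightarrow> real" where
  "state_energy_upto n = (LINT s:{0..t n}|lebesgue. energy K \<Omega> (V_RL s) (V s))"

definition work_upto :: "nat \<Rightarrow> real" where
  "work_upto n = (LINT s:{0..t n}|lebesgue. L2_inner \<Omega> (f s) (V s))"

definition source_energy_upto :: "nat \<Rightarrow> real" where
  "source_energy_upto n = (LINT s:{0..t n}|lebesgue. \<bar>L2_inner \<Omega> (frac_integral (- \<alpha>) f s) (dirichlet_inverse K \<Omega> (f s))\<bar>)"

lemma work_bound:
  assumes n: "n \<le> N"
  shows "\<bar>work_upto n\<bar> \<le> 1 / cos (\<alpha> * pi / 2) * sqrt (source_energy_upto n) * sqrt (state_energy_upto n)"
    and "0 \<le> state_energy_upto n"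
    and "set_integrable lebesgue {0..t n} (\<lambda>s. energy K \<Omega> (V_RL s) (V s))"
    and "set_integrable lebesgue {0..t n} (\<lambda>s. L2_inner \<Omega> (f s) (V s))"
    and "set_integrable lebesgue {0..t n} (\<lambda>s. \<bar>L2_inner \<Omega> (frac_integral (- \<alpha>) f s) (dirichlet_inverse K \<Omega> (f s))\<bar>)"
proof -
  interpret D: dg_data K \<Omega> \<phi> lam \<alpha> T "t n" f knots knot_time knot_degree c
    by (rule dg_data_knots[OF t_nonneg[OF n] t_le_T[OF n]])
  show "\<bar>work_upto n\<bar> \<le> 1 / cos (\<alpha> * pi / 2) * sqrt (source_energy_upto n) * sqrt (state_energy_upto n)"
    unfolding work_upto_def source_energy_upto_def state_energy_upto_def by (rule D.source_work_bound)
  show "0 \<le> state_energy_upto n" unfolding state_energy_upto_def by (rule D.state_energy_nonneg)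
  show "set_integrable lebesgue {0..t n} (\<lambda>s. energy K \<Omega> (V_RL s) (V s))" by (rule D.state_energy_set_integrable)
  show "set_integrable lebesgue {0..t n} (\<lambda>s. L2_inner \<Omega> (f s) (V s))" by (rule D.work_set_integrable)
  show "set_integrable lebesgue {0..t n} (\<lambda>s. \<bar>L2_inner \<Omega> (frac_integral (- \<alpha>) f s) (dirichlet_inverse K \<Omega> (f s))\<bar>)"
    by (rule D.resolvent_form_bound(1))
qed

lemma energy_U:
  assumes n: "n \<le> N"
  shows "(LINT s:{0..t n}|lebesgue. energy K \<Omega> (RL_derivative \<alpha> U s) (U s)) = state_energy_upto n"
  unfolding state_energy_upto_def
proof (rule set_integral_cong_AE_lebesgue[OF work_bound(3)[OF n]])
  show "AE s in lebesgue. s \<in> {0..t n} \<longrightarrow> energy K \<Omega> (RL_derivative \<alpha> U s) (U s) = energy K \<Omega> (V_RL s) (V s)"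
    using AE_not_mesh[of t N]
  proof eventually_elim
    case (elim s)
    show ?case
    proof
      assume "s \<in> {0..t n}"
      then have "0 \<le> s" "s \<le> t n" by auto
      from time_mesh_cover[OF mesh this n elim] obtain m where "m \<in> {1..n}" "t (m - 1) < s" "s < t m" by blast
      then have m: "m \<in> {1..N}" "t (m - 1) < s" "s < t m" using n by auto
      show "energy K \<Omega> (RL_derivative \<alpha> U s) (U s) = energy K \<Omega> (V_RL s) (V s)"
        by (rule energy_cong[OF RL_derivative_U[OF m] U_eq_V[OF m]])
    qed
  qed
qed

text \<open>The scheme tested with \<open>X = U\<close>. The time derivative contributes \<open>(\<parallel>v\<^sub>n\<parallel>\<^sup>2 - \<parallel>w\<parallel>\<^sup>2) / 2\<close>, and
  \<open>\<langle>w - v\<^sub>n\<^sub>-\<^sub>1, w\<rangle> = (\<parallel>w\<parallel>\<^sup>2 + \<parallel>w - v\<^sub>n\<^sub>-\<^sub>1\<parallel>\<^sup>2 - \<parallel>v\<^sub>n\<^sub>-\<^sub>1\<parallel>\<^sup>2) / 2\<close>.\<close>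

lemma interval_identity:
  assumes n: "n \<in> {1..N}"
  defines "v \<equiv> node_minus U0 t U" and "w \<equiv> right_value U (t (n - 1))"
  assumes v: "v (n - 1) \<in> L2_space \<Omega>"
  shows "v n \<in> L2_space \<Omega>" and "w \<in> L2_space \<Omega>"
    and "L2_inner \<Omega> (v n) (v n) + L2_inner \<Omega> (\<lambda>x. w x - v (n - 1) x) (\<lambda>x. w x - v (n - 1) x)
      + 2 * (state_energy_upto n - state_energy_upto (n - 1))
      = L2_inner \<Omega> (v (n - 1)) (v (n - 1)) + 2 * (work_upto n - work_upto (n - 1))"
proof -
  let ?I = "{t (n - 1)..t n}"
  have n1: "n \<le> N" "n - 1 \<le> N" using n by auto
  have step: "t (n - 1) < t n" by (rule t_step[OF n])
  have "\<exists>X\<in>poly_space \<Omega> (p n). \<forall>s\<in>{t (n - 1)<..<t n}. \<forall>x\<in>\<Omega>. U s x = X s x"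
    using solution n unfolding dg_solution_def dg_space_def by blast
  then obtain X where X: "X \<in> poly_space \<Omega> (p n)" "\<forall>s\<in>{t (n - 1)<..<t n}. \<forall>x\<in>\<Omega>. U s x = X s x"
    by (rule bexE)
  from X(1) obtain C where C: "\<forall>j\<le>p n. C j \<in> H10_space \<Omega>" and XC: "X = time_poly (p n) C"
    unfolding poly_space_iff by (elim exE conjE)
  have UX: "U s x = X s x" if "t (n - 1) < s" "s < t n" "x \<in> \<Omega>" for s x
    using X(2) that by auto
  have CL2: "C j \<in> L2_space \<Omega>" if "j \<le> p n" for j using C that by (auto intro: H10_L2)
  have XL2: "X s \<in> L2_space \<Omega>" for s
    unfolding XC time_poly_def[abs_def] by (intro L2_space_sum L2_space_scale_real CL2) auto
  have w: "w x = X (t (n - 1)) x" if x: "x \<in> \<Omega>" for x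
    unfolding w_def right_value_def
  proof (rule tendsto_Lim[OF trivial_limit_at_right_real])
    have "\<forall>\<^sub>F s in at_right (t (n - 1)). X s x = U s x"
      unfolding eventually_at_right_field using step UX x by (intro exI[of _ "t n"]) auto
    then show "((\<lambda>s. U s x) \<longlongrightarrow> X (t (n - 1)) x) (at_right (t (n - 1)))"
      unfolding XC by (rule Lim_transform_eventually[OF time_poly_tendsto])
  qed
  have vn: "v n x = X (t n) x" if x: "x \<in> \<Omega>" for x
  proof -
    have "\<forall>\<^sub>F s in at_left (t n). X s x = U s x"
      unfolding eventually_at_left_field using step UX x by (intro exI[of _ "t (n - 1)"]) auto
    then have "((\<lambda>s. U s x) \<longlongrightarrow> X (t n) x) (at_left (t n))"
      unfolding XC by (rule Lim_transform_eventually[OF time_poly_tendsto])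
    then have "left_value U (t n) x = X (t n) x"
      unfolding left_value_def by (rule tendsto_Lim[OF trivial_limit_at_left_real])
    then show ?thesis using n by (simp add: v_def node_minus_def)
  qed
  show vL2: "v n \<in> L2_space \<Omega>" using XL2[of "t n"] L2_space_cong[of \<Omega> "v n" "X (t n)"] vn by blast
  show wL2: "w \<in> L2_space \<Omega>" using XL2[of "t (n - 1)"] L2_space_cong[of \<Omega> w "X (t (n - 1))"] w by blast
  have dU: "time_derivative U s x = time_poly_deriv (p n) C s x" if s: "t (n - 1) < s" "s < t n" and x: "x \<in> \<Omega>" for s x
  proof -
    have "((\<lambda>r. U r x) has_real_derivative time_poly_deriv (p n) C s x) (at s)"
      by (rule has_field_derivative_transform_within_open[OF time_poly_has_derivative, where S = "{t (n - 1)<..<t n}"])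
        (use s UX[unfolded XC] x in auto)
    then show ?thesis unfolding time_derivative_def by (rule DERIV_imp_deriv)
  qed
  note FTC = time_poly_norm_FTC[where q = "p n" and c = C, OF CL2 less_imp_le[OF step], folded XC]
  have eI: "set_integrable lebesgue ?I (\<lambda>s. energy K \<Omega> (V_RL s) (V s))"
    by (rule set_integrable_subset[OF work_bound(3)[OF n1(1)]]) (use t_nonneg[OF n1(2)] in auto)
  have fI: "set_integrable lebesgue ?I (\<lambda>s. L2_inner \<Omega> (f s) (V s))"
    by (rule set_integrable_subset[OF work_bound(4)[OF n1(1)]]) (use t_nonneg[OF n1(2)] in auto)
  have scheme: "L2_inner \<Omega> (\<lambda>x. w x - v (n - 1) x) (right_value X (t (n - 1)))
        + (LINT s:?I|lebesgue. L2_inner \<Omega> (time_derivative U s) (X s) + energy K \<Omega> (RL_derivative \<alpha> U s) (X s))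
        = (LINT s:?I|lebesgue. L2_inner \<Omega> (f s) (X s))"
    using solution n X(1) unfolding dg_solution_def v_def w_def by blast
  have rv: "right_value X (t (n - 1)) = X (t (n - 1))" unfolding XC by (rule right_value_time_poly)
  have jump: "L2_inner \<Omega> (\<lambda>x. w x - v (n - 1) x) (right_value X (t (n - 1))) = L2_inner \<Omega> (\<lambda>x. w x - v (n - 1) x) w"
    unfolding rv by (rule L2_inner_cong) (simp_all add: w)
  have "(LINT s:?I|lebesgue. L2_inner \<Omega> (time_derivative U s) (X s) + energy K \<Omega> (RL_derivative \<alpha> U s) (X s))
      = (LINT s:?I|lebesgue. L2_inner \<Omega> (time_poly_deriv (p n) C s) (X s) + energy K \<Omega> (V_RL s) (V s))"
  proof (rule set_integral_cong_AE_lebesgue[OF set_integral_add(1)[OF FTC(1) eI]])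
    show "AE s in lebesgue. s \<in> ?I \<longrightarrow> L2_inner \<Omega> (time_derivative U s) (X s) + energy K \<Omega> (RL_derivative \<alpha> U s) (X s)
        = L2_inner \<Omega> (time_poly_deriv (p n) C s) (X s) + energy K \<Omega> (V_RL s) (V s)"
      using AE_open_interval[of n]
    proof eventually_elim
      case (elim s)
      show ?case
      proof
        assume "s \<in> ?I"
        then have s: "t (n - 1) < s" "s < t n" using elim by auto
        have "L2_inner \<Omega> (time_derivative U s) (X s) = L2_inner \<Omega> (time_poly_deriv (p n) C s) (X s)"
          by (rule L2_inner_cong[OF dU[OF s] refl])
        moreover have "energy K \<Omega> (RL_derivative \<alpha> U s) (X s) = energy K \<Omega> (V_RL s) (V s)"
        proof (rule energy_cong[OF RL_derivative_U[OF n s]])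
          show "X s x = V s x" if "x \<in> \<Omega>" for x using UX[OF s that] U_eq_V[OF n s that] by simp
        qed
        ultimately show "L2_inner \<Omega> (time_derivative U s) (X s) + energy K \<Omega> (RL_derivative \<alpha> U s) (X s)
            = L2_inner \<Omega> (time_poly_deriv (p n) C s) (X s) + energy K \<Omega> (V_RL s) (V s)" by simp
      qed
    qed
  qed
  also have "\<dots> = (L2_inner \<Omega> (X (t n)) (X (t n)) - L2_inner \<Omega> (X (t (n - 1))) (X (t (n - 1)))) / 2
      + (LINT s:?I|lebesgue. energy K \<Omega> (V_RL s) (V s))"
    by (simp only: set_integral_add(2)[OF FTC(1) eI] FTC(2))
  also have "L2_inner \<Omega> (X (t n)) (X (t n)) = L2_inner \<Omega> (v n) (v n)"
    by (rule L2_inner_cong) (simp_all add: vn)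
  also have "L2_inner \<Omega> (X (t (n - 1))) (X (t (n - 1))) = L2_inner \<Omega> w w"
    by (rule L2_inner_cong) (simp_all add: w)
  also have "(LINT s:?I|lebesgue. energy K \<Omega> (V_RL s) (V s)) = state_energy_upto n - state_energy_upto (n - 1)"
    unfolding state_energy_upto_def
    using set_integral_split[OF work_bound(3)[OF n1(1)] t_nonneg[OF n1(2)] less_imp_le[OF step]] by simp
  finally have lhs: "(LINT s:?I|lebesgue. L2_inner \<Omega> (time_derivative U s) (X s) + energy K \<Omega> (RL_derivative \<alpha> U s) (X s))
      = (L2_inner \<Omega> (v n) (v n) - L2_inner \<Omega> w w) / 2 + (state_energy_upto n - state_energy_upto (n - 1))" .
  have "(LINT s:?I|lebesgue. L2_inner \<Omega> (f s) (X s)) = (LINT s:?I|lebesgue. L2_inner \<Omega> (f s) (V s))"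
  proof (rule set_integral_cong_AE_lebesgue[OF fI])
    show "AE s in lebesgue. s \<in> ?I \<longrightarrow> L2_inner \<Omega> (f s) (X s) = L2_inner \<Omega> (f s) (V s)"
      using AE_open_interval[of n]
    proof eventually_elim
      case (elim s)
      show ?case
      proof
        assume "s \<in> ?I"
        then have s: "t (n - 1) < s" "s < t n" using elim by auto
        show "L2_inner \<Omega> (f s) (X s) = L2_inner \<Omega> (f s) (V s)"
        proof (rule L2_inner_cong[OF refl])
          show "X s x = V s x" if "x \<in> \<Omega>" for x using UX[OF s that] U_eq_V[OF n s that] by simp
        qed
      qed
    qed
  qed
  also have "\<dots> = work_upto n - work_upto (n - 1)"
    unfolding work_upto_def
    using set_integral_split[OF work_bound(4)[OF n1(1)] t_nonneg[OF n1(2)] less_imp_le[OF step]] by simp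
  finally have rhs: "(LINT s:?I|lebesgue. L2_inner \<Omega> (f s) (X s)) = work_upto n - work_upto (n - 1)" .
  have id: "L2_inner \<Omega> (\<lambda>x. w x - v (n - 1) x) w
      + ((L2_inner \<Omega> (v n) (v n) - L2_inner \<Omega> w w) / 2 + (state_energy_upto n - state_energy_upto (n - 1)))
      = work_upto n - work_upto (n - 1)"
    using scheme unfolding jump lhs rhs .
  have "L2_inner \<Omega> (\<lambda>x. w x - v (n - 1) x) w = L2_inner \<Omega> w w - L2_inner \<Omega> (v (n - 1)) w"
    by (rule L2_inner_diff_left[OF wL2 v wL2])
  moreover have "L2_inner \<Omega> (\<lambda>x. w x - v (n - 1) x) (\<lambda>x. w x - v (n - 1) x)
      = L2_inner \<Omega> w w - L2_inner \<Omega> w (v (n - 1)) - (L2_inner \<Omega> (v (n - 1)) w - L2_inner \<Omega> (v (n - 1)) (v (n - 1)))"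
    by (rule L2_inner_diff_diff[OF wL2 v wL2 v])
  ultimately show "L2_inner \<Omega> (v n) (v n) + L2_inner \<Omega> (\<lambda>x. w x - v (n - 1) x) (\<lambda>x. w x - v (n - 1) x)
      + 2 * (state_energy_upto n - state_energy_upto (n - 1))
      = L2_inner \<Omega> (v (n - 1)) (v (n - 1)) + 2 * (work_upto n - work_upto (n - 1))"
    using id L2_inner_commute[of \<Omega> w "v (n - 1)"] by (simp add: field_simps)
qed

lemma energy_inequality:
  assumes "n \<le> N"
  shows "node_minus U0 t U n \<in> L2_space \<Omega> \<and>
    L2_inner \<Omega> (node_minus U0 t U n) (node_minus U0 t U n) + 2 * state_energy_upto n
    \<le> L2_inner \<Omega> U0 U0 + 2 * work_upto n"
  using assms
proof (induction n)
  case 0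
  have z: "(LINT s:{0::real}|lebesgue. h s) = 0" for h :: "real \<Rightarrow> real"
  proof -
    have "(LINT s:{0::real}|lebesgue. h s) = (\<integral>s. 0 \<partial>(lebesgue :: real measure))"
      unfolding set_lebesgue_integral_def
    proof (rule integral_cong_AE)
      show eq: "AE s in lebesgue. indicator {0} s *\<^sub>R h s = (0::real)"
        using AE_completion[OF AE_lborel_singleton[of 0]] by eventually_elim simp
      have eq': "AE s in lebesgue. (0::real) = indicator {0} s *\<^sub>R h s" using eq by eventually_elim simp
      show "(\<lambda>s. indicator {0} s *\<^sub>R h s) \<in> borel_measurable lebesgue"
        by (rule borel_measurable_AE[OF _ eq']) simp
    qed simp
    then show ?thesis by simp
  qed
  show ?case using U0 by (simp add: node_minus_def state_energy_upto_def work_upto_def t_0 z)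
next
  case (Suc n)
  have IH: "node_minus U0 t U n \<in> L2_space \<Omega>"
      "L2_inner \<Omega> (node_minus U0 t U n) (node_minus U0 t U n) + 2 * state_energy_upto n \<le> L2_inner \<Omega> U0 U0 + 2 * work_upto n"
    using Suc by auto
  have m: "Suc n \<in> {1..N}" using Suc by simp
  note ii = interval_identity[OF m, unfolded diff_Suc_1, OF IH(1)]
  show ?case
    using ii(1,3) IH(2) L2_inner_self_nonneg[of \<Omega> "\<lambda>x. right_value U (t n) x - node_minus U0 t U n x"] by simp
qed

text \<open>The value \<open>w = U\<^sup>n\<^sup>-\<^sup>1\<^sub>+\<close> is not controlled by the balance at \<open>t n\<close> alone, but
  \<open>\<parallel>w\<parallel>\<^sup>2 \<le> 2 \<parallel>U\<^sup>n\<^sup>-\<^sup>1\<^sub>-\<parallel>\<^sup>2 + 2 \<parallel>w - U\<^sup>n\<^sup>-\<^sup>1\<^sub>-\<parallel>\<^sup>2\<close>, where the first term is controlled by the balance at the previous node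
  and the jump by the balance at \<open>t n\<close>. Twice the sum of both balances bounds the left-hand side.\<close>

lemma stability:
  assumes n: "n \<in> {1..N}"
  defines "d \<equiv> 1 / cos (\<alpha> * pi / 2)"
  shows "L2_inner \<Omega> (node_minus U0 t U n) (node_minus U0 t U n)
      + L2_inner \<Omega> (right_value U (t (n - 1))) (right_value U (t (n - 1))) + 2 * state_energy_upto n
    \<le> 4 * L2_inner \<Omega> U0 U0 + 4 * d\<^sup>2 * source_energy_upto n"
proof -
  have n1: "n \<le> N" "n - 1 \<le> N" using n by auto
  let ?v = "node_minus U0 t U n" and ?v' = "node_minus U0 t U (n - 1)" and ?w = "right_value U (t (n - 1))"
  let ?a = "L2_inner \<Omega> U0 U0" and ?J = "L2_inner \<Omega> (\<lambda>x. ?w x - ?v' x) (\<lambda>x. ?w x - ?v' x)"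
  define E E' F F' G G' where "E = state_energy_upto n" "E' = state_energy_upto (n - 1)" "F = work_upto n"
    "F' = work_upto (n - 1)" "G = source_energy_upto n" "G' = source_energy_upto (n - 1)"
  note defs = this
  have v': "?v' \<in> L2_space \<Omega>" and A': "L2_inner \<Omega> ?v' ?v' + 2 * E' \<le> ?a + 2 * F'"
    using energy_inequality[OF n1(2)] by (auto simp: defs)
  note ii = interval_identity[OF n v']
  have A: "L2_inner \<Omega> ?v ?v + ?J + 2 * E \<le> ?a + 2 * F" using ii(3) A' by (simp add: defs)
  have w: "L2_inner \<Omega> ?w ?w \<le> 2 * L2_inner \<Omega> ?v' ?v' + 2 * ?J"
  proof -
    have "0 \<le> L2_inner \<Omega> (\<lambda>x. ?w x - 2 *\<^sub>R ?v' x) (\<lambda>x. ?w x - 2 *\<^sub>R ?v' x)" by (rule L2_inner_self_nonneg)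
    then show ?thesis
      using L2_inner_quadratic[OF ii(2) v', of 2] L2_inner_quadratic[OF ii(2) v', of 1] by simp
  qed
  have Epos: "0 \<le> E" "0 \<le> E'" using work_bound(2) n1 by (auto simp: defs)
  have Gpos: "0 \<le> source_energy_upto m" for m
    unfolding source_energy_upto_def set_lebesgue_integral_def by (rule Bochner_Integration.integral_nonneg) simp
  have G': "G' \<le> G"
    unfolding defs source_energy_upto_def
    by (rule set_integral_mono_interval[OF work_bound(5)[OF n1(1)] t_nonneg[OF n1(2)] less_imp_le[OF t_step[OF n]]]) simp
  have young: "2 * f \<le> k * e + d\<^sup>2 * g / k" if "\<bar>f\<bar> \<le> d * sqrt g * sqrt e" "0 \<le> e" "0 \<le> g" "0 < k" for f k e g :: real
  proof -
    have "0 \<le> (sqrt k * sqrt e - d * sqrt g / sqrt k)\<^sup>2" by simp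
    also have "\<dots> = k * e + d\<^sup>2 * g / k - 2 * (d * sqrt g * sqrt e)"
      using that by (simp add: power2_diff power_mult_distrib power_divide)
    finally show ?thesis using that(1) by simp
  qed
  \<comment> \<open>After doubling, the balance at \<open>t n\<close> has \<open>4 E\<close> on the left, of which \<open>2 E\<close> must survive; the balance at the
    previous node may use up all of its \<open>2 E'\<close>. Together the weights cost \<open>2 d\<^sup>2 G + d\<^sup>2 G\<close>.\<close>
  have F: "2 * F \<le> 1 * E + d\<^sup>2 * G / 1"
    by (rule young) (use work_bound(1)[OF n1(1)] Epos Gpos in \<open>auto simp: defs d_def\<close>)
  have F': "2 * F' \<le> 2 * E' + d\<^sup>2 * G' / 2"
    by (rule young) (use work_bound(1)[OF n1(2)] Epos Gpos in \<open>auto simp: defs d_def\<close>)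
  have "d\<^sup>2 * G' \<le> d\<^sup>2 * G" using G' by (intro mult_left_mono) auto
  moreover have "0 \<le> d\<^sup>2 * G" using Gpos by (simp add: defs)
  moreover have "0 \<le> L2_inner \<Omega> ?v ?v" by (rule L2_inner_self_nonneg)
  ultimately have "L2_inner \<Omega> ?v ?v + L2_inner \<Omega> ?w ?w + 2 * E \<le> 4 * ?a + 4 * (d\<^sup>2 * G)"
    using A A' w F F' by simp
  then show ?thesis by (simp add: defs mult.assoc)
qed

end

theorem theorem1:
  fixes \<alpha> T K :: real
    and \<Omega> :: "'a::euclidean_space set"
    and \<phi> :: "nat \<Rightarrow> 'a \<Rightarrow> real"
    and lam :: "nat \<Rightarrow> real"
    and N :: nat
    and t :: "nat \<Rightarrow> real"
    and p :: "nat \<Rightarrow> nat"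
    and f U :: "real \<Rightarrow> 'a \<Rightarrow> real"
    and U0 :: "'a \<Rightarrow> real"
  defines "d \<equiv> 1 / cos (\<alpha> * pi / 2)"
    and "g \<equiv> frac_integral (- \<alpha>) f"
  assumes "- 1 < \<alpha>" and "\<alpha> < 0" and "T > 0" and "K > 0"
    and "polyhedral_domain \<Omega>"
    and "dirichlet_eigensystem K \<Omega> \<phi> lam"
    and "time_mesh T N t"
    and "regular_source \<alpha> T \<Omega> f"
    and "U0 \<in> L2_space \<Omega>"
    and "dg_solution \<alpha> K \<Omega> N t p f U0 U"
  shows "\<forall>n\<in>{1..N}.
    (L2_norm \<Omega> (node_minus U0 t U n))\<^sup>2 + (L2_norm \<Omega> (right_value U (t (n - 1))))\<^sup>2
      + 2 * (LINT s:{0..t n}|lebesgue. energy K \<Omega> (RL_derivative \<alpha> U s) (U s))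
    \<le> 4 * (L2_norm \<Omega> (node_minus U0 t U 0))\<^sup>2
      + 4 * d\<^sup>2 * (LINT s:{0..t n}|lebesgue. \<bar>L2_inner \<Omega> (g s) (dirichlet_inverse K \<Omega> (f s))\<bar>)"
proof
  have "\<Omega> \<in> lmeasurable"
  proof -
    obtain F where F: "finite F" "\<forall>P\<in>F. polytope P" "\<Omega> = interior (\<Union>F)"
      using assms(7) by (auto simp: polyhedral_domain_def)
    have "bounded (\<Union>F)" using F(1,2) by (intro bounded_Union) (auto simp: polytope_imp_bounded)
    then have "bounded \<Omega>" unfolding F(3) by (rule bounded_subset[OF _ interior_subset])
    then show ?thesis unfolding F(3) by (intro lmeasurable_open) auto
  qed
  then interpret dirichlet_problem K \<Omega> \<phi> lam
    using assms by unfold_locales auto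
  have dg: "U \<in> dg_space \<Omega> N t p" using assms(12) by (simp add: dg_solution_def)
  obtain P c where Pc: "\<And>i. i \<in> {..<N} \<times> {..P::nat} \<Longrightarrow> c i \<in> H10_space \<Omega>"
    "\<And>n s x. n \<in> {1..N} \<Longrightarrow> t (n - 1) < s \<Longrightarrow> s < t n \<Longrightarrow> x \<in> \<Omega> \<Longrightarrow>
      U s x = (\<Sum>i\<in>{..<N} \<times> {..P}. trunc_power (t (fst i)) (snd i) s * c i x)"
    by (rule dg_space_truncated_powers[OF assms(9) dg]) (rule that)
  interpret dg_representation K \<Omega> \<phi> lam \<alpha> T N t p f U U0 P c
    by unfold_locales (fact assms Pc)+
  fix n assume n: "n \<in> {1..N}"
  then have "n \<le> N" by simp
  from stability[OF n]
  show "(L2_norm \<Omega> (node_minus U0 t U n))\<^sup>2 + (L2_norm \<Omega> (right_value U (t (n - 1))))\<^sup>2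
      + 2 * (LINT s:{0..t n}|lebesgue. energy K \<Omega> (RL_derivative \<alpha> U s) (U s))
    \<le> 4 * (L2_norm \<Omega> (node_minus U0 t U 0))\<^sup>2
      + 4 * d\<^sup>2 * (LINT s:{0..t n}|lebesgue. \<bar>L2_inner \<Omega> (g s) (dirichlet_inverse K \<Omega> (f s))\<bar>)"
    unfolding L2_norm_power2 energy_U[OF \<open>n \<le> N\<close>] source_energy_upto_def d_def g_def
    by (simp only: node_minus_def if_True refl)
qed

end
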